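(* Let $A\in GL(n,\mathbb Z)$ and let $M(A)$ be the mapping torus of the diffeomorphism of the $n$-dimensional torus $\mathbb R^n/\mathbb Z^n$ induced by $A$. Then $M(A)$ is parallelizable if $\det(A)=1$, and $M(A)$ is not orientable (hence not stably parallelizable) if $\det(A)=-1$.
   Context: Let $\mathbb T=\mathbb R^n/\mathbb Z^n$ and let $\alpha:\mathbb T\to\mathbb T$ be the diffeomorphism induced by the linear automorphism $v\mapsto Av$ of $\mathbb R^n$. The manifold $M(A)$ is the smooth compact manifold $(\mathbb T\times [0,1])/\!\sim$, where $(a,0)\sim(\alpha(a),1)$ for all $a\in\mathbb T$. It is a compact solvmanifold with fundamental group $\mathbb Z^n\rtimes\mathbb Z$, the $\mathbb Z$-action on $\mathbb Z^n$ being generated by $A$. A smooth manifold $M$ is parallelizable if its tangent bundle $\tau M$ is trivial, and stably parallelizable if $\tau M\oplus k\epsilon$ is trivial for some $k\ge 1$, where $\epsilon$ is the trivial real line bundle. *)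

theory Defs
  imports "HOL-Analysis.Analysis"
begin

section \<open>Smooth manifolds\<close>

text \<open>Differentiability of all orders on open subsets of normed spaces, by iterating
  directional derivatives; in finite dimension this is the usual notion of \<open>C\<^sup>k\<close>.\<close>

primrec Ck_on :: "nat \<Rightarrow> ('a::real_normed_vector \<Rightarrow> 'b::real_normed_vector) \<Rightarrow> 'a set \<Rightarrow> bool" where
  "Ck_on 0 f S \<longleftrightarrow> continuous_on S f"
| "Ck_on (Suc k) f S \<longleftrightarrow>
     (\<forall>x\<in>S. f differentiable (at x)) \<and> (\<forall>v. Ck_on k (\<lambda>x. frechet_derivative f (at x) v) S)"

definition smooth_on :: "('a::real_normed_vector \<Rightarrow> 'b::real_normed_vector) \<Rightarrow> 'a set \<Rightarrow> bool" where
  "smooth_on f S \<longleftrightarrow> (\<forall>k. Ck_on k f S)"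

text \<open>A chart is a pair of a domain and a coordinate map into \<open>\<real>\<^sup>m\<close>. The values of the
  coordinate map outside the domain are irrelevant.\<close>

type_synonym ('p, 'm) chart = "'p set \<times> ('p \<Rightarrow> real^'m)"

definition is_chart :: "'p topology \<Rightarrow> ('p, 'm::finite) chart \<Rightarrow> bool" where
  "is_chart X c \<longleftrightarrow> openin X (fst c) \<and> open (snd c ` fst c) \<and>
     homeomorphic_map (subtopology X (fst c)) (top_of_set (snd c ` fst c)) (snd c)"

definition transition :: "('p, 'm::finite) chart \<Rightarrow> ('p, 'm) chart \<Rightarrow> real^'m \<Rightarrow> real^'m" where
  "transition c d = snd d \<circ> inv_into (fst c) (snd c)"

definition smooth_atlas :: "'p topology \<Rightarrow> ('p, 'm::finite) chart set \<Rightarrow> bool" where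
  "smooth_atlas X \<A> \<longleftrightarrow>
     (\<forall>c\<in>\<A>. is_chart X c) \<and> (\<Union>c\<in>\<A>. fst c) = topspace X \<and>
     (\<forall>c\<in>\<A>. \<forall>d\<in>\<A>. smooth_on (transition c d) (snd c ` (fst c \<inter> fst d)))"

record ('p, 'm::finite) manifold =
  mtop :: "'p topology"
  matlas :: "('p, 'm) chart set"

definition smooth_manifold :: "('p, 'm::finite) manifold \<Rightarrow> bool" where
  "smooth_manifold M \<longleftrightarrow>
     Hausdorff_space (mtop M) \<and> second_countable (mtop M) \<and> smooth_atlas (mtop M) (matlas M)"

text \<open>An orienting atlas only has to be compatible with the given atlas, i.e. it consists of
  charts of the given smooth structure.\<close>

definition orientable :: "('p, 'm::finite) manifold \<Rightarrow> bool" where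
  "orientable M \<longleftrightarrow>
     (\<exists>\<B>. smooth_atlas (mtop M) \<B> \<and> smooth_atlas (mtop M) (matlas M \<union> \<B>) \<and>
        (\<forall>c\<in>\<B>. \<forall>d\<in>\<B>. \<forall>p\<in>fst c \<inter> fst d. det (jacobian (transition c d) (at (snd c p))) > 0))"


section \<open>Vector bundles\<close>

text \<open>The data of a real vector bundle; addition is only meaningful within a fibre.
  Isomorphisms are those of topological vector bundles: homeomorphisms over the base that are
  linear on fibres.\<close>

record ('p, 't) vbundle =
  base :: "'p topology"
  total :: "'t topology"
  proj :: "'t \<Rightarrow> 'p"
  vadd :: "'t \<Rightarrow> 't \<Rightarrow> 't"
  vscale :: "real \<Rightarrow> 't \<Rightarrow> 't"

definition vbundle_iso :: "('p, 't) vbundle \<Rightarrow> ('p, 'u) vbundle \<Rightarrow> ('t \<Rightarrow> 'u) \<Rightarrow> bool" where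
  "vbundle_iso E F f \<longleftrightarrow> base E = base F \<and> homeomorphic_map (total E) (total F) f \<and>
     (\<forall>u\<in>topspace (total E). proj F (f u) = proj E u) \<and>
     (\<forall>u\<in>topspace (total E). \<forall>v\<in>topspace (total E). proj E u = proj E v \<longrightarrow>
        f (vadd E u v) = vadd F (f u) (f v)) \<and>
     (\<forall>r. \<forall>u\<in>topspace (total E). f (vscale E r u) = vscale F r (f u))"

text \<open>The product bundle \<open>k\<epsilon> = X \<times> \<real>\<^sup>k\<close>, the \<open>k\<close>-fold sum of the trivial line bundle.
  Here \<open>\<real>\<^sup>k\<close> is \<^term>\<open>Euclidean_space k\<close>, the sequences vanishing from index \<open>k\<close> on.\<close>

definition product_bundle :: "'p topology \<Rightarrow> nat \<Rightarrow> ('p, 'p \<times> (nat \<Rightarrow> real)) vbundle" where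
  "product_bundle X k = \<lparr>
     base = X,
     total = prod_topology X (Euclidean_space k),
     proj = fst,
     vadd = (\<lambda>(p, v) (q, w). (p, \<lambda>i. v i + w i)),
     vscale = (\<lambda>r (p, v). (p, \<lambda>i. r * v i)) \<rparr>"

definition trivial_bundle :: "('p, 't) vbundle \<Rightarrow> bool" where
  "trivial_bundle E \<longleftrightarrow> (\<exists>k f. vbundle_iso E (product_bundle (base E) k) f)"

definition whitney_sum :: "('p, 't) vbundle \<Rightarrow> ('p, 'u) vbundle \<Rightarrow> ('p, 't \<times> 'u) vbundle" where
  "whitney_sum E F = \<lparr>
     base = base E,
     total = subtopology (prod_topology (total E) (total F)) {(u, v). proj E u = proj F v},
     proj = (\<lambda>(u, v). proj E u),
     vadd = (\<lambda>(u, v) (u', v'). (vadd E u u', vadd F v v')),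
     vscale = (\<lambda>r (u, v). (vscale E r u, vscale F r v)) \<rparr>"

text \<open>A tangent vector at \<open>p\<close> is a pair \<open>(p, v)\<close>, where \<open>v\<close> gives the coordinates of the
  vector in every chart around \<open>p\<close> and these coordinates transform by the derivatives of the
  transition maps. For charts that do not contain \<open>p\<close> the component is set to zero, so that
  \<open>v\<close> is uniquely determined by the tangent vector.\<close>

definition tangent_vectors ::
    "('p, 'm::finite) manifold \<Rightarrow> ('p \<times> (('p, 'm) chart \<Rightarrow> real^'m)) set" where
  "tangent_vectors M = {(p, v). p \<in> topspace (mtop M) \<and>
     (\<forall>c. c \<notin> matlas M \<or> p \<notin> fst c \<longrightarrow> v c = 0) \<and>
     (\<forall>c\<in>matlas M. \<forall>d\<in>matlas M. p \<in> fst c \<inter> fst d \<longrightarrow>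
        v d = frechet_derivative (transition c d) (at (snd c p)) (v c))}"

text \<open>The topology of the tangent bundle has as a base the sets which correspond, for some chart
  \<open>c = (U, \<phi>)\<close>, to an open subset of \<open>\<phi>(U) \<times> \<real>\<^sup>m\<close>.\<close>

definition tangent_topology ::
    "('p, 'm::finite) manifold \<Rightarrow> ('p \<times> (('p, 'm) chart \<Rightarrow> real^'m)) topology" where
  "tangent_topology M = topology_generated_by
     {{(p, v) \<in> tangent_vectors M. p \<in> fst c \<and> (snd c p, v c) \<in> G} | c G. c \<in> matlas M \<and> open G}"

definition tangent_bundle ::
    "('p, 'm::finite) manifold \<Rightarrow> ('p, 'p \<times> (('p, 'm) chart \<Rightarrow> real^'m)) vbundle" where
  "tangent_bundle M = \<lparr>
     base = mtop M,
     total = tangent_topology M,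
     proj = fst,
     vadd = (\<lambda>(p, v) (q, w). (p, \<lambda>c. v c + w c)),
     vscale = (\<lambda>r (p, v). (p, \<lambda>c. r *\<^sub>R v c)) \<rparr>"

definition parallelizable :: "('p, 'm::finite) manifold \<Rightarrow> bool" where
  "parallelizable M \<longleftrightarrow> trivial_bundle (tangent_bundle M)"

definition stably_parallelizable :: "('p, 'm::finite) manifold \<Rightarrow> bool" where
  "stably_parallelizable M \<longleftrightarrow>
     (\<exists>k\<ge>1. trivial_bundle (whitney_sum (tangent_bundle M) (product_bundle (mtop M) k)))"


section \<open>The mapping torus\<close>

definition quotient_topology :: "'a topology \<Rightarrow> ('a \<times> 'a) set \<Rightarrow> 'a set topology" where
  "quotient_topology X r =
     topology (\<lambda>U. U \<subseteq> topspace X // r \<and> openin X {x \<in> topspace X. r `` {x} \<in> U})"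

definition torus_rel :: "((real^'n) \<times> (real^'n)) set" where
  "torus_rel = {(x, y). \<forall>i. y $ i - x $ i \<in> \<int>}"

definition torus_proj :: "real^'n \<Rightarrow> (real^'n) set" where
  "torus_proj x = torus_rel `` {x}"

definition torus :: "(real^'n) set topology" where
  "torus = quotient_topology euclidean torus_rel"

text \<open>For \<open>A \<in> GL(n,\<int>)\<close> the image of the coset \<open>x + \<int>\<^sup>n\<close> under \<open>A\<close> is the coset
  \<open>A x + \<int>\<^sup>n\<close>, so the induced map on the torus is the image map.\<close>

definition torus_aut :: "int^'n^'n \<Rightarrow> (real^'n) set \<Rightarrow> (real^'n) set" where
  "torus_aut A a = (\<lambda>x. map_matrix real_of_int A *v x) ` a"

definition cylinder :: "((real^'n) set \<times> real) topology" where
  "cylinder = prod_topology torus (top_of_set {0..1})"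

inductive seam :: "int^'n^'n \<Rightarrow> (real^'n) set \<times> real \<Rightarrow> (real^'n) set \<times> real \<Rightarrow> bool"
  for A where
  "a \<in> topspace torus \<Longrightarrow> seam A (a, 0) (torus_aut A a, 1)"

definition mt_rel ::
    "int^'n^'n \<Rightarrow> (((real^'n) set \<times> real) \<times> ((real^'n) set \<times> real)) set" where
  "mt_rel A = {(u, v). u \<in> topspace cylinder \<and> v \<in> topspace cylinder \<and> equivclp (seam A) u v}"

definition mt_proj :: "int^'n^'n \<Rightarrow> (real^'n) set \<times> real \<Rightarrow> ((real^'n) set \<times> real) set" where
  "mt_proj A u = mt_rel A `` {u}"

text \<open>The smooth structure of the mapping torus. The coordinates \<open>z \<in> \<real>\<^sup>n\<^sup>+\<^sup>1\<close> are indexed by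
  \<^typ>\<open>'n option\<close>: the components \<open>Some i\<close> are coordinates on the torus and \<open>None\<close> is the
  coordinate on the interval. There are charts in the interior of the cylinder and charts across
  the seam; the latter attach the end \<open>t \<rightarrow> 1\<close> of the cylinder to its beginning by means of
  the identification of \<open>(a, 0)\<close> with \<open>(\<alpha>(a), 1)\<close>. The charts are the inverses of the
  parametrizations below, restricted to products of an interval and an open set which injects
  into the torus.\<close>

definition torus_part :: "real^('n option) \<Rightarrow> real^'n" where
  "torus_part z = (\<chi> i. z $ Some i)"

definition interior_param :: "int^'n^'n \<Rightarrow> real^('n option) \<Rightarrow> ((real^'n) set \<times> real) set" where
  "interior_param A z = mt_proj A (torus_proj (torus_part z), z $ None)"

definition seam_param :: "int^'n^'n \<Rightarrow> real^('n option) \<Rightarrow> ((real^'n) set \<times> real) set" where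
  "seam_param A z =
     (if z $ None \<ge> 0 then mt_proj A (torus_proj (torus_part z), z $ None)
      else mt_proj A (torus_aut A (torus_proj (torus_part z)), z $ None + 1))"

definition inverse_chart :: "(real^'m \<Rightarrow> 'p) \<Rightarrow> (real^'m) set \<Rightarrow> ('p, 'm::finite) chart" where
  "inverse_chart P D = (P ` D, inv_into D P)"

definition coord_box :: "(real^'n) set \<Rightarrow> real set \<Rightarrow> (real^('n option)) set" where
  "coord_box W J = {z. torus_part z \<in> W \<and> z $ None \<in> J}"

definition mapping_torus ::
    "int^'n^'n \<Rightarrow> (((real^'n) set \<times> real) set, 'n option) manifold" where
  "mapping_torus A = \<lparr>
     mtop = quotient_topology cylinder (mt_rel A),
     matlas =
       {inverse_chart (interior_param A) (coord_box W {0<..<1}) | W.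
          open W \<and> inj_on torus_proj W} \<union>
       {inverse_chart (seam_param A) (coord_box W {-1/2<..<1/2}) | W.
          open W \<and> inj_on torus_proj W} \<rparr>"


section \<open>The mapping torus is a compact smooth manifold\<close>

text \<open>The final lemmas of this section confirm that, for \<open>A \<in> GL(n,\<int>)\<close>, the charts
  above do define a smooth structure on the quotient space.\<close>

lemma istopology_quotient:
  "istopology (\<lambda>U. U \<subseteq> topspace X // r \<and> openin X {x \<in> topspace X. r `` {x} \<in> U})"
  unfolding istopology_def
proof (intro conjI allI impI)
  fix S T assume S: "S \<subseteq> topspace X // r \<and> openin X {x \<in> topspace X. r `` {x} \<in> S}"
    and T: "T \<subseteq> topspace X // r \<and> openin X {x \<in> topspace X. r `` {x} \<in> T}"
  show "S \<inter> T \<subseteq> topspace X // r" using S by blast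
  have "{x \<in> topspace X. r `` {x} \<in> S \<inter> T} =
     {x \<in> topspace X. r `` {x} \<in> S} \<inter> {x \<in> topspace X. r `` {x} \<in> T}" by blast
  then show "openin X {x \<in> topspace X. r `` {x} \<in> S \<inter> T}" using S T by auto
next
  fix \<K> assume K: "\<forall>K\<in>\<K>. K \<subseteq> topspace X // r \<and> openin X {x \<in> topspace X. r `` {x} \<in> K}"
  then show "\<Union>\<K> \<subseteq> topspace X // r" by blast
  have "{x \<in> topspace X. r `` {x} \<in> \<Union>\<K>} = \<Union>((\<lambda>K. {x \<in> topspace X. r `` {x} \<in> K}) ` \<K>)" by blast
  then show "openin X {x \<in> topspace X. r `` {x} \<in> \<Union>\<K>}" using K by auto
qed

lemma openin_quotient_topology:
  "openin (quotient_topology X r) U \<longleftrightarrow>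
     U \<subseteq> topspace X // r \<and> openin X {x \<in> topspace X. r `` {x} \<in> U}"
  unfolding quotient_topology_def by (simp add: topology_inverse'[OF istopology_quotient])

lemma topspace_quotient_topology: "topspace (quotient_topology X r) = topspace X // r"
proof -
  have "{x \<in> topspace X. r `` {x} \<in> topspace X // r} = topspace X"
    by (auto simp: quotient_def)
  then have "openin (quotient_topology X r) (topspace X // r)"
    by (simp add: openin_quotient_topology)
  then have "topspace X // r \<subseteq> topspace (quotient_topology X r)"
    by (rule openin_subset)
  moreover have "topspace (quotient_topology X r) \<subseteq> topspace X // r"
    using openin_topspace[of "quotient_topology X r"] unfolding openin_quotient_topology by blast
  ultimately show ?thesis by blast
qed

lemma quotient_map_quotient_topology:
  "quotient_map X (quotient_topology X r) (\<lambda>x. r `` {x})"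
  unfolding quotient_map_def
  by (auto simp: openin_quotient_topology topspace_quotient_topology quotient_def)

lemma equiv_torus_rel: "equiv UNIV (torus_rel :: ((real^'n) \<times> (real^'n)) set)"
proof (rule equivI)
  show "sym (torus_rel :: ((real^'n) \<times> (real^'n)) set)"
  proof (rule symI)
    fix x y :: "real^'n" assume "(x, y) \<in> torus_rel"
    then have "- (y $ i - x $ i) \<in> \<int>" for i by (intro Ints_minus) (simp add: torus_rel_def)
    then show "(y, x) \<in> torus_rel" by (simp add: torus_rel_def)
  qed
  show "trans (torus_rel :: ((real^'n) \<times> (real^'n)) set)"
  proof (rule transI)
    fix x y z :: "real^'n" assume "(x, y) \<in> torus_rel" "(y, z) \<in> torus_rel"
    then have "(y $ i - x $ i) + (z $ i - y $ i) \<in> \<int>" for i by (intro Ints_add) (auto simp: torus_rel_def)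
    then show "(x, z) \<in> torus_rel" by (simp add: torus_rel_def)
  qed
qed (auto simp: torus_rel_def refl_on_def)

lemma torus_proj_eq: "torus_proj x = torus_proj y \<longleftrightarrow> (\<forall>i. y $ i - x $ i \<in> \<int>)"
  using eq_equiv_class_iff[OF equiv_torus_rel, of x y] by (auto simp: torus_rel_def torus_proj_def)

lemma quotient_torus: "quotient_map euclidean torus torus_proj"
  using quotient_map_quotient_topology[of euclidean torus_rel]
  by (simp add: torus_def flip: torus_proj_def)

lemma openin_torus:
  fixes U :: "(real^'n) set set"
  shows "openin torus U \<longleftrightarrow> U \<subseteq> range torus_proj \<and> open {x. torus_proj x \<in> U}"
proof -
  have "UNIV // torus_rel = (range torus_proj :: (real^'n) set set)"
    by (auto simp: quotient_def torus_proj_def)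
  then show ?thesis unfolding torus_def openin_quotient_topology by (simp flip: torus_proj_def)
qed

lemma topspace_torus: "topspace (torus :: (real^'n) set topology) = range torus_proj"
  using quotient_imp_surjective_map[OF quotient_torus, symmetric] by simp

lemma continuous_torus_proj: "continuous_map euclidean torus torus_proj"
  by (rule quotient_imp_continuous_map[OF quotient_torus])

lemma torus_proj_open_map: "open_map euclidean torus (torus_proj :: real^'n \<Rightarrow> _)"
  unfolding open_map_def
proof (intro allI impI)
  fix W :: "(real^'n) set" assume W: "openin euclidean W"
  have "{x. torus_proj x \<in> torus_proj ` W} = (\<Union>m\<in>{m. \<forall>i. m $ i \<in> \<int>}. (\<lambda>x. m + x) ` W)" (is "?L = ?R")
  proof (intro set_eqI iffI)
    fix x assume "x \<in> ?L"
    then obtain w where w: "w \<in> W" "torus_proj x = torus_proj w" by auto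
    then have "\<forall>i. (x - w) $ i \<in> \<int>" using torus_proj_eq[of w x] by auto
    then show "x \<in> ?R" using w by (auto intro!: exI[of _ "x - w"] image_eqI[of _ _ w])
  next
    fix x assume "x \<in> ?R"
    then obtain m w where "\<forall>i. m $ i \<in> \<int>" "w \<in> W" "x = m + w" by auto
    then have "torus_proj w = torus_proj x" by (simp add: torus_proj_eq)
    then show "x \<in> ?L" using \<open>w \<in> W\<close> by auto
  qed
  moreover have "open ?R" using W by (auto intro!: open_UN open_translation)
  ultimately have "open {x. torus_proj x \<in> torus_proj ` W}" by simp
  then show "openin torus (torus_proj ` W)"
    unfolding openin_torus by blast
qed

lemma Hausdorff_torus: "Hausdorff_space (torus :: (real^'n) set topology)"
proof -
  define g where "g a = (\<chi> i. cis (2 * pi * (SOME x. x \<in> a) $ i))" for a :: "(real^'n) set"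
  have g: "g (torus_proj x) = (\<chi> i. cis (2 * pi * x $ i))" for x
  proof -
    have "x \<in> torus_proj x" by (simp add: torus_proj_def torus_rel_def)
    then have "(SOME y. y \<in> torus_proj x) \<in> torus_proj x" by (rule someI)
    then have "\<forall>i. (SOME y. y \<in> torus_proj x) $ i - x $ i \<in> \<int>" by (simp add: torus_proj_def torus_rel_def)
    then have "cis (2 * pi * (SOME y. y \<in> torus_proj x) $ i) = cis (2 * pi * x $ i)" for i
    proof -
      assume "\<forall>i. (SOME y. y \<in> torus_proj x) $ i - x $ i \<in> \<int>"
      then obtain k where "(SOME y. y \<in> torus_proj x) $ i - x $ i = of_int k" by (meson Ints_cases)
      then have e: "2 * pi * (SOME y. y \<in> torus_proj x) $ i = 2 * pi * x $ i + 2 * pi * of_int k"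
        by (simp add: algebra_simps)
      have "cis (2 * pi * of_int k) = 1" by (rule cis_multiple_2pi) simp
      then show ?thesis unfolding e by (simp flip: cis_mult)
    qed
    then show ?thesis by (simp add: g_def vec_eq_iff)
  qed
  have inj: "inj_on g (topspace torus)"
  proof (rule inj_onI)
    fix a b assume "a \<in> topspace torus" "b \<in> topspace torus" and e: "g a = g b"
    then obtain x y where xy: "a = torus_proj x" "b = torus_proj y" by (auto simp: topspace_torus)
    have "y $ i - x $ i \<in> \<int>" for i
    proof -
      have "cis (2 * pi * x $ i) = cis (2 * pi * y $ i)" using e xy g by (simp add: vec_eq_iff)
      then have "cos (2 * pi * x $ i) = cos (2 * pi * y $ i) \<and> sin (2 * pi * x $ i) = sin (2 * pi * y $ i)"
        by (simp add: complex_eq_iff)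
      then obtain k :: int where "2 * pi * y $ i = 2 * pi * x $ i + 2 * pi * k"
        using sin_cos_eq_iff[of "2 * pi * y $ i" "2 * pi * x $ i"] by auto
      then have "2 * pi * (y $ i - x $ i) = 2 * pi * k" by (simp add: algebra_simps)
      then have "y $ i - x $ i = of_int k" by (subst (asm) mult_cancel_left) auto
      then show ?thesis by simp
    qed
    then show "a = b" by (simp add: xy torus_proj_eq)
  qed
  have "continuous_map euclidean euclidean (g \<circ> torus_proj)"
    by (auto simp: g o_def intro!: continuous_intros continuous_on_vec_lambda)
  then have "continuous_map torus euclidean g"
    using continuous_compose_quotient_map_eq[OF quotient_torus] by blast
  then show ?thesis
    by (rule Hausdorff_space_injective_preimage[OF Hausdorff_space_euclidean _ inj])
qed

lemma compact_torus: "compact_space (torus :: (real^'n) set topology)"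
proof -
  have "(topspace torus :: (real^'n) set set) = torus_proj ` cbox 0 1"
  proof -
    have "torus_proj x \<in> torus_proj ` cbox 0 1" for x :: "real^'n"
    proof -
      have "torus_proj x = torus_proj (\<chi> i. frac (x $ i))" by (simp add: torus_proj_eq frac_def)
      moreover have "(\<chi> i. frac (x $ i)) \<in> cbox 0 (1::real^'n)"
        by (auto simp: mem_box_cart frac_ge_0 less_imp_le[OF frac_lt_1])
      ultimately show ?thesis by blast
    qed
    then show ?thesis by (auto simp: topspace_torus)
  qed
  moreover have "compactin torus (torus_proj ` cbox 0 (1::real^'n))"
    by (rule image_compactin[OF _ continuous_torus_proj]) simp
  ultimately show ?thesis by (simp add: compact_space_def)
qed

lemma second_countable_torus: "second_countable (torus :: (real^'n) set topology)"
proof -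
  have "second_countable (euclidean :: (real^'n) topology)"
  proof -
    obtain \<B> :: "(real^'n) set set" where B: "countable \<B>" "topological_basis \<B>"
      using ex_countable_basis by blast
    show ?thesis unfolding second_countable_def
    proof (intro exI[of _ \<B>] conjI ballI allI impI)
      fix V assume "V \<in> \<B>" then show "openin euclidean V"
        using B(2) topological_basis_open by auto
    next
      fix U and x :: "real^'n" assume "openin euclidean U \<and> x \<in> U"
      then show "\<exists>V\<in>\<B>. x \<in> V \<and> V \<subseteq> U"
        using topological_basisE[OF B(2), of U x] by (metis open_openin)
    qed (rule B(1))
  qed
  then show ?thesis
    using second_countable_open_map_image[OF continuous_torus_proj torus_proj_open_map] topspace_torus by auto
qed

abbreviation rmat :: "int^'n^'n \<Rightarrow> real^'n^'n" where "rmat A \<equiv> map_matrix real_of_int A"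

lemma rmat_mult: "rmat (A ** B) = rmat A ** rmat B"
  by (simp add: matrix_matrix_mult_def vec_eq_iff)

lemma rmat_one: "rmat (mat 1) = mat 1"
  by (simp add: mat_def vec_eq_iff)

lemma rmat_Ints: "(\<forall>i. x $ i \<in> \<int>) \<Longrightarrow> (rmat A *v x) $ i \<in> \<int>"
  by (auto simp: matrix_vector_mult_def intro!: Ints_sum Ints_mult)

lemma rmat_inverse:
  assumes "invertible A"
  obtains B where "\<And>x. rmat A *v (rmat B *v x) = x" "\<And>x. rmat B *v (rmat A *v x) = x"
proof -
  obtain B where "A ** B = mat 1" "B ** A = mat 1" using assms unfolding invertible_def by blast
  then have "rmat A ** rmat B = mat 1" "rmat B ** rmat A = mat 1"
    by (metis rmat_mult rmat_one)+
  then show ?thesis by (intro that[of B]) (simp_all add: matrix_vector_mul_assoc)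
qed

lemma torus_aut_proj:
  assumes "invertible A"
  shows "torus_aut A (torus_proj x) = torus_proj (rmat A *v x)"
proof -
  obtain B where B: "\<And>x. rmat A *v (rmat B *v x) = x" "\<And>x. rmat B *v (rmat A *v x) = x"
    using rmat_inverse[OF assms] by blast
  show ?thesis unfolding torus_aut_def torus_rel_def torus_proj_def
  proof (intro set_eqI iffI; clarsimp)
    fix y i assume "\<forall>i. y $ i - x $ i \<in> \<int>"
    then show "(rmat A *v y) $ i - (rmat A *v x) $ i \<in> \<int>"
      using rmat_Ints[of "y - x" A i] by (simp add: matrix_vector_mult_diff_distrib)
  next
    fix y assume "\<forall>i. y $ i - (rmat A *v x) $ i \<in> \<int>"
    then have "(rmat B *v y) $ i - x $ i \<in> \<int>" for i
      using rmat_Ints[of "y - rmat A *v x" B i] by (simp add: matrix_vector_mult_diff_distrib B)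
    then show "y \<in> (*v) (rmat A) ` {y. \<forall>i. y $ i - x $ i \<in> \<int>}"
      by (intro image_eqI[of _ _ "rmat B *v y"]) (auto simp: B)
  qed
qed

lemma torus_proj_rmat_eq:
  assumes "invertible A" shows "torus_proj (rmat A *v x) = torus_proj (rmat A *v y) \<longleftrightarrow> torus_proj x = torus_proj y"
proof -
  obtain B where B: "\<And>x. rmat A *v (rmat B *v x) = x" "\<And>x. rmat B *v (rmat A *v x) = x"
    using rmat_inverse[OF assms] by blast
  have *: "torus_proj x = torus_proj y \<Longrightarrow> torus_proj (rmat C *v x) = torus_proj (rmat C *v y)" for C x y
    using rmat_Ints[of "y - x" C] by (simp add: torus_proj_eq matrix_vector_mult_diff_distrib)
  show ?thesis using *[of x y A] *[of "rmat A *v x" "rmat A *v y" B] by (auto simp: B)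
qed

lemma topspace_cylinder: "topspace (cylinder :: ((real^'n) set \<times> real) topology) = range torus_proj \<times> {0..1}"
  by (simp add: cylinder_def topspace_torus)

lemma seam_iff:
  assumes "invertible A"
  shows "seam A u v \<longleftrightarrow> (\<exists>x. u = (torus_proj x, 0) \<and> v = (torus_proj (rmat A *v x), 1))"
  by (auto simp: seam.simps topspace_torus torus_aut_proj[OF assms])

lemma equivclp_seam:
  assumes "invertible A"
  shows "equivclp (seam A) u v \<longleftrightarrow> u = v \<or> seam A u v \<or> seam A v u"
proof
  assume "equivclp (seam A) u v"
  then have "(symclp (seam A))\<^sup>*\<^sup>* u v" by (simp add: equivclp_def)
  then show "u = v \<or> seam A u v \<or> seam A v u"
  proof (induction rule: rtranclp_induct)
    case (step y z)
    from step.hyps(2) have "seam A y z \<or> seam A z y" by (simp add: symclp_def)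
    with step.IH show ?case
      unfolding seam_iff[OF assms] using torus_proj_rmat_eq[OF assms] by (elim disjE exE conjE) auto
  qed auto
qed (auto simp: equivclp_def symclp_def intro: r_into_rtranclp)

lemma mt_rel_iff:
  assumes "invertible A"
  shows "(u, v) \<in> mt_rel A \<longleftrightarrow> u \<in> topspace cylinder \<and> v \<in> topspace cylinder \<and>
    (u = v \<or> seam A u v \<or> seam A v u)"
  using equivclp_seam[OF assms] by (auto simp: mt_rel_def)

lemma equiv_mt_rel: "equiv (topspace cylinder) (mt_rel A)"
  by (rule equivI) (auto simp: mt_rel_def refl_on_def sym_def trans_def
     intro: equivclp_sym equivclp_trans)

lemma mt_class_eq:
  assumes "invertible A" "u \<in> topspace cylinder" "v \<in> topspace cylinder"
  shows "mt_proj A u = mt_proj A v \<longleftrightarrow> u = v \<or> seam A u v \<or> seam A v u"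
  by (simp add: mt_proj_def mt_rel_iff[OF assms(1)] assms(2,3)
      eq_equiv_class_iff[OF equiv_mt_rel[of A] assms(2,3)])

definition coord_join :: "real^'n \<Rightarrow> real \<Rightarrow> real^('n option)" where
  "coord_join x s = (\<chi> i. case i of None \<Rightarrow> s | Some j \<Rightarrow> x $ j)"

definition cyl_proj :: "real^('n option) \<Rightarrow> (real^'n) set \<times> real" where
  "cyl_proj z = (torus_proj (torus_part z), z $ None)"

definition deck :: "int^'n^'n \<Rightarrow> real^('n option) \<Rightarrow> real^('n option)" where
  "deck A z = coord_join (rmat A *v torus_part z) (z $ None + 1)"

lemma torus_part_join [simp]: "torus_part (coord_join x s) = x"
  by (simp add: torus_part_def coord_join_def)

lemma join_None [simp]: "coord_join x s $ None = s"
  by (simp add: coord_join_def)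

lemma join_torus_part [simp]: "coord_join (torus_part z) (z $ None) = z"
  by (auto simp: torus_part_def coord_join_def vec_eq_iff split: option.split)

lemma vec_option_eq: "z = w \<longleftrightarrow> torus_part z = torus_part w \<and> z $ None = w $ None"
  by (metis join_torus_part)

lemma torus_part_add: "torus_part (z + w) = torus_part z + torus_part w"
  by (simp add: torus_part_def vec_eq_iff)

lemma bounded_linear_torus_part: "bounded_linear torus_part"
  by (simp add: linear_conv_bounded_linear[symmetric] linear_iff torus_part_def vec_eq_iff)

lemma bounded_linear_join:
  fixes M :: "real^'n^'n"
  shows "bounded_linear (\<lambda>z :: real^('n option). coord_join (M *v torus_part z) (z $ None))"
  unfolding linear_conv_bounded_linear[symmetric]
  by (auto simp: linear_iff vec_option_eq torus_part_add matrix_vector_right_distrib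
     linear_cmul[OF bounded_linear.linear[OF bounded_linear_torus_part]] matrix_vector_mult_scaleR)

lemma continuous_torus_part [continuous_intros]:
  "continuous_on S f \<Longrightarrow> continuous_on S (\<lambda>x. torus_part (f x))"
  by (rule bounded_linear.continuous_on[OF bounded_linear_torus_part])

lemma continuous_join [continuous_intros]:
  assumes "continuous_on S f" "continuous_on S g"
  shows "continuous_on S (\<lambda>x. coord_join (f x) (g x))"
  unfolding coord_join_def
proof (rule continuous_on_vec_lambda)
  fix i show "continuous_on S (\<lambda>x. case i of None \<Rightarrow> g x | Some j \<Rightarrow> f x $ j)"
    using assms by (cases i) (auto intro: continuous_intros)
qed

lemma continuous_matrix_vector [continuous_intros]:
  fixes M :: "real^'n^'m"
  shows "continuous_on S f \<Longrightarrow> continuous_on S (\<lambda>x. M *v f x)"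
  by (rule bounded_linear.continuous_on[OF matrix_vector_mul_bounded_linear])

lemma continuous_deck [continuous_intros]:
  "continuous_on S f \<Longrightarrow> continuous_on S (\<lambda>x. deck A (f x))"
  unfolding deck_def by (intro continuous_intros)

lemma coord_box_UNIV: "coord_box UNIV J = {z. z $ None \<in> J}"
  by (simp add: coord_box_def)

lemma open_coord_box: "open W \<Longrightarrow> open J \<Longrightarrow> open (coord_box W J)"
proof -
  assume "open W" "open J"
  then have "open (torus_part -` W)" "open ((\<lambda>z::real^('a option). z $ None) -` J)"
    by (auto intro!: open_vimage continuous_intros)
  moreover have "coord_box W J = torus_part -` W \<inter> (\<lambda>z. z $ None) -` J"
    by (auto simp: coord_box_def)
  ultimately show ?thesis by auto
qed

lemma cyl_proj_in: "z $ None \<in> {0..1} \<Longrightarrow> cyl_proj z \<in> topspace cylinder"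
  by (simp add: topspace_cylinder cyl_proj_def)

lemma cylinder_cases:
  assumes "u \<in> topspace cylinder"
  obtains z where "u = cyl_proj z" "0 \<le> z $ None" "z $ None \<le> 1"
proof -
  obtain x s where "u = (torus_proj x, s)" "0 \<le> s" "s \<le> 1"
    using assms by (auto simp: topspace_cylinder)
  then show ?thesis by (intro that[of "coord_join x s"]) (auto simp: cyl_proj_def)
qed

lemma cyl_proj_eq: "cyl_proj z = cyl_proj w \<longleftrightarrow>
    torus_proj (torus_part z) = torus_proj (torus_part w) \<and> z $ None = w $ None"
  by (simp add: cyl_proj_def)

lemma continuous_cyl_proj:
  "continuous_map (top_of_set {z. 0 \<le> z $ None \<and> z $ None \<le> 1}) cylinder cyl_proj"
  unfolding cylinder_def cyl_proj_def
proof (rule continuous_map_pairedI)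
  have "continuous_map (top_of_set {z::real^('a option). 0 \<le> z $ None \<and> z $ None \<le> 1}) euclidean torus_part"
    by (auto intro!: continuous_intros)
  from continuous_map_compose[OF this continuous_torus_proj]
  show "continuous_map (top_of_set {z::real^('a option). 0 \<le> z $ None \<and> z $ None \<le> 1}) torus
        (\<lambda>z. torus_proj (torus_part z))" by (simp add: o_def)
  show "continuous_map (top_of_set {z::real^('a option). 0 \<le> z $ None \<and> z $ None \<le> 1})
        (top_of_set {0..1}) (\<lambda>z. z $ None)"
    by (auto simp: continuous_map_in_subtopology intro!: continuous_intros)
qed

lemma open_cyl_proj:
  assumes "open S"
  shows "openin cylinder (cyl_proj ` (S \<inter> {z. 0 \<le> z $ None \<and> z $ None \<le> 1}))"
proof (subst openin_subopen, intro ballI)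
  fix u assume "u \<in> cyl_proj ` (S \<inter> {z. 0 \<le> z $ None \<and> z $ None \<le> 1})"
  then obtain z where z: "z \<in> S" "0 \<le> z $ None" "z $ None \<le> 1" "u = cyl_proj z" by auto
  have "open ((\<lambda>(x, s). coord_join x s) -` S)"
    using assms by (auto simp: case_prod_unfold intro!: open_vimage continuous_intros)
  moreover have "(torus_part z, z $ None) \<in> (\<lambda>(x, s). coord_join x s) -` S" using z by simp
  ultimately obtain W J where WJ: "open W" "open J" "torus_part z \<in> W" "z $ None \<in> J"
      "W \<times> J \<subseteq> (\<lambda>(x, s). coord_join x s) -` S"
    by (elim open_prod_elim) auto
  have "openin torus (torus_proj ` W)" 
    by (rule torus_proj_open_map[unfolded open_map_def, rule_format]) (simp add: WJ(1))
  then have "openin cylinder (torus_proj ` W \<times> (J \<inter> {0..1}))"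
    unfolding cylinder_def using WJ(2)
    by (auto simp: openin_prod_Times_iff openin_open)
  moreover have "u \<in> torus_proj ` W \<times> (J \<inter> {0..1})" using z WJ by (auto simp: cyl_proj_def)
  moreover have "torus_proj ` W \<times> (J \<inter> {0..1}) \<subseteq> cyl_proj ` (S \<inter> {z. 0 \<le> z $ None \<and> z $ None \<le> 1})"
  proof
    fix v assume "v \<in> torus_proj ` W \<times> (J \<inter> {0..1})"
    then obtain x s where "x \<in> W" "s \<in> J" "0 \<le> s" "s \<le> 1" "v = (torus_proj x, s)" by auto
    then show "v \<in> cyl_proj ` (S \<inter> {z. 0 \<le> z $ None \<and> z $ None \<le> 1})"
      using WJ(5) by (intro image_eqI[of _ _ "coord_join x s"]) (auto simp: cyl_proj_def)
  qed
  ultimately show "\<exists>T. openin cylinder T \<and> u \<in> T \<and> T \<subseteq> cyl_proj ` (S \<inter> {z. 0 \<le> z $ None \<and> z $ None \<le> 1})"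
    by blast
qed

lemma mtop_mapping_torus: "mtop (mapping_torus A) = quotient_topology cylinder (mt_rel A)"
  by (simp add: mapping_torus_def)

lemma quotient_mt: "quotient_map cylinder (mtop (mapping_torus A)) (mt_proj A)"
  using quotient_map_quotient_topology[of cylinder "mt_rel A"]
  by (simp add: mapping_torus_def flip: mt_proj_def)

lemmas continuous_mt = quotient_imp_continuous_map[OF quotient_mt]
lemmas mt_surj = quotient_imp_surjective_map[OF quotient_mt]

lemma openin_mt:
  "openin (mtop (mapping_torus A)) U \<longleftrightarrow> U \<subseteq> mt_proj A ` topspace cylinder \<and>
     openin cylinder {u \<in> topspace cylinder. mt_proj A u \<in> U}"
  using quotient_mt[of A] unfolding quotient_map_def
  by (metis (no_types, lifting) openin_subset)

context
  fixes A :: "int^'n^'n" assumes A: "invertible A"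
begin

lemma seam_cyl: "seam A (cyl_proj z) (cyl_proj w) \<longleftrightarrow>
    z $ None = 0 \<and> cyl_proj w = cyl_proj (deck A z)"
proof -
  have *: "torus_proj a = torus_proj b \<Longrightarrow> torus_proj (rmat A *v a) = torus_proj (rmat A *v b)" for a b
    by (simp only: torus_proj_rmat_eq[OF A])
  show ?thesis unfolding seam_iff[OF A] cyl_proj_def deck_def
    by (auto dest: *) 
qed

lemma mt_cyl_eq:
  assumes "0 \<le> z $ None" "z $ None \<le> 1" "0 \<le> w $ None" "w $ None \<le> 1"
  shows "mt_proj A (cyl_proj z) = mt_proj A (cyl_proj w) \<longleftrightarrow> cyl_proj z = cyl_proj w \<or>
    z $ None = 0 \<and> cyl_proj w = cyl_proj (deck A z) \<or> w $ None = 0 \<and> cyl_proj z = cyl_proj (deck A w)"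
  using assms by (subst mt_class_eq[OF A]) (auto simp: cyl_proj_in seam_cyl)

lemma deck_None [simp]: "deck A z $ None = z $ None + 1"
  by (simp add: deck_def)

lemma cyl_deck_eq: "cyl_proj (deck A z) = cyl_proj (deck A w) \<longleftrightarrow> cyl_proj z = cyl_proj w"
  by (simp add: cyl_proj_eq) (simp add: deck_def torus_proj_rmat_eq[OF A])

lemma interior_param_eq: "interior_param A z = mt_proj A (cyl_proj z)"
  by (simp add: interior_param_def cyl_proj_def)

lemma seam_param_eq:
  "seam_param A z = (if 0 \<le> z $ None then mt_proj A (cyl_proj z) else mt_proj A (cyl_proj (deck A z)))"
  by (simp add: seam_param_def cyl_proj_def deck_def torus_aut_proj[OF A])

lemma seam_param_le:
  assumes "-1 \<le> z $ None" "z $ None \<le> 0"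
  shows "seam_param A z = mt_proj A (cyl_proj (deck A z))"
proof (cases "z $ None = 0")
  case True
  then have "mt_proj A (cyl_proj z) = mt_proj A (cyl_proj (deck A z))"
    by (subst mt_cyl_eq) auto
  then show ?thesis by (simp add: seam_param_eq)
qed (use assms in \<open>simp add: seam_param_eq\<close>)

lemma ii_eq:
  assumes "z $ None \<in> {0<..<1}" "w $ None \<in> {0<..<1}"
  shows "interior_param A z = interior_param A w \<longleftrightarrow> cyl_proj z = cyl_proj w"
  using assms by (auto simp: interior_param_eq mt_cyl_eq)

lemma ss_eq:
  assumes "z $ None \<in> {-1/2<..<1/2}" "w $ None \<in> {-1/2<..<1/2}"
  shows "seam_param A z = seam_param A w \<longleftrightarrow> cyl_proj z = cyl_proj w"
proof (cases "0 \<le> z $ None"; cases "0 \<le> w $ None")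
  assume "0 \<le> z $ None" "0 \<le> w $ None" then show ?thesis
    using assms by (auto simp: seam_param_eq mt_cyl_eq cyl_proj_eq)
next
  assume "\<not> 0 \<le> z $ None" "\<not> 0 \<le> w $ None" then show ?thesis
    using assms by (auto simp: seam_param_eq mt_cyl_eq cyl_deck_eq)
next
  assume *: "0 \<le> z $ None" "\<not> 0 \<le> w $ None"
  then have "seam_param A z \<noteq> seam_param A w" "cyl_proj z \<noteq> cyl_proj w"
    using assms by (auto simp: seam_param_eq mt_cyl_eq cyl_proj_eq)
  then show ?thesis by simp
next
  assume *: "\<not> 0 \<le> z $ None" "0 \<le> w $ None"
  then have "seam_param A z \<noteq> seam_param A w" "cyl_proj z \<noteq> cyl_proj w"
    using assms by (auto simp: seam_param_eq mt_cyl_eq cyl_proj_eq)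
  then show ?thesis by simp
qed

lemma is_eq:
  assumes "z $ None \<in> {0<..<1}" "w $ None \<in> {-1/2<..<1/2}"
  shows "interior_param A z = seam_param A w \<longleftrightarrow>
     0 < w $ None \<and> cyl_proj z = cyl_proj w \<or> w $ None < 0 \<and> cyl_proj z = cyl_proj (deck A w)"
  using assms by (auto simp: interior_param_eq seam_param_eq mt_cyl_eq cyl_proj_eq)

end

lemma Ck_on_locally_affine:
  assumes "\<And>x. x \<in> S \<Longrightarrow> \<exists>N L c. open N \<and> x \<in> N \<and> bounded_linear L \<and> (\<forall>y\<in>N. f y = L y + c)"
  shows "Ck_on k f S"
  using assms
proof (induction k arbitrary: f)
  case 0
  have "continuous (at x within S) f" if "x \<in> S" for x
  proof -
    from 0[OF that] obtain N L c where N: "open N" "x \<in> N" "bounded_linear L" "\<forall>y\<in>N. f y = L y + c"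
      by (elim exE conjE)
    have "continuous_on N (\<lambda>y. L y + c)"
      by (intro continuous_intros bounded_linear.continuous_on[OF N(3)])
    then have "continuous_on N f" using N(4) by (simp cong: continuous_on_cong)
    then have "continuous (at x) f" using N(1,2) by (simp add: continuous_on_eq_continuous_at)
    then show ?thesis by (rule continuous_at_imp_continuous_at_within)
  qed
  then show ?case by (simp add: continuous_on_eq_continuous_within)
next
  case (Suc k)
  have der: "(f has_derivative L) (at y)"
    if "open N" "y \<in> N" "bounded_linear L" "\<forall>y\<in>N. f y = L y + c" for N L c y
  proof -
    have "((\<lambda>y. L y + c) has_derivative L) (at y)"
      using has_derivative_add_const[OF bounded_linear_imp_has_derivative[OF that(3)]] .
    then show ?thesis
      by (rule has_derivative_transform_within_open[OF _ that(1,2)]) (use that(4) in auto)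
  qed
  show ?case unfolding Ck_on.simps
  proof (intro conjI ballI allI)
    fix x assume "x \<in> S"
    from Suc.prems[OF this] obtain N L c where N: "open N" "x \<in> N" "bounded_linear L" "\<forall>y\<in>N. f y = L y + c"
      by (elim exE conjE)
    show "f differentiable (at x)" using der[OF N] unfolding differentiable_def by (intro exI)
  next
    fix v show "Ck_on k (\<lambda>x. frechet_derivative f (at x) v) S"
    proof (rule Suc.IH)
      fix x assume "x \<in> S"
      from Suc.prems[OF this] obtain N L c where N: "open N" "x \<in> N" "bounded_linear L" "\<forall>y\<in>N. f y = L y + c"
        by (elim exE conjE)
      have "\<forall>y\<in>N. frechet_derivative f (at y) v = (\<lambda>_. 0) y + L v"
        using frechet_derivative_at[OF der[OF N(1) _ N(3,4)]] by force
      then show "\<exists>N L c. open N \<and> x \<in> N \<and> bounded_linear L \<and>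
          (\<forall>y\<in>N. frechet_derivative f (at y) v = L y + c)"
        using N(1,2) bounded_linear_zero
        by (intro exI[of _ N] exI[of _ "\<lambda>_. 0"] exI[of _ "L v"] conjI)
    qed
  qed
qed

context
  fixes A :: "int^'n^'n" assumes A: "invertible A"
begin

definition deck_inv :: "real^('n option) \<Rightarrow> real^('n option)" where
  "deck_inv z = coord_join (matrix_inv (rmat A) *v torus_part z) (z $ None - 1)"

lemma invertible_rmat: "invertible (rmat A)"
  using A unfolding invertible_def by (metis rmat_mult rmat_one)

lemma matrix_inv_rmat:
  "rmat A ** matrix_inv (rmat A) = mat 1" "matrix_inv (rmat A) ** rmat A = mat 1"
proof -
  have "\<exists>B. rmat A ** B = mat 1 \<and> B ** rmat A = mat 1"
    using invertible_rmat by (simp add: invertible_def)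
  then have "rmat A ** matrix_inv (rmat A) = mat 1 \<and> matrix_inv (rmat A) ** rmat A = mat 1"
    unfolding matrix_inv_def by (rule someI_ex)
  then show "rmat A ** matrix_inv (rmat A) = mat 1" "matrix_inv (rmat A) ** rmat A = mat 1" by auto
qed

lemma deck_inv [simp]: "deck A (deck_inv z) = z" "deck_inv (deck A z) = z"
  using matrix_inv_rmat
  by (simp_all add: vec_option_eq[of _ z]) (simp_all add: deck_def deck_inv_def matrix_vector_mul_assoc)

lemma deck_inv_None [simp]: "deck_inv z $ None = z $ None - 1"
  by (simp add: deck_inv_def)

lemma continuous_deck_inv [continuous_intros]:
  "continuous_on S f \<Longrightarrow> continuous_on S (\<lambda>x. deck_inv (f x))"
  unfolding deck_inv_def by (intro continuous_intros)

lemma open_deck_image: "open S \<Longrightarrow> open (deck A ` S)"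
proof -
  assume "open S"
  then have "open (deck_inv -` S)" by (intro open_vimage continuous_intros)
  moreover have "deck_inv -` S = deck A ` S" by (force simp: image_iff)
  ultimately show ?thesis by simp
qed

lemma interior_param_in: "z $ None \<in> {0<..<1} \<Longrightarrow> interior_param A z \<in> topspace (mtop (mapping_torus A))"
  by (auto simp: interior_param_eq[OF A] cyl_proj_in simp flip: mt_surj)

lemma seam_param_in: "z $ None \<in> {-1/2<..<1/2} \<Longrightarrow> seam_param A z \<in> topspace (mtop (mapping_torus A))"
  using cyl_proj_in[of z] cyl_proj_in[of "deck A z"] deck_None[OF A, of z]
  by (auto simp: seam_param_eq[OF A] simp flip: mt_surj)

lemma continuous_interior_param:
  "continuous_map (top_of_set (coord_box UNIV {0<..<1})) (mtop (mapping_torus A)) (interior_param A)"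
proof -
  have "continuous_map (top_of_set (coord_box UNIV {0<..<1})) cylinder cyl_proj"
    by (rule continuous_map_from_subtopology_mono[OF continuous_cyl_proj]) (auto simp: coord_box_UNIV)
  from continuous_map_compose[OF this continuous_mt[of A]]
  show ?thesis by (simp add: o_def interior_param_eq[OF A, abs_def])
qed

lemma continuous_seam_param:
  "continuous_map (top_of_set (coord_box UNIV {-1/2<..<1/2})) (mtop (mapping_torus A)) (seam_param A)"
proof -
  let ?D = "coord_box UNIV {-1/2<..<1/2} :: (real^('n option)) set"
  have ge: "X \<inter> {z \<in> X. P z} = X \<inter> {z. P z}" for X :: "(real^('n option)) set" and P
    by auto
  have "continuous_map (top_of_set ?D) (mtop (mapping_torus A))
    (\<lambda>z. if 0 \<le> z $ None then mt_proj A (cyl_proj z) else mt_proj A (cyl_proj (deck A z)))"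
  proof (rule continuous_map_cases_le)
    show "continuous_map (top_of_set ?D) euclideanreal (\<lambda>_. 0)" by simp
    show "continuous_map (top_of_set ?D) euclideanreal (\<lambda>z. z $ None)"
      by (auto intro!: continuous_intros)
    have "continuous_map (top_of_set (?D \<inter> {z. 0 \<le> z $ None})) cylinder cyl_proj"
      by (rule continuous_map_from_subtopology_mono[OF continuous_cyl_proj]) (auto simp: coord_box_UNIV)
    from continuous_map_compose[OF this continuous_mt[of A]]
    show "continuous_map (subtopology (top_of_set ?D) {z \<in> topspace (top_of_set ?D). 0 \<le> z $ None})
       (mtop (mapping_torus A)) (\<lambda>z. mt_proj A (cyl_proj z))"
      by (simp add: o_def subtopology_subtopology ge)
    have "continuous_map (top_of_set (?D \<inter> {z. z $ None \<le> 0})) (top_of_set {z. 0 \<le> z $ None \<and> z $ None \<le> 1}) (deck A)"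
      by (auto simp: continuous_map_in_subtopology coord_box_UNIV deck_None[OF A] intro!: continuous_intros)
    from continuous_map_compose[OF continuous_map_compose[OF this continuous_cyl_proj] continuous_mt[of A]]
    show "continuous_map (subtopology (top_of_set ?D) {z \<in> topspace (top_of_set ?D). z $ None \<le> 0})
       (mtop (mapping_torus A)) (\<lambda>z. mt_proj A (cyl_proj (deck A z)))"
      by (simp add: o_def subtopology_subtopology ge)
    fix z assume "z \<in> topspace (top_of_set ?D)" "0 = z $ None"
    then show "mt_proj A (cyl_proj z) = mt_proj A (cyl_proj (deck A z))"
      using seam_param_le[OF A, of z] by (simp add: seam_param_eq[OF A])
  qed
  then show ?thesis by (simp add: seam_param_eq[OF A, abs_def])
qed

lemma open_interior_param:
  assumes "open S" "S \<subseteq> coord_box UNIV {0<..<1}"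
  shows "openin (mtop (mapping_torus A)) (interior_param A ` S)"
  unfolding openin_mt
proof
  show "interior_param A ` S \<subseteq> mt_proj A ` topspace cylinder"
    using assms by (force simp: interior_param_eq[OF A] coord_box_UNIV intro!: imageI cyl_proj_in)
  have "{u \<in> topspace cylinder. mt_proj A u \<in> interior_param A ` S} =
     cyl_proj ` (S \<inter> {z. 0 \<le> z $ None \<and> z $ None \<le> 1})" (is "?L = ?R")
  proof (intro set_eqI iffI)
    fix u assume u: "u \<in> ?L"
    then obtain w where w: "u = cyl_proj w" "0 \<le> w $ None" "w $ None \<le> 1"
      by (auto elim: cylinder_cases)
    from u obtain z where z: "z \<in> S" "mt_proj A (cyl_proj w) = mt_proj A (cyl_proj z)"
      by (auto simp: w interior_param_eq[OF A])
    have zr: "0 < z $ None" "z $ None < 1" using z(1) assms(2) by (auto simp: coord_box_UNIV)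
    have "cyl_proj w = cyl_proj z"
      using z(2) mt_cyl_eq[OF A, of w z] w zr by (auto simp: cyl_proj_eq deck_None[OF A])
    then show "u \<in> ?R" using z zr w by auto
  next
    fix u assume "u \<in> ?R" then show "u \<in> ?L"
      by (auto simp: cyl_proj_in interior_param_eq[OF A])
  qed
  then show "openin cylinder {u \<in> topspace cylinder. mt_proj A u \<in> interior_param A ` S}"
    using open_cyl_proj[OF assms(1)] by simp
qed

lemma open_seam_param:
  assumes "open S" "S \<subseteq> coord_box UNIV {-1/2<..<1/2}"
  shows "openin (mtop (mapping_torus A)) (seam_param A ` S)"
  unfolding openin_mt
proof
  let ?I = "{z. 0 \<le> z $ None \<and> z $ None \<le> 1} :: (real^('n option)) set"
  have S: "-1/2 < z $ None \<and> z $ None < 1/2" if "z \<in> S" for z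
    using assms(2) that by (auto simp: coord_box_UNIV)
  show "seam_param A ` S \<subseteq> mt_proj A ` topspace cylinder"
    using S by (force simp: seam_param_eq[OF A] deck_None[OF A] intro!: imageI cyl_proj_in)
  have "{u \<in> topspace cylinder. mt_proj A u \<in> seam_param A ` S} =
     cyl_proj ` (S \<inter> ?I) \<union> cyl_proj ` (deck A ` S \<inter> ?I)" (is "?L = ?R")
  proof (intro set_eqI iffI)
    fix u assume u: "u \<in> ?L"
    then obtain w where w: "u = cyl_proj w" "0 \<le> w $ None" "w $ None \<le> 1"
      by (auto elim: cylinder_cases)
    from u obtain z where z: "z \<in> S" "mt_proj A (cyl_proj w) = seam_param A z" by (auto simp: w)
    show "u \<in> ?R"
    proof (cases "0 \<le> z $ None")
      case True
      then have "mt_proj A (cyl_proj w) = mt_proj A (cyl_proj z)" using z by (simp add: seam_param_eq[OF A])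
      then have "cyl_proj w = cyl_proj z \<or> z $ None = 0 \<and> cyl_proj w = cyl_proj (deck A z)"
        using mt_cyl_eq[OF A, of w z] w S[OF z(1)] True by (auto simp: cyl_proj_eq deck_None[OF A])
      then show ?thesis using z(1) w S[OF z(1)] True
        by (auto simp: deck_None[OF A])
    next
      case False
      then have "mt_proj A (cyl_proj w) = mt_proj A (cyl_proj (deck A z))" using z by (simp add: seam_param_eq[OF A])
      then have "cyl_proj w = cyl_proj (deck A z)"
        using mt_cyl_eq[OF A, of w "deck A z"] w S[OF z(1)] False by (auto simp: cyl_proj_eq deck_None[OF A])
      then show ?thesis using z(1) w S[OF z(1)] False
        by (auto simp: deck_None[OF A])
    qed
  next
    fix u assume "u \<in> ?R" then show "u \<in> ?L"
    proof
      assume "u \<in> cyl_proj ` (S \<inter> ?I)"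
      then obtain z where z: "z \<in> S" "z \<in> ?I" "u = cyl_proj z" by blast
      then have e: "mt_proj A u = seam_param A z" by (simp add: seam_param_eq[OF A])
      have "mt_proj A u \<in> seam_param A ` S" by (rule image_eqI[of _ "seam_param A", OF e z(1)])
      then show ?thesis using z by (simp add: cyl_proj_in)
    next
      assume "u \<in> cyl_proj ` (deck A ` S \<inter> ?I)"
      then obtain z where z: "z \<in> S" "deck A z \<in> ?I" "u = cyl_proj (deck A z)" by blast
      then have e: "mt_proj A u = seam_param A z"
        using seam_param_le[OF A, of z] by (simp add: deck_None[OF A])
      have "mt_proj A u \<in> seam_param A ` S" by (rule image_eqI[of _ "seam_param A", OF e z(1)])
      then show ?thesis using z by (simp add: cyl_proj_in)
    qed
  qed
  then show "openin cylinder {u \<in> topspace cylinder. mt_proj A u \<in> seam_param A ` S}"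
    using open_cyl_proj[OF assms(1)] open_cyl_proj[OF open_deck_image[OF assms(1)]] by auto
qed

end

lemma is_chart_inverse_chart:
  fixes P :: "real^'m \<Rightarrow> 'p"
  assumes cont: "continuous_map (top_of_set D0) X P"
    and op: "\<And>S. open S \<Longrightarrow> S \<subseteq> D0 \<Longrightarrow> openin X (P ` S)"
    and D: "open D" "D \<subseteq> D0" "inj_on P D"
  shows "is_chart X (inverse_chart P D)"
proof -
  have im: "inv_into D P ` P ` D = D" using inv_into_image_cancel[OF D(3) subset_refl] .
  have top: "P ` D \<subseteq> topspace X" using op[OF D(1,2)] openin_subset by blast
  have "homeomorphic_map (top_of_set D) (subtopology X (P ` D)) P"
  proof (rule bijective_open_imp_homeomorphic_map)
    show "continuous_map (top_of_set D) (subtopology X (P ` D)) P"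
      using continuous_map_from_subtopology_mono[OF cont D(2)] by (simp add: continuous_map_in_subtopology)
    show "open_map (top_of_set D) (subtopology X (P ` D)) P"
      unfolding open_map_def
    proof (intro allI impI)
      fix U assume "openin (top_of_set D) U"
      then have U: "open U" "U \<subseteq> D" using D(1) by (auto simp: openin_open_eq)
      have "openin X (P ` U)" by (rule op) (use U D in auto)
      then show "openin (subtopology X (P ` D)) (P ` U)"
        using U by (auto intro!: openin_subset_topspace_eq[THEN iffD2] simp: openin_subtopology_Int2 openin_open_subtopology op[OF D(1,2)])
    qed
    show "P ` topspace (top_of_set D) = topspace (subtopology X (P ` D))" using top by auto
    show "inj_on P (topspace (top_of_set D))" using D(3) by simp
  qed
  then obtain g where g: "homeomorphic_maps (top_of_set D) (subtopology X (P ` D)) P g"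
    using homeomorphic_map_maps by blast
  then have "homeomorphic_map (subtopology X (P ` D)) (top_of_set D) g"
    using homeomorphic_maps_map by blast
  then have "homeomorphic_map (subtopology X (P ` D)) (top_of_set D) (inv_into D P)"
  proof (rule homeomorphic_map_eq)
    fix x assume "x \<in> topspace (subtopology X (P ` D))"
    then obtain d where d: "d \<in> D" "x = P d" by auto
    then have "g x = d" using g by (auto simp: homeomorphic_maps_def)
    then show "g x = inv_into D P x" using d D(3) by simp
  qed
  then show ?thesis using op[OF D(1,2)] D(1) by (simp add: is_chart_def inverse_chart_def im)
qed

context
  fixes A :: "int^'n^'n" assumes A: "invertible A"
begin

lemma cyl_translate:
  assumes "cyl_proj z = cyl_proj w"
  obtains c where "w = z + c" "\<And>y. cyl_proj (y + c) = cyl_proj y"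
proof
  show "w = z + (w - z)" by simp
  have tp: "torus_part (w - z) = torus_part w - torus_part z"
    by (simp add: torus_part_def vec_eq_iff)
  show "cyl_proj (y + (w - z)) = cyl_proj y" for y
    using assms by (auto simp: cyl_proj_eq torus_proj_eq torus_part_add tp)
      (metis Ints_minus minus_diff_eq)
qed

definition mt_params :: "((real^('n option) \<Rightarrow> ((real^'n) set \<times> real) set) \<times> real set) set" where
  "mt_params = {(interior_param A, {0<..<1}), (seam_param A, {-1/2<..<1/2})}"

lemma bounded_linear_deck_part: "bounded_linear (\<lambda>z. coord_join (rmat A *v torus_part z) (z $ None))"
  by (rule bounded_linear_join)

lemma deck_affine: "deck A z = coord_join (rmat A *v torus_part z) (z $ None) + coord_join 0 1"
  by (simp add: vec_option_eq torus_part_add deck_def)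

lemma deck_inv_affine:
  "deck_inv A z = coord_join (matrix_inv (rmat A) *v torus_part z) (z $ None) + coord_join 0 (-1)"
  by (simp add: vec_option_eq torus_part_add deck_inv_def[OF A])

lemma param_transition:
  assumes "(P, J) \<in> mt_params" "(Q, K) \<in> mt_params" "z $ None \<in> J" "w $ None \<in> K" "P z = Q w"
  shows "\<exists>N L c. open N \<and> z \<in> N \<and> bounded_linear L \<and> L z + c = w \<and>
     (\<forall>y\<in>N. y $ None \<in> J \<longrightarrow> (L y + c) $ None \<in> K \<longrightarrow> P y = Q (L y + c))"
proof -
  have pos: "open {y :: real^('n option). 0 < y $ None}" and neg: "open {y :: real^('n option). y $ None < 0}"
    by (auto intro!: open_Collect_less continuous_intros)
  have trans: ?thesis if eq: "cyl_proj z = cyl_proj w" "P = Q" "J = K"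
  proof -
    obtain c where c: "w = z + c" "\<And>y. cyl_proj (y + c) = cyl_proj y" using cyl_translate[OF eq(1)] by blast
    have "P y = Q (y + c)" if "y $ None \<in> J" "(y + c) $ None \<in> K" for y
      using assms(1,2) that c(2)[of y] \<open>P = Q\<close> \<open>J = K\<close> ii_eq[OF A, of y "y + c"] ss_eq[OF A, of y "y + c"]
      by (auto simp: mt_params_def)
    then show ?thesis using c(1)
      by (intro exI[of _ UNIV] exI[of _ "\<lambda>z. z"] exI[of _ c]) (auto simp: bounded_linear_ident)
  qed
  consider "P = interior_param A" "J = {0<..<1}" "Q = interior_param A" "K = {0<..<1}"
    | "P = interior_param A" "J = {0<..<1}" "Q = seam_param A" "K = {-1/2<..<1/2}"
    | "P = seam_param A" "J = {-1/2<..<1/2}" "Q = interior_param A" "K = {0<..<1}"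
    | "P = seam_param A" "J = {-1/2<..<1/2}" "Q = seam_param A" "K = {-1/2<..<1/2}"
    using assms(1,2) by (auto simp: mt_params_def)
  then show ?thesis
  proof cases
    case 1
    then show ?thesis using trans ii_eq[OF A, of z w] assms by auto
  next
    case 4
    then show ?thesis using trans ss_eq[OF A, of z w] assms by auto
  next
    case 2
    then have "0 < w $ None \<and> cyl_proj z = cyl_proj w \<or> w $ None < 0 \<and> cyl_proj z = cyl_proj (deck A w)"
      using is_eq[OF A, of z w] assms by auto
    then show ?thesis
    proof (elim disjE conjE)
      assume w: "0 < w $ None" "cyl_proj z = cyl_proj w"
      obtain c where c: "w = z + c" "\<And>y. cyl_proj (y + c) = cyl_proj y" using cyl_translate[OF w(2)] by blast
      have "P y = Q (y + c)" if "y $ None \<in> J" "(y + c) $ None \<in> K" for y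
        using that c(2)[of y] is_eq[OF A, of y "y + c"] 2 by (auto simp: cyl_proj_eq)
      then show ?thesis using c(1)
        by (intro exI[of _ UNIV] exI[of _ "\<lambda>z. z"] exI[of _ c]) (auto simp: bounded_linear_ident)
    next
      assume w: "w $ None < 0" "cyl_proj z = cyl_proj (deck A w)"
      obtain c where c: "deck A w = z + c" "\<And>y. cyl_proj (y + c) = cyl_proj y" using cyl_translate[OF w(2)] by blast
      let ?L = "\<lambda>z. coord_join (matrix_inv (rmat A) *v torus_part z) (z $ None)"
      define c' where "c' = ?L c + coord_join 0 (-1)"
      have L: "?L y + c' = deck_inv A (y + c)" for y
        unfolding c'_def deck_inv_affine
        using linear_add[OF bounded_linear.linear[OF bounded_linear_join[of "matrix_inv (rmat A)"]], of y c]
        by (simp add: add.assoc)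
      have cN: "c $ None = 0" using c(2)[of 0] by (simp add: cyl_proj_eq)
      have "?L z + c' = w" unfolding L c(1)[symmetric] by (rule deck_inv(2)[OF A])
      moreover have "P y = Q (?L y + c')" if "y $ None \<in> J" "(?L y + c') $ None \<in> K" for y
        using that c(2)[of y] is_eq[OF A, of y "deck_inv A (y + c)"] 2 cN unfolding L
        by (auto simp: deck_inv[OF A] deck_inv_None[OF A])
      ultimately show ?thesis
        by (intro exI[of _ UNIV] exI[of _ ?L] exI[of _ c']) (auto simp: bounded_linear_join)
    qed
  next
    case 3
    then have "0 < z $ None \<and> cyl_proj w = cyl_proj z \<or> z $ None < 0 \<and> cyl_proj w = cyl_proj (deck A z)"
      using is_eq[OF A, of w z] assms by auto
    then show ?thesis
    proof (elim disjE conjE)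
      assume w: "0 < z $ None" "cyl_proj w = cyl_proj z"
      obtain c where c: "w = z + c" "\<And>y. cyl_proj (y + c) = cyl_proj y" using cyl_translate[OF w(2)[symmetric]] by blast
      have "P y = Q (y + c)" if "y $ None \<in> J" "(y + c) $ None \<in> K" for y
        using that c(2)[of y] is_eq[OF A, of "y + c" y] 3 by (auto simp: cyl_proj_eq)
      then show ?thesis using c(1)
        by (intro exI[of _ UNIV] exI[of _ "\<lambda>z. z"] exI[of _ c]) (auto simp: bounded_linear_ident)
    next
      assume w: "z $ None < 0" "cyl_proj w = cyl_proj (deck A z)"
      obtain c where c: "w = deck A z + c" "\<And>y. cyl_proj (y + c) = cyl_proj y"
        using cyl_translate[OF w(2)[symmetric]] by blast
      let ?L = "\<lambda>z. coord_join (rmat A *v torus_part z) (z $ None)"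
      define c' where "c' = coord_join 0 1 + c"
      have L: "?L y + c' = deck A y + c" for y unfolding c'_def deck_affine by (simp add: add.assoc)
      have "P y = Q (?L y + c')" if "y \<in> {y. y $ None < 0}" "y $ None \<in> J" "(?L y + c') $ None \<in> K" for y
        using that c(2)[of "deck A y"] is_eq[OF A, of "deck A y + c" y] 3 unfolding L by auto
      moreover have "?L z + c' = w" unfolding L c(1) ..
      ultimately show ?thesis using neg w(1)
        by (intro exI[of _ "{y. y $ None < 0}"] exI[of _ ?L] exI[of _ c']) (auto simp: bounded_linear_join)
    qed
  qed
qed

lemma param_chart:
  assumes "(P, J) \<in> mt_params"
  shows "continuous_map (top_of_set (coord_box UNIV J)) (mtop (mapping_torus A)) P"
    and "open S \<Longrightarrow> S \<subseteq> coord_box UNIV J \<Longrightarrow> openin (mtop (mapping_torus A)) (P ` S)"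
    and "inj_on torus_proj W \<Longrightarrow> inj_on P (coord_box W J)"
    and "open J"
  using assms continuous_interior_param[OF A] continuous_seam_param[OF A]
    open_interior_param[OF A] open_seam_param[OF A]
  by (auto simp: mt_params_def inj_on_def coord_box_def ii_eq[OF A] ss_eq[OF A] cyl_proj_eq vec_option_eq)

lemma matlas_eq:
  "matlas (mapping_torus A) =
     {inverse_chart P (coord_box W J) | P J W. (P, J) \<in> mt_params \<and> open W \<and> inj_on torus_proj W}"
  by (auto simp: mapping_torus_def mt_params_def)

lemma transition_inverse_chart:
  assumes "inj_on P D" "z \<in> D"
  shows "transition (inverse_chart P D) (inverse_chart Q E) z = inv_into E Q (P z)"
proof -
  have "inv_into (P ` D) (inv_into D P) z = P z"
    using assms inv_into_f_eq[of "inv_into D P" "P ` D" "P z" z] by (simp add: inj_on_inv_into)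
  then show ?thesis by (simp add: transition_def inverse_chart_def)
qed

lemma smooth_transition:
  assumes "c \<in> matlas (mapping_torus A)" "d \<in> matlas (mapping_torus A)"
  shows "smooth_on (transition c d) (snd c ` (fst c \<inter> fst d))"
proof -
  obtain P J W where P: "(P, J) \<in> mt_params" "open W" "inj_on torus_proj W" "c = inverse_chart P (coord_box W J)"
    using assms(1) unfolding matlas_eq by blast
  obtain Q K V where Q: "(Q, K) \<in> mt_params" "open V" "inj_on torus_proj V" "d = inverse_chart Q (coord_box V K)"
    using assms(2) unfolding matlas_eq by blast
  let ?D = "coord_box W J" and ?E = "coord_box V K"
  have injP: "inj_on P ?D" and injQ: "inj_on Q ?E" and oD: "open ?D" and oE: "open ?E"
    using param_chart(3)[OF P(1,3)] param_chart(3)[OF Q(1,3)]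
      open_coord_box[OF P(2) param_chart(4)[OF P(1)]] open_coord_box[OF Q(2) param_chart(4)[OF Q(1)]] by simp_all
  show ?thesis unfolding smooth_on_def
  proof (intro allI Ck_on_locally_affine)
    fix z assume "z \<in> snd c ` (fst c \<inter> fst d)"
    then obtain p where "p \<in> P ` ?D" "p \<in> Q ` ?E" "z = inv_into ?D P p"
      by (auto simp: P(4) Q(4) inverse_chart_def)
    then obtain w where w: "w \<in> ?E" "P z = Q w" and z: "z \<in> ?D"
    proof -
      have "P z = p" "z \<in> ?D"
        using \<open>p \<in> P ` ?D\<close> \<open>z = _\<close> by (auto simp: f_inv_into_f inv_into_into)
      moreover from \<open>p \<in> Q ` ?E\<close> obtain w where "w \<in> ?E" "p = Q w" by blast
      ultimately show thesis using that by simp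
    qed
    then obtain N L a where N: "open N" "z \<in> N" "bounded_linear L" "L z + a = w"
       "\<forall>y\<in>N. y $ None \<in> J \<longrightarrow> (L y + a) $ None \<in> K \<longrightarrow> P y = Q (L y + a)"
      using param_transition[OF P(1) Q(1), of z w] by (auto simp: coord_box_def)
    let ?N = "N \<inter> ?D \<inter> (\<lambda>y. L y + a) -` ?E"
    have "open ?N" using N(1) oD oE
      by (intro open_Int open_vimage continuous_intros bounded_linear.continuous_on[OF N(3)])
    moreover have "z \<in> ?N" using N(2,4) z w(1) by simp
    moreover have "\<forall>y\<in>?N. transition c d y = L y + a"
    proof
      fix y assume y: "y \<in> ?N"
      then have "P y = Q (L y + a)" using N(5) by (simp add: coord_box_def)
      then show "transition c d y = L y + a"
        using y injQ by (simp add: P(4) Q(4) transition_inverse_chart[OF injP])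
    qed
    ultimately show "\<exists>N L a. open N \<and> z \<in> N \<and> bounded_linear L \<and> (\<forall>y\<in>N. transition c d y = L y + a)"
      using N(3) by (intro exI[of _ ?N] exI[of _ L] exI[of _ a] conjI)
  qed
qed

lemma inj_on_torus_proj_ball: "inj_on torus_proj (ball x (1/2) :: (real^'n) set)"
proof (rule inj_onI)
  fix y z :: "real^'n" assume yz: "y \<in> ball x (1/2)" "z \<in> ball x (1/2)" "torus_proj y = torus_proj z"
  have "dist z y < 1" using yz(1,2) dist_triangle_half_r[of x z 1 y] by (simp add: dist_commute)
  then have "\<bar>z $ i - y $ i\<bar> < 1" for i
    using component_le_norm_cart[of "z - y" i] by (simp add: dist_norm)
  moreover have "z $ i - y $ i \<in> \<int>" for i using yz(3) by (simp add: torus_proj_eq)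
  ultimately have "z $ i - y $ i = 0" for i using Ints_nonzero_abs_less1 by blast
  then show "y = z" by (simp add: vec_eq_iff)
qed

lemma mt_cases:
  assumes "p \<in> topspace (mtop (mapping_torus A))"
  obtains P J z where "(P, J) \<in> mt_params" "z $ None \<in> J" "p = P z"
proof -
  obtain z where z: "p = mt_proj A (cyl_proj z)" "0 \<le> z $ None" "z $ None \<le> 1"
    using assms by (auto simp flip: mt_surj elim: cylinder_cases)
  consider "z $ None = 0" | "z $ None = 1" | "0 < z $ None \<and> z $ None < 1" using z by linarith
  then show ?thesis
  proof cases
    case 1 then show ?thesis
      using z by (intro that[of "seam_param A" "{-1/2<..<1/2}" z]) (auto simp: mt_params_def seam_param_eq[OF A])
  next
    case 2
    have "seam_param A (deck_inv A z) = mt_proj A (cyl_proj z)"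
      using seam_param_le[OF A, of "deck_inv A z"] 2 by (simp add: deck_inv[OF A] deck_inv_None[OF A])
    then show ?thesis
      using z 2 by (intro that[of "seam_param A" "{-1/2<..<1/2}" "deck_inv A z"])
        (auto simp: mt_params_def deck_inv_None[OF A])
  next
    case 3 then show ?thesis
      using z by (intro that[of "interior_param A" "{0<..<1}" z]) (auto simp: mt_params_def interior_param_eq[OF A])
  qed
qed

lemma smooth_atlas_mt: "smooth_atlas (mtop (mapping_torus A)) (matlas (mapping_torus A))"
  unfolding smooth_atlas_def
proof (intro conjI ballI)
  show ch: "is_chart (mtop (mapping_torus A)) c" if c: "c \<in> matlas (mapping_torus A)" for c
  proof -
    obtain P J W where P: "(P, J) \<in> mt_params" "open W" "inj_on torus_proj W" "c = inverse_chart P (coord_box W J)"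
      using c unfolding matlas_eq by blast
    show ?thesis unfolding P(4)
    proof (rule is_chart_inverse_chart[OF param_chart(1)[OF P(1)] param_chart(2)[OF P(1)]])
      show "coord_box W J \<subseteq> coord_box UNIV J" by (auto simp: coord_box_def)
    qed (use P param_chart(3,4)[OF P(1)] open_coord_box in auto)
  qed
  show "(\<Union>c\<in>matlas (mapping_torus A). fst c) = topspace (mtop (mapping_torus A))"
  proof
    show "(\<Union>c\<in>matlas (mapping_torus A). fst c) \<subseteq> topspace (mtop (mapping_torus A))"
      using ch openin_subset by (fastforce simp: is_chart_def)
    show "topspace (mtop (mapping_torus A)) \<subseteq> (\<Union>c\<in>matlas (mapping_torus A). fst c)"
    proof
      fix p assume "p \<in> topspace (mtop (mapping_torus A))"
      then obtain P J z where p: "(P, J) \<in> mt_params" "z $ None \<in> J" "p = P z" by (rule mt_cases)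
      let ?W = "ball (torus_part z) (1/2)"
      have "inverse_chart P (coord_box ?W J) \<in> matlas (mapping_torus A)"
        using p(1) inj_on_torus_proj_ball unfolding matlas_eq by blast
      moreover have "p \<in> fst (inverse_chart P (coord_box ?W J))"
        using p(2,3) by (simp add: inverse_chart_def coord_box_def)
      ultimately show "p \<in> (\<Union>c\<in>matlas (mapping_torus A). fst c)" by blast
    qed
  qed
qed (rule smooth_transition)

lemma second_countable_mt: "second_countable (mtop (mapping_torus A))"
proof -
  obtain \<B> :: "(real^('n option)) set set" where B: "countable \<B>" "topological_basis \<B>"
    using ex_countable_basis by blast
  let ?C = "(\<lambda>(b, P, J). P ` (b \<inter> coord_box UNIV J)) ` (\<B> \<times> mt_params)"
  show ?thesis unfolding second_countable_def
  proof (intro exI[of _ ?C] conjI ballI allI impI)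
    have "countable mt_params" by (simp add: mt_params_def)
    then show "countable ?C" using B(1) by (intro countable_image countable_SIGMA) auto
  next
    fix V assume "V \<in> ?C"
    then obtain b P J where V: "b \<in> \<B>" "(P, J) \<in> mt_params" "V = P ` (b \<inter> coord_box UNIV J)" by auto
    have "open b" using B(2) V(1) topological_basis_open by blast
    then show "openin (mtop (mapping_torus A)) V" unfolding V(3)
      using V(2) by (intro param_chart(2)[OF V(2)] open_Int open_coord_box param_chart(4)[OF V(2)]) auto
  next
    fix U p assume "openin (mtop (mapping_torus A)) U \<and> p \<in> U"
    then have U: "openin (mtop (mapping_torus A)) U" "p \<in> U" by auto
    then have "p \<in> topspace (mtop (mapping_torus A))" using openin_subset by blast
    then obtain P J z where p: "(P, J) \<in> mt_params" "z $ None \<in> J" "p = P z" by (rule mt_cases)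
    have "openin (top_of_set (coord_box UNIV J)) {y \<in> coord_box UNIV J. P y \<in> U}"
      using openin_continuous_map_preimage[OF param_chart(1)[OF p(1)] U(1)] by simp
    then have "open {y \<in> coord_box UNIV J. P y \<in> U}"
      using open_coord_box[OF open_UNIV param_chart(4)[OF p(1)]] by (rule openin_open_trans)
    moreover have "z \<in> {y \<in> coord_box UNIV J. P y \<in> U}" using p U(2) by (simp add: coord_box_UNIV)
    ultimately obtain b where b: "b \<in> \<B>" "z \<in> b" "b \<subseteq> {y \<in> coord_box UNIV J. P y \<in> U}"
      by (rule topological_basisE[OF B(2)])
    have "P ` (b \<inter> coord_box UNIV J) \<in> ?C" using b(1) p(1) by force
    moreover have "p \<in> P ` (b \<inter> coord_box UNIV J)" using p b(2) by (simp add: coord_box_UNIV)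
    moreover have "P ` (b \<inter> coord_box UNIV J) \<subseteq> U" using b(3) by blast
    ultimately show "\<exists>V\<in>?C. p \<in> V \<and> V \<subseteq> U" by blast
  qed
qed

lemma compact_cylinder: "compact_space (cylinder :: ((real^'n) set \<times> real) topology)"
  by (simp add: cylinder_def compact_space_prod_topology compact_torus compact_space_subtopology)

lemma Hausdorff_cylinder: "Hausdorff_space (cylinder :: ((real^'n) set \<times> real) topology)"
  by (simp add: cylinder_def Hausdorff_space_prod_topology Hausdorff_torus Hausdorff_space_subtopology)

lemma compact_mt: "compact_space (mtop (mapping_torus A))"
  using image_compactin[OF compact_cylinder[unfolded compact_space_def] continuous_mt[of A]] mt_surj[of A]
  by (simp add: compact_space_def)

lemma closed_cyl_move:
  fixes g :: "real^('n option) \<Rightarrow> real^('n option)"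
  assumes g: "continuous_on UNIV g" "\<And>z w. cyl_proj (g z) = cyl_proj (g w) \<longleftrightarrow> cyl_proj z = cyl_proj w"
    and r: "\<And>z. z $ None = r \<Longrightarrow> g z $ None \<in> {0..1}" and rr: "0 \<le> r" "r \<le> 1"
    and C: "closedin cylinder C"
  shows "closedin cylinder {cyl_proj (g z) | z. z $ None = r \<and> cyl_proj z \<in> C}"
proof -
  let ?I = "{z :: real^('n option). z $ None = r}"
  let ?h = "\<lambda>u. cyl_proj (g (SOME z. cyl_proj z = u))"
  let ?f = "\<lambda>x. coord_join x r :: real^('n option)"
  have h: "?h (cyl_proj z) = cyl_proj (g z)" for z
    using someI[of "\<lambda>y. cyl_proj y = cyl_proj z" z] by (simp add: g(2))
  have "continuous_map euclidean (top_of_set {z::real^('n option). 0 \<le> z $ None \<and> z $ None \<le> 1}) (\<lambda>x. g (?f x))"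
    using r by (auto simp: continuous_map_in_subtopology intro!: continuous_intros
       continuous_on_compose2[OF g(1)])
  from continuous_map_compose[OF this continuous_cyl_proj]
  have "continuous_map euclidean cylinder (\<lambda>x. ?h (cyl_proj (?f x)))" by (simp add: h o_def)
  then have "continuous_map euclidean cylinder ((\<lambda>a. ?h (a, r)) \<circ> torus_proj)"
    by (simp add: cyl_proj_def o_def)
  then have ct: "continuous_map torus cylinder (\<lambda>a. ?h (a, r))"
    by (rule continuous_compose_quotient_map[OF quotient_torus])
  have "continuous_map torus cylinder (\<lambda>a. (a, r))"
    unfolding cylinder_def using rr by (intro continuous_map_pairedI) auto
  from closedin_continuous_map_preimage[OF this C]
  have "closedin torus {a \<in> topspace torus. (a, r) \<in> C}" .
  then have "compactin torus {a \<in> topspace torus. (a, r) \<in> C}"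
    by (rule closedin_compact_space[OF compact_torus])
  from image_compactin[OF this ct]
  have "closedin cylinder ((\<lambda>a. ?h (a, r)) ` {a \<in> topspace torus. (a, r) \<in> C})"
    by (rule compactin_imp_closedin[OF Hausdorff_cylinder])
  also have "(\<lambda>a. ?h (a, r)) ` {a \<in> topspace torus. (a, r) \<in> C} =
     {cyl_proj (g z) | z. z $ None = r \<and> cyl_proj z \<in> C}" (is "?L = ?R")
  proof (intro set_eqI iffI)
    fix u assume "u \<in> ?L"
    then obtain x where x: "u = ?h (torus_proj x, r)" "(torus_proj x, r) \<in> C" by (auto simp: topspace_torus)
    have "(torus_proj x, r) = cyl_proj (?f x)" by (simp add: cyl_proj_def)
    then show "u \<in> ?R" using x h[of "?f x"] by (auto intro!: exI[of _ "?f x"])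
  next
    fix u assume "u \<in> ?R"
    then obtain z where z: "u = cyl_proj (g z)" "z $ None = r" "cyl_proj z \<in> C" by blast
    have "cyl_proj z = (torus_proj (torus_part z), r)" using z(2) by (simp add: cyl_proj_def)
    then show "u \<in> ?L" using z h[of z]
      by (intro image_eqI[of _ _ "torus_proj (torus_part z)"]) (auto simp: topspace_torus)
  qed
  finally show ?thesis .
qed

lemma closed_map_mt: "closed_map cylinder (mtop (mapping_torus A)) (mt_proj A)"
  unfolding closed_map_def
proof (intro allI impI)
  fix C :: "((real^'n) set \<times> real) set" assume C: "closedin cylinder C"
  have Csub: "C \<subseteq> topspace cylinder" using C closedin_subset by blast
  have eq: "{u \<in> topspace cylinder. mt_proj A u \<in> mt_proj A ` C} =
    C \<union> {cyl_proj (deck A z) | z. z $ None = 0 \<and> cyl_proj z \<in> C}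
      \<union> {cyl_proj (deck_inv A z) | z. z $ None = 1 \<and> cyl_proj z \<in> C}" (is "?L = ?R")
  proof (intro set_eqI iffI)
    fix u assume u: "u \<in> ?L"
    then obtain w where w: "u = cyl_proj w" "0 \<le> w $ None" "w $ None \<le> 1"
      by (auto elim: cylinder_cases)
    from u obtain v where v: "v \<in> C" "mt_proj A u = mt_proj A v" by auto
    then obtain z where z: "v = cyl_proj z" "0 \<le> z $ None" "z $ None \<le> 1"
      using Csub by (blast elim: cylinder_cases)
    consider "cyl_proj w = cyl_proj z" | "w $ None = 0" "cyl_proj z = cyl_proj (deck A w)"
      | "z $ None = 0" "cyl_proj w = cyl_proj (deck A z)"
      using v(2) mt_cyl_eq[OF A w(2,3) z(2,3)] w(1) z(1) by blast
    then show "u \<in> ?R"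
    proof cases
      case 1 then show ?thesis using v(1) w z by simp
    next
      case 2
      have "u = cyl_proj (deck_inv A (deck A w))" "deck A w $ None = 1" "cyl_proj (deck A w) \<in> C"
        using 2 w z v(1) by (simp_all add: deck_inv[OF A] deck_None[OF A])
      then show ?thesis by blast
    next
      case 3 then show ?thesis using v(1) w z by blast
    qed
  next
    fix u assume "u \<in> ?R"
    then consider "u \<in> C" | z where "u = cyl_proj (deck A z)" "z $ None = 0" "cyl_proj z \<in> C"
      | z where "u = cyl_proj (deck_inv A z)" "z $ None = 1" "cyl_proj z \<in> C" by blast
    then show "u \<in> ?L"
    proof cases
      case 1 then show ?thesis using Csub by blast
    next
      case 2
      have e: "mt_proj A u = mt_proj A (cyl_proj z)" unfolding 2(1)
        using 2(2) by (subst mt_cyl_eq[OF A]) (auto simp: deck_None[OF A])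
      have "u \<in> topspace cylinder" unfolding 2(1)
        using 2(2) by (intro cyl_proj_in) (simp add: deck_None[OF A])
      then show ?thesis using e 2(3) by simp
    next
      case 3
      have e: "mt_proj A u = mt_proj A (cyl_proj z)" unfolding 3(1)
        using 3(2) by (subst mt_cyl_eq[OF A]) (auto simp: deck_inv_None[OF A] deck_inv[OF A])
      have "u \<in> topspace cylinder" unfolding 3(1)
        using 3(2) by (intro cyl_proj_in) (simp add: deck_inv_None[OF A])
      then show ?thesis using e 3(3) by simp
    qed
  qed
  have di: "cyl_proj (deck_inv A z) = cyl_proj (deck_inv A w) \<longleftrightarrow> cyl_proj z = cyl_proj w" for z w
    using cyl_deck_eq[OF A, of "deck_inv A z" "deck_inv A w"] by (simp add: deck_inv[OF A])
  have "closedin cylinder ?L" unfolding eq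
  proof (intro closedin_Un C closed_cyl_move)
    show "continuous_on UNIV (deck A)" by (rule continuous_deck) (rule continuous_on_id)
    show "continuous_on UNIV (deck_inv A)" by (rule continuous_deck_inv[OF A]) (rule continuous_on_id)
  qed (auto simp: cyl_deck_eq[OF A] di deck_None[OF A] deck_inv_None[OF A])
  moreover have "mt_proj A ` C \<subseteq> topspace (mtop (mapping_torus A))"
    using Csub mt_surj[of A] by blast
  ultimately show "closedin (mtop (mapping_torus A)) (mt_proj A ` C)"
    using quotient_mt[of A] unfolding quotient_map_closedin by blast
qed

lemma smooth_manifold_mapping_torus: "smooth_manifold (mapping_torus A)"
proof -
  have "normal_space (cylinder :: ((real^'n) set \<times> real) topology)"
    using compact_cylinder Hausdorff_cylinder by (simp add: compact_Hausdorff_or_regular_imp_normal_space)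
  then have "Hausdorff_space (mtop (mapping_torus A))"
    using normal_Hausdorff_space_closed_continuous_map_image[OF _ Hausdorff_cylinder closed_map_mt
       continuous_mt[of A] mt_surj] by blast
  then show ?thesis by (simp add: smooth_manifold_def second_countable_mt smooth_atlas_mt)
qed

end

end

(*
  If det A = 1 then A lies in the identity component of GL(n,R), and a path g from A to 1 in
  GL(n,R) provides a frame: in a chart with interval coordinate t the isomorphism of tangent spaces
  with R^(n+1) is g(t) + 1 (direct sum), continued to t < 0 across the seam by g(t+1) A + 1. At t = 0
  the two agree because g(1) A = A = g(0).

  An orienting atlas, and likewise a trivialization of the sum of the tangent bundle with a
  k-dimensional trivial bundle, assigns to every chart a nowhere vanishing continuous function, such
  that the functions of two charts differ in sign by the sign of the Jacobian determinant of the
  transition. For det A = -1 there is no such assignment: an interior chart and a seam chart with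
  connected domains overlap in two pieces, and the Jacobian determinants there are 1 and -1.
*)
theory Submission
  imports "Jordan_Normal_Form.Determinant" Defs
begin

text \<open>Two obstacles shape the argument. The atlas contains charts over arbitrary open sets
  that inject into the torus, so a chart domain may be disconnected; an orientation therefore has to
  be recorded as a function on each chart and not as one sign per chart. Orientability and stable
  parallelizability are reduced separately to the existence of such functions, and neither negative
  claim is deduced from the other. In the stable case the rank is a number, not a type, so two kinds
  of determinant meet: one for matrices indexed by naturals and one for matrices indexed by a finite
  type. No block formula relates them. Only signs matter, and the sign of a continuous nowhere
  vanishing function on the general linear group is fixed by its values at the identity and at one
  reflection. The same description of the two path components yields the path \<open>g\<close> used
  for the frame. Moreover the rank \<open>k'\<close> of the trivial bundle is not given to be the
  rank of the stabilized tangent bundle; this equality comes out of a trace comparison.\<close>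

section \<open>Determinants of variable size\<close>

text \<open>The rank \<open>n + 1 + k\<close> of the stabilized tangent bundle depends on the bound variable \<open>k\<close>,
  so that its matrices cannot be indexed by a type.\<close>

definition ndet :: "nat \<Rightarrow> (nat \<Rightarrow> nat \<Rightarrow> real) \<Rightarrow> real" where
  "ndet m P = Determinant.det (Matrix.mat m m (\<lambda>(i, j). P i j))"

lemma ndet_mult: "ndet m (\<lambda>i j. \<Sum>k<m. P i k * Q k j) = ndet m P * ndet m Q"
proof -
  have "Matrix.mat m m (\<lambda>(i, j). \<Sum>k<m. P i k * Q k j) =
      Matrix.mat m m (\<lambda>(i, j). P i j) * Matrix.mat m m (\<lambda>(i, j). Q i j)"
    by (rule eq_matI) (auto simp: scalar_prod_def atLeast0LessThan)
  then show ?thesis unfolding ndet_def by (simp add: det_mult[of _ m])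
qed

lemma ndet_diagonal:
  assumes "\<And>i j. i < m \<Longrightarrow> j < m \<Longrightarrow> i \<noteq> j \<Longrightarrow> P i j = 0"
  shows "ndet m P = (\<Prod>i<m. P i i)"
  unfolding ndet_def
  by (subst det_lower_triangular[of m])
    (auto simp: assms prod_list_diag_prod atLeast0LessThan)

lemma ndet_cong: "(\<And>i j. i < m \<Longrightarrow> j < m \<Longrightarrow> P i j = Q i j) \<Longrightarrow> ndet m P = ndet m Q"
  unfolding ndet_def by (rule arg_cong[of _ _ Determinant.det]) auto

text \<open>The Leibniz formula exhibits the determinant as a polynomial in the entries.\<close>

lemma continuous_on_ndet:
  assumes "\<And>i j. i < m \<Longrightarrow> j < m \<Longrightarrow> continuous_on S (\<lambda>t. P t i j)"
  shows "continuous_on S (\<lambda>t. ndet m (P t))"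
proof -
  have "ndet m (P t) = (\<Sum>p | p permutes {0..<m}. signof p * (\<Prod>i = 0..<m. P t i (p i)))" for t
    unfolding ndet_def
    by (subst det_def'[of _ m]) (auto intro!: sum.cong prod.cong simp: permutes_def dest: permutes_in_image)
  then show ?thesis
    using assms by (auto intro!: continuous_intros dest: permutes_in_image)
qed

hide_const (open) Determinant.det Matrix.mat Matrix.row Matrix.vec
no_notation vec_index (infixl "$" 100)

section \<open>Path components of the general linear group\<close>

abbreviation GL :: "(real^'n^'n) set" where "GL \<equiv> {M. invertible M}"

text \<open>The pointwise product of two paths of invertible matrices is again such a path. This
  makes the property "joined to the identity or to a fixed reflection" stable under
  products.\<close>

lemma path_component_mult:
  fixes A B :: "real^'n^'n"
  assumes "path_component GL A A'" "path_component GL B B'"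
  shows "path_component GL (A ** B) (A' ** B')"
proof -
  obtain p q where p: "path p" "path_image p \<subseteq> GL" "pathstart p = A" "pathfinish p = A'"
    and q: "path q" "path_image q \<subseteq> GL" "pathstart q = B" "pathfinish q = B'"
    using assms unfolding path_component_def by blast
  have "path (\<lambda>t. p t ** q t)"
    using p(1) q(1) unfolding path_def matrix_matrix_mult_def by (intro continuous_intros)
  moreover have "path_image (\<lambda>t. p t ** q t) \<subseteq> GL"
    using p(2) q(2) by (auto simp: path_image_def intro!: invertible_mult)
  ultimately show ?thesis
    using p(3,4) q(3,4) unfolding path_component_def
    by (intro exI[of _ "\<lambda>t. p t ** q t"]) (auto simp: pathstart_def pathfinish_def)
qed

text \<open>The Householder reflection in the hyperplane orthogonal to \<open>u\<close>. Dividing by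
  \<open>u \<bullet> u\<close> admits every nonzero \<open>u\<close>, so that reflections can be
  moved along segments without normalizing.\<close>

definition reflection :: "real^'n \<Rightarrow> real^'n^'n" where
  "reflection u = (\<chi> i j. (if i = j then 1 else 0) - 2 * (u $ i) * (u $ j) / (u \<bullet> u))"

lemma reflection_axis:
  "reflection (axis k 1) = (\<chi> i j. if i = j then if i = k then - 1 else 1 else 0)"
  by (simp add: reflection_def vec_eq_iff inner_axis_axis) (simp add: axis_def)

text \<open>In the product, the two cross terms \<open>- 2 * u $ i * u $ j / s\<close> are cancelled
  by the quadratic term, whose sum over \<open>k\<close> contributes one factor
  \<open>s\<close>.\<close>

lemma reflection_involution:
  assumes "u \<noteq> 0" shows "reflection u ** reflection u = mat 1"
proof -
  define s where "s = u \<bullet> u"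
  have s: "s \<noteq> 0" "(\<Sum>k\<in>UNIV. (u $ k) * (u $ k)) = s"
    using assms by (simp add: s_def) (simp add: s_def inner_vec_def)
  have "(\<Sum>k\<in>UNIV. ((if i = k then 1 else 0) - 2 * u $ i * u $ k / s) * ((if k = j then 1 else 0) - 2 * u $ k * u $ j / s))
     = (if i = j then 1 else 0)" for i j
  proof -
    have "(\<Sum>k\<in>UNIV. ((if i = k then 1 else 0) - 2 * u $ i * u $ k / s) * ((if k = j then 1 else 0) - 2 * u $ k * u $ j / s))
      = (\<Sum>k\<in>UNIV. (if i = k then if k = j then 1 else 0 else 0) - (if i = k then 2 * u $ k * u $ j / s else 0)
          - (if k = j then 2 * u $ i * u $ k / s else 0) + (4 * u $ i * u $ j / s\<^sup>2) * (u $ k * u $ k))"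
      using s(1) by (intro sum.cong) (auto simp: field_simps power2_eq_square)
    also have "\<dots> = (if i = j then 1 else 0) - 2 * u $ i * u $ j / s - 2 * u $ i * u $ j / s + (4 * u $ i * u $ j / s\<^sup>2) * s"
      by (simp only: sum.distrib sum_subtractf sum.delta sum.delta' finite UNIV_I if_True s(2) flip: sum_distrib_left)
    also have "\<dots> = (if i = j then 1 else 0)" using s(1) by (simp add: power2_eq_square)
    finally show ?thesis .
  qed
  then show ?thesis
    by (simp add: matrix_matrix_mult_def reflection_def mat_def vec_eq_iff flip: s_def)
qed

lemma invertible_reflection: "u \<noteq> 0 \<Longrightarrow> invertible (reflection u)"
  using reflection_involution unfolding invertible_def by blast

text \<open>A segment between nonzero vectors misses 0 unless they point in opposite directions, and
  in that case \<open>v\<close> may be replaced by \<open>- v\<close>, which has the same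
  reflection.\<close>

lemma path_component_reflection:
  fixes u v :: "real^'n"
  assumes "u \<noteq> 0" "v \<noteq> 0"
  shows "path_component GL (reflection u) (reflection v)"
proof -
  have seg: "path_component GL (reflection u) (reflection w)" if w: "0 \<notin> closed_segment u w" for w
  proof -
    have lp: "linepath u w t \<noteq> 0" if "t \<in> {0..1}" for t
      using that w linepath_image_01[of u w] by (metis imageI)
    have "path (\<lambda>t. reflection (linepath u w t))" unfolding path_def reflection_def
      using lp by (intro continuous_intros continuous_on_vec_lambda) auto
    then show ?thesis using lp unfolding path_component_def
      by (intro exI[of _ "\<lambda>t. reflection (linepath u w t)"])
        (auto simp: path_image_def pathstart_def pathfinish_def linepath_0' linepath_1' intro!: invertible_reflection)
  qed
  have "reflection (- v) = reflection v" by (simp add: reflection_def)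
  moreover have "0 \<notin> closed_segment u v \<or> 0 \<notin> closed_segment u (- v)"
  proof (rule ccontr)
    assume "\<not> ?thesis"
    then obtain s t where s: "0 \<le> s" "s \<le> 1" "(1 - s) *\<^sub>R u + s *\<^sub>R v = 0"
      and t: "0 \<le> t" "t \<le> 1" "(1 - t) *\<^sub>R u - t *\<^sub>R v = 0"
      by (auto simp: in_segment)
    \<comment> \<open>Weighting the two equations by \<open>t\<close> and \<open>s\<close>
      eliminates \<open>v\<close>. Both remaining coefficients of \<open>u\<close> are nonnegative,
      hence zero, which forces \<open>s = t = 0\<close> or \<open>s = t = 1\<close> and so
      \<open>u = 0\<close> or \<open>v = 0\<close>.\<close>
    have "t *\<^sub>R ((1 - s) *\<^sub>R u + s *\<^sub>R v) + s *\<^sub>R ((1 - t) *\<^sub>R u - t *\<^sub>R v) = (t * (1 - s) + s * (1 - t)) *\<^sub>R u"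
      by (simp add: vec_eq_iff algebra_simps)
    then have "t * (1 - s) + s * (1 - t) = 0" using s t assms by simp
    moreover have "t * (1 - s) \<ge> 0" "s * (1 - t) \<ge> 0" using s t by simp_all
    ultimately have "t * (1 - s) = 0" "s * (1 - t) = 0" by linarith+
    then show False using s t assms by auto
  qed
  ultimately show ?thesis using seg[of v] seg[of "- v"] by auto
qed

text \<open>The property passes to products because \<open>?R\<close> is an involution, so it
  suffices to check the generators: diagonal matrices, transpositions and shears. A matrix with a
  zero row is not invertible.\<close>

lemma path_component_GL:
  fixes A :: "real^'n^'n"
  assumes "invertible A"
  shows "path_component GL A (mat 1) \<or> path_component GL A (reflection (axis k 1))"
proof -
  let ?R = "reflection (axis k 1) :: real^'n^'n"
  let ?P = "\<lambda>A. path_component GL A (mat 1) \<or> path_component GL A ?R"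
  have one: "path_component GL (mat 1 :: real^'n^'n) (mat 1)"
    by (auto simp: path_component_refl_eq invertible_def intro!: exI[of _ "mat 1"])
  have RR: "?R ** ?R = mat 1" by (rule reflection_involution) (simp add: axis_eq_0_iff)
  have R: "?P (reflection u)" if "u \<noteq> 0" for u
    using path_component_reflection[OF that, of "axis k 1"] by (simp add: axis_eq_0_iff)
  have mult: "?P (A ** B)" if "?P A" "?P B" for A B :: "real^'n^'n"
    using that path_component_mult[of A "mat 1" B "mat 1"] path_component_mult[of A ?R B "mat 1"]
      path_component_mult[of A "mat 1" B ?R] path_component_mult[of A ?R B ?R]
    by (auto simp: RR)
  \<comment> \<open>The diagonal sign matrices, with \<open>- 1\<close> exactly on \<open>S\<close>;
    each is a product of axis reflections, one for every element of \<open>S\<close>.\<close>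
  define D where "D S = (\<chi> i j. if i = j then if i \<in> S then - 1 else 1 else (0::real))" for S :: "'n set"
  have D: "?P (D S)" for S
  proof (induction S rule: finite_induct[OF finite])
    case 1
    have "D {} = mat 1" by (simp add: D_def mat_def vec_eq_iff)
    then show ?case using one by simp
  next
    case (2 i S)
    have "D (insert i S) = D S ** reflection (axis i 1)"
    proof -
      have "(\<Sum>c\<in>UNIV. (if a = c then if a \<in> S then - 1 else 1 else 0) * (if c = b then if c = i then - 1 else 1 else 0)) =
        (\<Sum>c\<in>UNIV. if a = c then if a = b then if a \<in> insert i S then - 1 else 1 else 0 else (0::real))" for a b
        using 2(2) by (intro sum.cong) auto
      then show ?thesis
        by (simp add: D_def reflection_axis matrix_matrix_mult_def vec_eq_iff)
    qed
    then show ?case using mult[OF 2(3) R[of "axis i 1"]] by (simp add: axis_eq_0_iff)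
  qed
  have "invertible A \<longrightarrow> ?P A"
  proof (induction A rule: induct_matrix_elementary_alt)
    case (1 A B)
    show ?case
    proof
      assume "invertible (A ** B)"
      then have "invertible A" "invertible B" by (simp_all add: invertible_det_nz det_mul)
      then show "?P (A ** B)" using mult[of A B] 1 by blast
    qed
  next
    case (2 A i)
    then show ?case using det_zero_row(1)[of i A] by (simp add: invertible_det_nz row_def vec_eq_iff)
  next
    case (3 A)
    show ?case
    proof
      assume "invertible A"
      then have nz: "A $ i $ i \<noteq> 0" for i using det_diagonal[of A] 3 by (auto simp: invertible_det_nz)
      let ?S = "{i. A $ i $ i < 0}"
      \<comment> \<open>Every diagonal entry moves straight towards its own sign, so none of them
        meets 0 on the way.\<close>
      let ?g = "\<lambda>t. (1 - t) *\<^sub>R A + t *\<^sub>R D ?S"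
      have "invertible (?g t)" if t: "0 \<le> t" "t \<le> 1" for t
      proof -
        have "?g t $ i $ i \<noteq> 0" for i
        proof (cases "A $ i $ i < 0")
          case True
          then have "(1 - t) * A $ i $ i \<le> 0" using t by (intro mult_nonneg_nonpos) auto
          then show ?thesis using True t by (cases "t = 0") (auto simp: D_def)
        next
          case False
          then have "(1 - t) * A $ i $ i \<ge> 0" using t by (intro mult_nonneg_nonneg) auto
          then have "t \<noteq> 0 \<Longrightarrow> (1 - t) * A $ i $ i + t \<noteq> 0" using t by linarith
          then show ?thesis using False nz[of i] by (cases "t = 0") (auto simp: D_def)
        qed
        moreover have "?g t $ i $ j = 0" if "i \<noteq> j" for i j using 3 that by (simp add: D_def)
        ultimately show ?thesis
          unfolding invertible_det_nz by (subst det_diagonal) (blast, simp add: prod_zero_iff)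
      qed
      moreover have "path ?g" unfolding path_def by (intro continuous_intros)
      ultimately have "path_component GL A (D ?S)" unfolding path_component_def
        by (intro exI[of _ ?g]) (auto simp: path_image_def pathstart_def pathfinish_def)
      then show "?P A" using D[of ?S] path_component_trans by blast
    qed
  next
    case (4 m n)
    \<comment> \<open>a transposition of coordinates is the reflection in the difference of two basis vectors\<close>
    have "(axis m 1 - axis n 1) \<bullet> (axis m 1 - axis n 1 :: real^'n) = 2"
      using 4 by (simp add: inner_diff_left inner_diff_right inner_axis_axis)
    then have "(\<chi> i j. mat 1 $ i $ Transposition.transpose m n j) = reflection (axis m 1 - axis n 1 :: real^'n)"
      using 4 by (simp add: vec_eq_iff reflection_def mat_def) (auto simp: axis_def Transposition.transpose_def)
    moreover have "axis m 1 - axis n 1 \<noteq> (0 :: real^'n)" using 4 by (auto simp: axis_def vec_eq_iff)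
    ultimately show ?case using R by simp
  next
    case (5 m n)
    \<comment> \<open>The shears with fixed \<open>m \<noteq> n\<close> form a one-parameter group,
      which gives the inverse \<open>g (- t)\<close> directly.\<close>
    define g where "g t = (\<chi> i j. (if i = j then 1 else 0) + (if i = m \<and> j = n then t else (0::real)))" for t
    have "g s ** g t = g (s + t)" for s t
    proof -
      have "(\<Sum>k\<in>UNIV. ((if i = k then 1 else 0) + (if i = m \<and> k = n then s else 0)) * ((if k = j then 1 else 0) + (if k = m \<and> j = n then t else 0)))
        = (if i = j then 1 else 0) + (if i = m \<and> j = n then s + t else 0)" for i j
      proof -
        have "(\<Sum>k\<in>UNIV. ((if i = k then 1 else 0) + (if i = m \<and> k = n then s else 0)) * ((if k = j then 1 else 0) + (if k = m \<and> j = n then t else 0)))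
          = (\<Sum>k\<in>UNIV. (if i = k then (if i = j then 1 else 0) + (if i = m \<and> j = n then t else 0) else 0)
              + (if k = n then if i = m \<and> n = j then s else 0 else 0))"
          using 5 by (intro sum.cong) auto
        then show ?thesis by (auto simp: sum.distrib)
      qed
      then show ?thesis by (simp add: g_def matrix_matrix_mult_def vec_eq_iff)
    qed
    moreover have g0: "g 0 = mat 1" by (simp add: g_def mat_def vec_eq_iff)
    ultimately have "invertible (g t)" for t
      unfolding invertible_def by (intro exI[of _ "g (- t)"]) simp
    moreover have "path g" unfolding path_def g_def
    proof (intro continuous_intros continuous_on_vec_lambda)
      show "continuous_on {0..1} (\<lambda>t. if i = m \<and> j = n then t else 0)" for i j
        by (cases "i = m \<and> j = n") (auto intro: continuous_intros)
    qed
    moreover have "g 1 = (\<chi> i j. of_bool (i = m \<and> j = n \<or> i = j))"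
      using 5 by (auto simp: g_def vec_eq_iff)
    ultimately have "path_component GL (mat 1) (\<chi> i j. of_bool (i = m \<and> j = n \<or> i = j))"
      unfolding path_component_def using g0
      by (intro exI[of _ g]) (auto simp: path_image_def pathstart_def pathfinish_def)
    then show ?case using path_component_sym by blast
  qed
  then show ?thesis using assms by blast
qed

text \<open>The intermediate value theorem along a path. It is applied to matrices in
  \<open>GL\<close> and later to points of a coordinate box.\<close>

lemma sgn_path_component:
  assumes "path_component S a b" "continuous_on S h" "\<And>x. x \<in> S \<Longrightarrow> h x \<noteq> (0::real)"
  shows "sgn (h a) = sgn (h b)"
proof -
  obtain g where g: "path g" "path_image g \<subseteq> S" "pathstart g = a" "pathfinish g = b"
    using assms(1) unfolding path_component_def by blast
  have "connected (h ` path_image g)"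
    by (intro connected_continuous_image continuous_on_subset[OF assms(2) g(2)] connected_path_image g(1))
  moreover have "h a \<in> h ` path_image g" "h b \<in> h ` path_image g"
    using g pathstart_in_path_image pathfinish_in_path_image by blast+
  moreover have "0 \<notin> h ` path_image g" using g(2) assms(3) by force
  ultimately show ?thesis
    using connectedD_interval[of "h ` path_image g" "h a" "h b" 0] connectedD_interval[of "h ` path_image g" "h b" "h a" 0]
    by (auto simp: sgn_if)
qed

lemma det_reflection_axis: "det (reflection (axis k 1) :: real^'n^'n) = - 1"
proof -
  have "det (reflection (axis k 1) :: real^'n^'n) = (\<Prod>i\<in>UNIV. if i = k then - 1 else 1)"
    by (subst det_diagonal) (auto simp: reflection_axis)
  then show ?thesis by simp
qed

lemma continuous_on_det: "continuous_on S (det :: real^'n^'n \<Rightarrow> real)"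
  unfolding det_def by (intro continuous_intros)

text \<open>Since \<open>GL\<close> has just two components, the sign of the determinant of any matrix built from
  \<open>M\<close> can be found by looking at the identity and one reflection.\<close>

lemma sgn_det_unique:
  fixes h :: "real^'n^'n \<Rightarrow> real"
  assumes "continuous_on GL h" "\<And>M. invertible M \<Longrightarrow> h M \<noteq> 0"
    and "h (mat 1) > 0" "h (reflection (axis k 1)) < 0" and "invertible M"
  shows "sgn (h M) = sgn (det M)"
proof -
  have d: "det x \<noteq> 0" if "x \<in> GL" for x :: "real^'n^'n" using that by (simp add: invertible_det_nz)
  have h: "h x \<noteq> 0" if "x \<in> GL" for x using that assms(2) by blast
  show ?thesis using path_component_GL[OF assms(5), of k]
  proof
    assume *: "path_component GL M (mat 1)"
    have "sgn (h M) = 1" "sgn (det M) = 1"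
      using sgn_path_component[OF * assms(1) h] sgn_path_component[OF * continuous_on_det d] assms(3) by simp_all
    then show ?thesis by simp
  next
    assume *: "path_component GL M (reflection (axis k 1))"
    have "sgn (h M) = - 1" "sgn (det M) = - 1"
      using sgn_path_component[OF * assms(1) h] sgn_path_component[OF * continuous_on_det d] assms(4)
      by (simp_all add: det_reflection_axis)
    then show ?thesis by simp
  qed
qed

text \<open>The sign of \<open>det\<close> is constant along a path in \<open>GL\<close>, so a
  matrix joined to a reflection would have negative determinant.\<close>

lemma path_component_det_pos:
  fixes M :: "real^'n^'n"
  assumes "det M > 0" shows "path_component GL M (mat 1)"
proof (rule ccontr)
  assume "\<not> ?thesis"
  moreover have "invertible M" using assms by (simp add: invertible_det_nz)
  ultimately have *: "path_component GL M (reflection (axis undefined 1))" using path_component_GL by blast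
  have "det x \<noteq> 0" if "x \<in> GL" for x :: "real^'n^'n" using that by (simp add: invertible_det_nz)
  from sgn_path_component[OF * continuous_on_det this] show False
    using assms by (simp add: det_reflection_axis)
qed

section \<open>Transition maps and tangent vectors\<close>

abbreviation dtr :: "('p, 'm::finite) chart \<Rightarrow> ('p, 'm) chart \<Rightarrow> 'p \<Rightarrow> real^'m \<Rightarrow> real^'m" where
  "dtr c d p \<equiv> frechet_derivative (transition c d) (at (snd c p))"

abbreviation chart_inv :: "('p, 'm::finite) chart \<Rightarrow> real^'m \<Rightarrow> 'p" where
  "chart_inv c \<equiv> inv_into (fst c) (snd c)"

lemma is_chartD:
  assumes "is_chart X c"
  shows "openin X (fst c)" "fst c \<subseteq> topspace X"
    "homeomorphic_map (subtopology X (fst c)) (top_of_set (snd c ` fst c)) (snd c)"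
  using assms openin_subset unfolding is_chart_def by blast+

lemma chart_inj: assumes "is_chart X c" shows "inj_on (snd c) (fst c)"
  using homeomorphic_imp_injective_map[OF is_chartD(3)[OF assms]] is_chartD(2)[OF assms]
  by (simp add: Int_absorb1)

lemma chart_inv_apply: "is_chart X c \<Longrightarrow> p \<in> fst c \<Longrightarrow> chart_inv c (snd c p) = p"
  by (simp add: chart_inj)

lemma transition_apply: "is_chart X c \<Longrightarrow> p \<in> fst c \<Longrightarrow> transition c d (snd c p) = snd d p"
  by (simp add: transition_def chart_inv_apply)

lemma continuous_chart:
  assumes "is_chart X c" shows "continuous_map (subtopology X (fst c)) euclidean (snd c)"
  using homeomorphic_imp_continuous_map[OF is_chartD(3)[OF assms]]
  by (simp add: continuous_map_in_subtopology)

lemma continuous_chart_inv: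
  assumes "is_chart X c"
  shows "continuous_map (top_of_set (snd c ` fst c)) (subtopology X (fst c)) (chart_inv c)"
proof -
  have sub: "fst c \<subseteq> topspace X" by (rule is_chartD(2)[OF assms])
  obtain g where g: "homeomorphic_maps (subtopology X (fst c)) (top_of_set (snd c ` fst c)) (snd c) g"
    using assms homeomorphic_map_maps is_chartD(3) by blast
  then have "continuous_map (top_of_set (snd c ` fst c)) (subtopology X (fst c)) g"
    by (simp add: homeomorphic_maps_def)
  then show ?thesis
  proof (rule continuous_map_eq)
    fix z assume "z \<in> topspace (top_of_set (snd c ` fst c))"
    then obtain p where p: "p \<in> fst c" "z = snd c p" by auto
    then have "g z = p" using g sub by (auto simp: homeomorphic_maps_def)
    then show "g z = chart_inv c z" using p chart_inv_apply[OF assms] by simp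
  qed
qed

text \<open>The image is the preimage of \<open>U\<close> under the continuous inverse of the chart.
  Openness is what makes derivatives at points of an overlap independent of the values of transition
  maps elsewhere.\<close>

lemma open_chart_image:
  assumes "is_chart X c" "openin X U" shows "open (snd c ` (fst c \<inter> U))"
proof -
  have "openin (top_of_set (snd c ` fst c)) {z \<in> topspace (top_of_set (snd c ` fst c)). chart_inv c z \<in> fst c \<inter> U}"
    using assms by (intro openin_continuous_map_preimage[OF continuous_chart_inv])
      (auto simp: openin_subtopology)
  moreover have "{z \<in> topspace (top_of_set (snd c ` fst c)). chart_inv c z \<in> fst c \<inter> U} = snd c ` (fst c \<inter> U)"
    using chart_inv_apply[OF assms(1)] by auto
  ultimately show ?thesis using assms(1) openin_open_trans by (auto simp: is_chart_def)
qed

text \<open>The chain rule for germs: transition maps compose correctly only on overlaps, since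
  \<open>inv_into\<close> takes arbitrary values off the image of a chart.\<close>

lemma has_derivative_local_comp:
  assumes "open N" "x \<in> N" "\<And>y. y \<in> N \<Longrightarrow> h y = g (f y)"
    and "f differentiable at x" "g differentiable at (f x)"
  shows "frechet_derivative h (at x) = frechet_derivative g (at (f x)) \<circ> frechet_derivative f (at x)"
proof -
  have "(g \<circ> f has_derivative frechet_derivative g (at (f x)) \<circ> frechet_derivative f (at x)) (at x)"
    by (intro diff_chain_at) (use assms(4,5) frechet_derivative_works in blast)+
  then have "(h has_derivative frechet_derivative g (at (f x)) \<circ> frechet_derivative f (at x)) (at x)"
    by (rule has_derivative_transform_within_open[OF _ assms(1,2)]) (simp add: assms(3))
  from frechet_derivative_at[OF this] show ?thesis by simp
qed

section \<open>Differentials of coordinate changes in a smooth atlas\<close>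

context
  fixes X :: "'p topology" and \<A> :: "('p, 'm::finite) chart set"
  assumes atlas: "smooth_atlas X \<A>"
begin

lemma atlas_chart: "c \<in> \<A> \<Longrightarrow> is_chart X c"
  using atlas by (simp add: smooth_atlas_def)

lemma open_overlap: "c \<in> \<A> \<Longrightarrow> d \<in> \<A> \<Longrightarrow> open (snd c ` (fst c \<inter> fst d))"
  using open_chart_image[OF atlas_chart is_chartD(1)[OF atlas_chart]] .

lemma atlas_Ck: "c \<in> \<A> \<Longrightarrow> d \<in> \<A> \<Longrightarrow> Ck_on k (transition c d) (snd c ` (fst c \<inter> fst d))"
  using atlas unfolding smooth_atlas_def smooth_on_def by blast

lemma differentiable_transition:
  assumes "c \<in> \<A>" "d \<in> \<A>" "p \<in> fst c \<inter> fst d"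
  shows "transition c d differentiable (at (snd c p))"
  using atlas_Ck[OF assms(1,2), of "Suc 0"] assms(3) by simp

lemma linear_dtr: "c \<in> \<A> \<Longrightarrow> d \<in> \<A> \<Longrightarrow> p \<in> fst c \<inter> fst d \<Longrightarrow> linear (dtr c d p)"
  using differentiable_transition[THEN linear_frechet_derivative] .

lemma continuous_dtr:
  assumes "c \<in> \<A>" "d \<in> \<A>"
  shows "continuous_on (snd c ` (fst c \<inter> fst d)) (\<lambda>z. frechet_derivative (transition c d) (at z) v)"
  using atlas_Ck[OF assms, of "Suc 0"] by simp

lemma continuous_transition:
  assumes "c \<in> \<A>" "d \<in> \<A>"
  shows "continuous_on (snd c ` (fst c \<inter> fst d)) (transition c d)"
  using atlas_Ck[OF assms, of 0] by simp

text \<open>The cocycle condition, by the chain rule on the open triple overlap.\<close>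

lemma dtr_comp:
  assumes "c \<in> \<A>" "d \<in> \<A>" "e \<in> \<A>" "p \<in> fst c" "p \<in> fst d" "p \<in> fst e"
  shows "dtr d e p (dtr c d p v) = dtr c e p v"
proof -
  have "openin X (fst d \<inter> fst e)" using assms by (intro openin_Int is_chartD(1)[OF atlas_chart])
  then have N: "open (snd c ` (fst c \<inter> (fst d \<inter> fst e)))"
    by (rule open_chart_image[OF atlas_chart[OF assms(1)]])
  have t: "transition c d (snd c p) = snd d p"
    using assms by (intro transition_apply[OF atlas_chart]) auto
  have "dtr c e p = frechet_derivative (transition d e) (at (transition c d (snd c p))) \<circ> dtr c d p"
  proof (rule has_derivative_local_comp[OF N])
    show "transition c e y = transition d e (transition c d y)"
      if y: "y \<in> snd c ` (fst c \<inter> (fst d \<inter> fst e))" for y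
    proof -
      obtain q where "q \<in> fst c" "q \<in> fst d" "q \<in> fst e" "y = snd c q" using y by blast
      then show ?thesis using assms atlas_chart by (simp add: transition_apply[of X])
    qed
    show "transition d e differentiable at (transition c d (snd c p))"
      unfolding t using assms by (intro differentiable_transition) auto
  qed (use assms differentiable_transition in auto)
  then show ?thesis by (simp add: t)
qed

lemma dtr_self:
  assumes "c \<in> \<A>" "p \<in> fst c" shows "dtr c c p v = v"
proof -
  have "frechet_derivative (transition c c) (at (snd c p)) = (\<lambda>v. v)"
  proof (rule frechet_derivative_at[symmetric], rule has_derivative_transform_within_open[OF has_derivative_ident])
    show "open (snd c ` (fst c \<inter> fst c))" using open_overlap assms by blast
    show "snd c p \<in> snd c ` (fst c \<inter> fst c)" using assms by blast
    show "y = transition c c y" if "y \<in> snd c ` (fst c \<inter> fst c)" for y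
      using that transition_apply[OF atlas_chart[OF assms(1)], of _ c] by auto
  qed
  then show ?thesis by simp
qed

end

text \<open>The inverse of reading off the coordinates in the chart \<open>c\<close>: the
  coordinates in all other charts are forced, by the transformation rule around \<open>p\<close> and
  by the zero convention elsewhere.\<close>

definition tangent_lift ::
    "('p, 'm::finite) manifold \<Rightarrow> ('p, 'm) chart \<Rightarrow> 'p \<Rightarrow> real^'m \<Rightarrow> 'p \<times> (('p, 'm) chart \<Rightarrow> real^'m)" where
  "tangent_lift M c p v = (p, \<lambda>d. if d \<in> matlas M \<and> p \<in> fst d then dtr c d p v else 0)"

section \<open>Tangent vectors and their coordinates in one chart\<close>

context
  fixes M :: "('p, 'm::finite) manifold"
  assumes atlas: "smooth_atlas (mtop M) (matlas M)"
begin

lemma openin_tangent_base: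
  "c \<in> matlas M \<Longrightarrow> open G \<Longrightarrow>
    openin (tangent_topology M) {(p, v) \<in> tangent_vectors M. p \<in> fst c \<and> (snd c p, v c) \<in> G}"
  unfolding tangent_topology_def by (rule topology_generated_by_Basis) blast

lemma topspace_tangent: "topspace (tangent_topology M) = tangent_vectors M"
proof
  show "topspace (tangent_topology M) \<subseteq> tangent_vectors M"
    unfolding tangent_topology_def topology_generated_by_topspace
    by (intro Union_least) (elim CollectE exE conjE, simp add: subset_iff)
  show "tangent_vectors M \<subseteq> topspace (tangent_topology M)"
  proof
    fix u assume u: "u \<in> tangent_vectors M"
    then have "fst u \<in> topspace (mtop M)" by (auto simp: tangent_vectors_def)
    then obtain c where c: "c \<in> matlas M" "fst u \<in> fst c" using atlas unfolding smooth_atlas_def by blast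
    then have "u \<in> {(p, v) \<in> tangent_vectors M. p \<in> fst c \<and> (snd c p, v c) \<in> UNIV}"
      using u by (simp add: case_prod_beta)
    then show "u \<in> topspace (tangent_topology M)"
      using openin_subset[OF openin_tangent_base[OF c(1) open_UNIV]] by (rule subsetD[rotated])
  qed
qed

lemma tangent_lift_in:
  assumes "c \<in> matlas M" "p \<in> fst c" shows "tangent_lift M c p v \<in> tangent_vectors M"
proof -
  have "p \<in> topspace (mtop M)" using is_chartD(2)[OF atlas_chart[OF atlas assms(1)]] assms(2) by blast
  moreover have "dtr d e p (dtr c d p v) = dtr c e p v"
    if "d \<in> matlas M" "e \<in> matlas M" "p \<in> fst d \<inter> fst e" for d e
    using that dtr_comp[OF atlas assms(1) that(1,2) assms(2)] by simp
  ultimately show ?thesis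
    unfolding tangent_lift_def tangent_vectors_def mem_Collect_eq prod.case
    by (intro conjI ballI allI impI) auto
qed

lemma tangent_vectorsD:
  assumes "(p, w) \<in> tangent_vectors M"
  shows "p \<in> topspace (mtop M)" "c \<notin> matlas M \<or> p \<notin> fst c \<Longrightarrow> w c = 0"
    "c \<in> matlas M \<Longrightarrow> d \<in> matlas M \<Longrightarrow> p \<in> fst c \<inter> fst d \<Longrightarrow> w d = dtr c d p (w c)"
proof -
  note * = assms[unfolded tangent_vectors_def mem_Collect_eq prod.case]
  show "p \<in> topspace (mtop M)" by (rule *[THEN conjunct1])
  show "c \<notin> matlas M \<or> p \<notin> fst c \<Longrightarrow> w c = 0" by (rule *[THEN conjunct2, THEN conjunct1, rule_format])
  show "c \<in> matlas M \<Longrightarrow> d \<in> matlas M \<Longrightarrow> p \<in> fst c \<inter> fst d \<Longrightarrow> w d = dtr c d p (w c)"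
    by (rule *[THEN conjunct2, THEN conjunct2, rule_format])
qed

lemma tangent_lift_eq:
  assumes "c \<in> matlas M" "p \<in> fst c" "(p, w) \<in> tangent_vectors M"
  shows "(p, w) = tangent_lift M c p (w c)"
proof -
  have "w = (\<lambda>d. if d \<in> matlas M \<and> p \<in> fst d then dtr c d p (w c) else 0)"
  proof
    fix d
    show "w d = (if d \<in> matlas M \<and> p \<in> fst d then dtr c d p (w c) else 0)"
    proof (cases "d \<in> matlas M \<and> p \<in> fst d")
      case True
      then have "w d = dtr c d p (w c)" using assms(2) by (intro tangent_vectorsD(3)[OF assms(3,1)]) auto
      then show ?thesis unfolding if_P[OF True] .
    next
      case False
      then have "w d = 0" by (intro tangent_vectorsD(2)[OF assms(3)]) blast
      then show ?thesis unfolding if_not_P[OF False] .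
    qed
  qed
  then show ?thesis unfolding tangent_lift_def by (rule arg_cong)
qed

lemma tangent_lift_change:
  assumes "c \<in> matlas M" "d \<in> matlas M" "p \<in> fst c" "p \<in> fst d"
  shows "tangent_lift M c p v = tangent_lift M d p (dtr c d p v)"
  using assms dtr_comp[OF atlas assms(1,2)] by (simp add: tangent_lift_def fun_eq_iff)

text \<open>The coordinate vector field with constant coordinates \<open>v\<close> is a continuous
  local section: membership in a basic set belonging to a chart \<open>d\<close> is decided by the
  transition map and its derivative in direction \<open>v\<close>, both continuous. Constant fields
  suffice because only basis vectors are inserted later.\<close>

lemma continuous_tangent_lift:
  assumes c: "c \<in> matlas M"
  shows "continuous_map (top_of_set (snd c ` fst c)) (tangent_topology M) (\<lambda>z. tangent_lift M c (chart_inv c z) v)"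
  unfolding tangent_topology_def
proof (rule continuous_on_generated_topo)
  let ?f = "\<lambda>z. tangent_lift M c (chart_inv c z) v" and ?Z = "snd c ` fst c"
  have inv: "chart_inv c (snd c p) = p" if "p \<in> fst c" for p
    by (rule chart_inv_apply[OF atlas_chart[OF atlas c] that])
  show "?f ` topspace (top_of_set ?Z) \<subseteq>
      \<Union>{{(p, v) \<in> tangent_vectors M. p \<in> fst c \<and> (snd c p, v c) \<in> G} |c G. c \<in> matlas M \<and> open G}"
    using topspace_tangent[unfolded tangent_topology_def topology_generated_by_topspace] tangent_lift_in[OF c]
    by (auto simp: inv)
  fix U assume "U \<in> {{(p, v) \<in> tangent_vectors M. p \<in> fst c \<and> (snd c p, v c) \<in> G} |c G. c \<in> matlas M \<and> open G}"
  then obtain d G where U: "U = {(p, v) \<in> tangent_vectors M. p \<in> fst d \<and> (snd d p, v d) \<in> G}" "d \<in> matlas M" "open G"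
    by blast
  let ?O = "snd c ` (fst c \<inter> fst d)"
  let ?g = "\<lambda>z. (transition c d z, frechet_derivative (transition c d) (at z) v)"
  have "continuous_on ?O ?g"
    using continuous_transition[OF atlas c U(2)] continuous_dtr[OF atlas c U(2)] by (intro continuous_intros)
  then have "open (?g -` G \<inter> ?O)"
    using open_overlap[OF atlas c U(2)] U(3) continuous_on_open_vimage by blast
  moreover have "?f -` U \<inter> topspace (top_of_set ?Z) = ?g -` G \<inter> ?O"
  proof -
    have "?f (snd c p) \<in> U \<longleftrightarrow> p \<in> fst d \<and> ?g (snd c p) \<in> G" if "p \<in> fst c" for p
      using tangent_lift_in[OF c that] that U(2) transition_apply[OF atlas_chart[OF atlas c] that]
      by (auto simp: U(1) inv tangent_lift_def)
    note e = this
    show ?thesis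
    proof (intro Set.set_eqI iffI)
      fix z assume z: "z \<in> ?f -` U \<inter> topspace (top_of_set ?Z)"
      then obtain p where p: "p \<in> fst c" "z = snd c p" by auto
      then have "p \<in> fst d" "?g z \<in> G" using z e[OF p(1)] by simp_all
      then show "z \<in> ?g -` G \<inter> ?O" using p by blast
    next
      fix z assume z: "z \<in> ?g -` G \<inter> ?O"
      then obtain p where p: "p \<in> fst c" "p \<in> fst d" "z = snd c p" by auto
      then have "?f z \<in> U" using z e[OF p(1)] by simp
      then show "z \<in> ?f -` U \<inter> topspace (top_of_set ?Z)" using p by simp
    qed
  qed
  ultimately show "openin (top_of_set ?Z) (?f -` U \<inter> topspace (top_of_set ?Z))"
    by (auto intro: open_subset)
qed

end

section \<open>Parallelizability from compatible frames\<close>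

lemma matrix_inv_apply:
  fixes A :: "real^'n^'n"
  assumes "invertible A"
  shows "A *v (matrix_inv A *v x) = x" "matrix_inv A *v (A *v x) = x"
proof -
  have "A ** matrix_inv A = mat 1 \<and> matrix_inv A ** A = mat 1"
    using assms unfolding invertible_def matrix_inv_def by (rule someI_ex)
  then show "A *v (matrix_inv A *v x) = x" "matrix_inv A *v (A *v x) = x"
    by (simp_all add: matrix_vector_mul_assoc)
qed

text \<open>Cramer's rule expresses the solution as quotients of determinants, which depend
  continuously on the matrix and the right-hand side.\<close>

lemma continuous_on_matrix_inv_apply:
  fixes T :: "'a::topological_space \<Rightarrow> real^'n^'n"
  assumes "continuous_on S T" "continuous_on S f" "\<And>z. z \<in> S \<Longrightarrow> invertible (T z)"
  shows "continuous_on S (\<lambda>z. matrix_inv (T z) *v f z)"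
proof -
  have "continuous_on S (\<lambda>z. \<chi> k. det (\<chi> i j. if j = k then f z $ i else T z $ i $ j) / det (T z))"
  proof (intro continuous_on_vec_lambda continuous_on_divide)
    fix k
    have "continuous_on S (\<lambda>z. if j = k then f z $ i else T z $ i $ j)" for i j
      using assms(1,2) by (cases "j = k") (auto intro: continuous_intros)
    then show "continuous_on S (\<lambda>z. det (\<chi> i j. if j = k then f z $ i else T z $ i $ j))"
      by (intro continuous_on_compose2[OF continuous_on_det[of UNIV]] continuous_on_vec_lambda) auto
    show "continuous_on S (\<lambda>z. det (T z))"
      by (rule continuous_on_compose2[OF continuous_on_det[of UNIV] assms(1)]) auto
  qed (use assms(3) in \<open>auto simp: invertible_det_nz\<close>)
  then show ?thesis
  proof (rule continuous_on_eq)
    fix z assume "z \<in> S"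
    then have i: "invertible (T z)" by (rule assms(3))
    then have "T z *v (matrix_inv (T z) *v f z) = f z" by (rule matrix_inv_apply)
    then show "(\<chi> k. det (\<chi> i j. if j = k then f z $ i else T z $ i $ j) / det (T z)) = matrix_inv (T z) *v f z"
      using cramer[of "T z"] i by (simp add: invertible_det_nz)
  qed
qed

lemma continuous_map_vec:
  fixes f :: "'a \<Rightarrow> real^'n"
  assumes "\<And>i. continuous_map X euclideanreal (\<lambda>x. f x $ i)"
  shows "continuous_map X euclidean f"
  using assms by (auto simp: continuous_map_atin intro!: vec_tendstoI)

text \<open>By \<open>comp\<close>, the vector \<open>T c (snd c p) *v v c\<close> attached to a
  tangent vector does not depend on the chart \<open>c\<close>. These local expressions therefore
  glue to one fibrewise linear map from the tangent bundle to a product, bijective on fibres by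
  \<open>inv\<close>.\<close>

lemma parallelizable_if_frames:
  fixes M :: "('p, 'm::finite) manifold" and T :: "('p, 'm) chart \<Rightarrow> real^'m \<Rightarrow> real^'m^'m"
  assumes atlas: "smooth_atlas (mtop M) (matlas M)"
    and cont: "\<And>c. c \<in> matlas M \<Longrightarrow> continuous_on (snd c ` fst c) (T c)"
    and inv: "\<And>c p. c \<in> matlas M \<Longrightarrow> p \<in> fst c \<Longrightarrow> invertible (T c (snd c p))"
    and comp: "\<And>c d p v. c \<in> matlas M \<Longrightarrow> d \<in> matlas M \<Longrightarrow> p \<in> fst c \<Longrightarrow> p \<in> fst d \<Longrightarrow>
      T d (snd d p) *v dtr c d p v = T c (snd c p) *v v"
  shows "parallelizable M"
proof -
  let ?X = "mtop M" and ?m = "CARD('m)" and ?TM = "tangent_topology M"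
  let ?P = "prod_topology ?X (Euclidean_space ?m)"
  obtain e :: "nat \<Rightarrow> 'm" where e: "bij_betw e {..<?m} UNIV"
    using ex_bij_betw_nat_finite[of "UNIV :: 'm set"] by (auto simp: atLeast0LessThan)
  define e' where "e' = inv_into {..<?m} e"
  have e': "e' j < ?m" "e (e' j) = j" for j
    using e bij_betw_inv_into_right[OF e, of j] bij_betwE[OF bij_betw_inv_into[OF e]]
    by (auto simp: e'_def)
  have e'e: "e' (e i) = i" if "i < ?m" for i
    using that e by (simp add: e'_def bij_betw_inv_into_left)
  \<comment> \<open>\<open>S\<close> and \<open>R\<close> translate between vectors indexed by a
    type and sequences vanishing from \<open>CARD('m)\<close> on, the fibre of
    \<open>product_bundle\<close>.\<close>
  define S where "S x = (\<lambda>i. if i < ?m then x $ e i else 0)" for x :: "real^'m"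
  define R where "R y = (\<chi> j. y (e' j))" for y :: "nat \<Rightarrow> real"
  have RS: "R (S x) = x" for x by (simp add: R_def S_def e' vec_eq_iff)
  have SR: "S (R y) = y" if "y \<in> topspace (Euclidean_space ?m)" for y
    using that by (auto simp: R_def S_def e'e topspace_Euclidean_space)
  have topP: "topspace ?P = topspace ?X \<times> topspace (Euclidean_space ?m)" by simp
  \<comment> \<open>An arbitrary choice of a chart around each point. It need not vary continuously;
    fact \<open>F\<close> below shows that any other chart gives the same value, and continuity is
    then checked chart by chart.\<close>
  define ch where "ch p = (SOME c. c \<in> matlas M \<and> p \<in> fst c)" for p
  have ch: "ch p \<in> matlas M" "p \<in> fst (ch p)" if "p \<in> topspace ?X" for p
  proof -
    have "\<exists>c. c \<in> matlas M \<and> p \<in> fst c" using atlas that unfolding smooth_atlas_def by blast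
    from someI_ex[OF this] show "ch p \<in> matlas M" "p \<in> fst (ch p)" by (simp_all only: ch_def)
  qed
  define F where "F u = (fst u, S (T (ch (fst u)) (snd (ch (fst u)) (fst u)) *v snd u (ch (fst u))))"
    for u :: "'p \<times> (('p, 'm) chart \<Rightarrow> real^'m)"
  have F: "F (p, v) = (p, S (T c (snd c p) *v v c))"
    if "(p, v) \<in> tangent_vectors M" "c \<in> matlas M" "p \<in> fst c" for p v c
  proof -
    note p = ch[OF tangent_vectorsD(1)[OF atlas that(1)]]
    have "v (ch p) = dtr c (ch p) p (v c)"
      using p that by (intro tangent_vectorsD(3)[OF atlas]) auto
    then show ?thesis using comp[OF that(2) p(1) that(3) p(2), of "v c"] by (simp add: F_def)
  qed
  \<comment> \<open>The candidate inverse is written in all charts at once, so its component in a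
    given chart can be read off directly when continuity is tested on a basic open set.\<close>
  define G where "G y = (fst y, \<lambda>d. if d \<in> matlas M \<and> fst y \<in> fst d then matrix_inv (T d (snd d (fst y))) *v R (snd y) else 0)"
    for y :: "'p \<times> (nat \<Rightarrow> real)"
  have G: "G (p, y) = tangent_lift M c p (matrix_inv (T c (snd c p)) *v R y)"
    if c: "c \<in> matlas M" "p \<in> fst c" for p y c
  proof -
    \<comment> \<open>The invertible matrix \<open>T d (snd d p)\<close> sends both sides to
      \<open>R y\<close>.\<close>
    have "matrix_inv (T d (snd d p)) *v R y = dtr c d p (matrix_inv (T c (snd c p)) *v R y)"
      if d: "d \<in> matlas M" "p \<in> fst d" for d
    proof -
      have "T d (snd d p) *v dtr c d p (matrix_inv (T c (snd c p)) *v R y) = R y"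
        unfolding comp[OF c(1) d(1) c(2) d(2)] by (rule matrix_inv_apply(1)[OF inv[OF c]])
      then show ?thesis using matrix_inv_apply(2)[OF inv[OF d]] by metis
    qed
    then have "(\<lambda>d. if d \<in> matlas M \<and> p \<in> fst d then matrix_inv (T d (snd d p)) *v R y else 0) =
        (\<lambda>d. if d \<in> matlas M \<and> p \<in> fst d then dtr c d p (matrix_inv (T c (snd c p)) *v R y) else 0)"
      by (intro ext if_cong) auto
    then show ?thesis unfolding tangent_lift_def G_def fst_conv snd_conv by (rule arg_cong)
  qed
  have Gin: "G (p, y) \<in> tangent_vectors M" if "p \<in> topspace ?X" for p y
    unfolding G[OF ch[OF that]] by (rule tangent_lift_in[OF atlas ch[OF that]])
  have GF: "G (F u) = u" if u: "u \<in> tangent_vectors M" for u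
  proof -
    obtain p v where pv: "u = (p, v)" by (cases u)
    note c = ch[OF tangent_vectorsD(1)[OF atlas u[unfolded pv]]]
    have "G (F u) = tangent_lift M (ch p) p (v (ch p))"
      unfolding pv F[OF u[unfolded pv] c] G[OF c] RS matrix_inv_apply(2)[OF inv[OF c]] ..
    then show ?thesis using tangent_lift_eq[OF atlas c u[unfolded pv]] by (simp add: pv)
  qed
  have FG: "F (G (p, y)) = (p, y)" if p: "p \<in> topspace ?X" "y \<in> topspace (Euclidean_space ?m)" for p y
  proof -
    note c = ch[OF p(1)]
    have "G (p, y) = (p, snd (G (p, y)))" by (simp add: G_def)
    then have "F (G (p, y)) = (p, S (T (ch p) (snd (ch p) p) *v snd (G (p, y)) (ch p)))"
      using F[OF _ c, of "snd (G (p, y))"] Gin[OF p(1), of y] by simp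
    also have "snd (G (p, y)) (ch p) = matrix_inv (T (ch p) (snd (ch p) p)) *v R y"
      using c by (simp add: G_def)
    finally show ?thesis by (simp add: matrix_inv_apply(1)[OF inv[OF c]] SR[OF p(2)])
  qed
  have contF: "continuous_map ?TM ?P F"
  \<comment> \<open>The parts of the tangent bundle over the chart domains are open and cover it.
    Over one domain, \<open>F\<close> is the map
    \<open>(z, x) \<mapsto> (chart_inv c z, S (T c z *v x))\<close> in coordinates.\<close>
  proof (rule pasting_lemma[where I = "matlas M" and f = "\<lambda>_. F" and T = "\<lambda>c. {u \<in> tangent_vectors M. fst u \<in> fst c}"])
    fix c assume c: "c \<in> matlas M"
    let ?U = "{u \<in> tangent_vectors M. fst u \<in> fst c}" and ?Z = "snd c ` fst c"
    have "?U = {(p, v) \<in> tangent_vectors M. p \<in> fst c \<and> (snd c p, v c) \<in> UNIV}" by auto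
    then show U: "openin ?TM ?U" using openin_tangent_base[OF atlas c open_UNIV] by simp
    let ?h = "\<lambda>u. (snd c (fst u), snd u c)"
    have h: "continuous_map (subtopology ?TM ?U) (top_of_set (?Z \<times> UNIV)) ?h"
      unfolding continuous_map_in_subtopology
    proof
      show "continuous_map (subtopology ?TM ?U) euclidean ?h"
        unfolding continuous_map_def
      proof (intro conjI allI impI)
        fix V :: "((real^'m) \<times> (real^'m)) set" assume "openin euclidean V"
        then have "openin ?TM {(p, v) \<in> tangent_vectors M. p \<in> fst c \<and> (snd c p, v c) \<in> V}"
          using openin_tangent_base[OF atlas c, of V] by simp
        moreover have "{(p, v) \<in> tangent_vectors M. p \<in> fst c \<and> (snd c p, v c) \<in> V} =
           {x \<in> topspace (subtopology ?TM ?U). ?h x \<in> V}"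
          by (auto simp: topspace_tangent[OF atlas])
        ultimately show "openin (subtopology ?TM ?U) {x \<in> topspace (subtopology ?TM ?U). ?h x \<in> V}"
          using U by (auto simp: openin_open_subtopology)
      qed simp
      show "?h \<in> topspace (subtopology ?TM ?U) \<rightarrow> ?Z \<times> UNIV" by (auto simp: topspace_tangent[OF atlas])
    qed
    have "continuous_map (top_of_set (?Z \<times> (UNIV :: (real^'m) set))) ?P
        (\<lambda>x. (chart_inv c (fst x), S (T c (fst x) *v snd x)))"
    proof (rule continuous_map_pairedI)
      have "continuous_map (top_of_set (?Z \<times> (UNIV :: (real^'m) set))) (top_of_set ?Z) fst"
        by (auto simp: continuous_map_in_subtopology intro!: continuous_intros)
      from continuous_map_compose[OF this continuous_chart_inv[OF atlas_chart[OF atlas c]]]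
      show "continuous_map (top_of_set (?Z \<times> (UNIV :: (real^'m) set))) ?X (\<lambda>x. chart_inv c (fst x))"
        by (simp add: o_def continuous_map_in_subtopology)
      have T: "continuous_on (?Z \<times> (UNIV :: (real^'m) set)) (\<lambda>x. T c (fst x))"
        by (rule continuous_on_compose2[OF cont[OF c]]) (auto intro: continuous_intros)
      show "continuous_map (top_of_set (?Z \<times> (UNIV :: (real^'m) set))) (Euclidean_space ?m)
          (\<lambda>x. S (T c (fst x) *v snd x))"
        unfolding S_def continuous_map_componentwise_Euclidean_space
        by (auto simp: matrix_vector_mult_def intro!: continuous_intros T)
    qed
    from continuous_map_compose[OF h this]
    show "continuous_map (subtopology ?TM ?U) ?P F"
    proof (rule continuous_map_eq)
      fix u assume "u \<in> topspace (subtopology ?TM ?U)"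
      then have u: "(fst u, snd u) \<in> tangent_vectors M" "fst u \<in> fst c" by (auto simp: topspace_tangent[OF atlas])
      show "((\<lambda>x. (chart_inv c (fst x), S (T c (fst x) *v snd x))) \<circ> ?h) u = F u"
        using F[OF u(1) c u(2)] chart_inv_apply[OF atlas_chart[OF atlas c] u(2)] by simp
    qed
  next
    fix u assume "u \<in> topspace ?TM"
    then have u: "(fst u, snd u) \<in> tangent_vectors M" by (simp add: topspace_tangent[OF atlas])
    show "\<exists>c. c \<in> matlas M \<and> u \<in> {u \<in> tangent_vectors M. fst u \<in> fst c} \<and> F u = F u"
      using ch[OF tangent_vectorsD(1)[OF atlas u]] u by (intro exI[of _ "ch (fst u)"]) simp
  qed simp
  have contR: "continuous_map (Euclidean_space ?m) euclidean R"
    by (rule continuous_map_vec)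
      (auto simp: R_def Euclidean_space_def intro!: continuous_map_from_subtopology continuous_map_product_projection)
  have contG: "continuous_map ?P ?TM G"
    unfolding tangent_topology_def
  proof (rule continuous_on_generated_topo)
    show "G ` topspace ?P \<subseteq> \<Union> {{(p, v) \<in> tangent_vectors M. p \<in> fst c \<and> (snd c p, v c) \<in> G} |c G. c \<in> matlas M \<and> open G}"
      using topspace_tangent[OF atlas, unfolded tangent_topology_def topology_generated_by_topspace] Gin
      by (auto simp: topP)
    fix U assume "U \<in> {{(p, v) \<in> tangent_vectors M. p \<in> fst c \<and> (snd c p, v c) \<in> G} |c G. c \<in> matlas M \<and> open G}"
    then obtain d V where U: "U = {(p, v) \<in> tangent_vectors M. p \<in> fst d \<and> (snd d p, v d) \<in> V}" "d \<in> matlas M" "open V"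
      by (elim CollectE exE conjE)
    let ?Z = "snd d ` fst d"
    have dX: "fst d \<subseteq> topspace ?X" "openin ?X (fst d)"
      using is_chartD(1,2)[OF atlas_chart[OF atlas U(2)]] by auto
    let ?Q = "prod_topology (subtopology ?X (fst d)) (Euclidean_space ?m)"
    let ?k = "\<lambda>y. (snd d (fst y), matrix_inv (T d (snd d (fst y))) *v R (snd y))"
    have 1: "continuous_map ?Q (top_of_set (?Z \<times> UNIV)) (\<lambda>y. (snd d (fst y), R (snd y)))"
      unfolding continuous_map_in_subtopology
    proof
      have "continuous_map ?Q euclidean (\<lambda>y. snd d (fst y))"
        using continuous_map_compose[OF continuous_map_fst continuous_chart[OF atlas_chart[OF atlas U(2)]]]
        by (simp add: o_def)
      moreover have "continuous_map ?Q euclidean (\<lambda>y. R (snd y))"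
        using continuous_map_compose[OF continuous_map_snd contR] by (simp add: o_def)
      ultimately show "continuous_map ?Q euclidean (\<lambda>y. (snd d (fst y), R (snd y)))"
        using continuous_map_pairedI[of ?Q euclidean "\<lambda>y. snd d (fst y)" euclidean "\<lambda>y. R (snd y)"] by simp
    qed auto
    have Tinv: "invertible (T d z)" if "z \<in> ?Z" for z using that inv[OF U(2)] by auto
    have "continuous_on (?Z \<times> (UNIV :: (real^'m) set)) (\<lambda>x. T d (fst x))"
      by (rule continuous_on_compose2[OF cont[OF U(2)]]) (auto intro: continuous_intros)
    then have "continuous_on (?Z \<times> (UNIV :: (real^'m) set)) (\<lambda>x. (fst x, matrix_inv (T d (fst x)) *v snd x))"
      by (intro continuous_intros continuous_on_matrix_inv_apply) (auto simp: Tinv)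
    then have "continuous_map (top_of_set (?Z \<times> (UNIV :: (real^'m) set))) euclidean (\<lambda>x. (fst x, matrix_inv (T d (fst x)) *v snd x))"
      by simp
    from continuous_map_compose[OF 1 this] have "continuous_map ?Q euclidean ?k" by (simp add: o_def)
    from openin_continuous_map_preimage[OF this, of V]
    have "openin ?Q {y \<in> topspace ?Q. ?k y \<in> V}" using U(3) by simp
    then have "openin (subtopology ?P (fst d \<times> topspace (Euclidean_space ?m))) {y \<in> topspace ?Q. ?k y \<in> V}"
      unfolding prod_topology_subtopology(1) .
    moreover have "openin ?P (fst d \<times> topspace (Euclidean_space ?m))"
      using dX(2) by (simp add: openin_prod_Times_iff)
    ultimately have "openin ?P {y \<in> topspace ?Q. ?k y \<in> V}"
      by (rule openin_trans_full)
    moreover have "G -` U \<inter> topspace ?P = {y \<in> topspace ?Q. ?k y \<in> V}"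
    proof (intro Set.set_eqI)
      fix y :: "'p \<times> (nat \<Rightarrow> real)"
      obtain p w where y: "y = (p, w)" by (cases y)
      show "y \<in> G -` U \<inter> topspace ?P \<longleftrightarrow> y \<in> {y \<in> topspace ?Q. ?k y \<in> V}"
        using Gin[of p w] dX(1) U(2) by (auto simp: y U(1) G_def)
    qed
    ultimately show "openin ?P (G -` U \<inter> topspace ?P)" by simp
  qed
  have "homeomorphic_maps ?TM ?P F G"
    unfolding homeomorphic_maps_def using contF contG GF FG by (auto simp: topspace_tangent[OF atlas])
  then have hom: "homeomorphic_map ?TM ?P F" using homeomorphic_map_maps by blast
  have "vbundle_iso (tangent_bundle M) (product_bundle (base (tangent_bundle M)) ?m) F"
    unfolding vbundle_iso_def
  proof (intro conjI ballI allI impI)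
    show "base (tangent_bundle M) = base (product_bundle (base (tangent_bundle M)) ?m)"
      by (simp add: product_bundle_def)
    show "homeomorphic_map (total (tangent_bundle M)) (total (product_bundle (base (tangent_bundle M)) ?m)) F"
      using hom by (simp add: tangent_bundle_def product_bundle_def)
    show "proj (product_bundle (base (tangent_bundle M)) ?m) (F u) = proj (tangent_bundle M) u" for u
      by (simp add: tangent_bundle_def product_bundle_def F_def)
    show "F (vadd (tangent_bundle M) u v) = vadd (product_bundle (base (tangent_bundle M)) ?m) (F u) (F v)"
      if "proj (tangent_bundle M) u = proj (tangent_bundle M) v" for u v
      using that by (auto simp: tangent_bundle_def product_bundle_def F_def S_def case_prod_beta
        matrix_vector_right_distrib)
    show "F (vscale (tangent_bundle M) r u) = vscale (product_bundle (base (tangent_bundle M)) ?m) r (F u)" for r u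
      by (auto simp: tangent_bundle_def product_bundle_def F_def S_def case_prod_beta matrix_vector_mult_scaleR)
  qed
  then show ?thesis unfolding parallelizable_def trivial_bundle_def by blast
qed

section \<open>Orientation signs\<close>

definition enum_idx :: "nat \<Rightarrow> 'm::finite" where
  "enum_idx = (SOME e. bij_betw e {..<CARD('m)} UNIV)"

lemma bij_enum_idx: "bij_betw (enum_idx :: nat \<Rightarrow> 'm::finite) {..<CARD('m)} UNIV"
proof -
  have "\<exists>e :: nat \<Rightarrow> 'm. bij_betw e {..<CARD('m)} UNIV"
    using ex_bij_betw_nat_finite[of "UNIV :: 'm set"] by (simp add: atLeast0LessThan)
  then show ?thesis unfolding enum_idx_def by (rule someI_ex)
qed

lemma enum_idx_eq [simp]:
  "i < CARD('m) \<Longrightarrow> j < CARD('m) \<Longrightarrow> enum_idx i = (enum_idx j :: 'm::finite) \<longleftrightarrow> i = j"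
  using bij_betw_imp_inj_on[OF bij_enum_idx[where 'm = 'm]] by (auto simp: inj_on_def)

lemma sum_enum_idx: "(\<Sum>i<CARD('m). g (enum_idx i :: 'm::finite)) = (\<Sum>x\<in>UNIV. g x)"
  by (rule sum.reindex_bij_betw[OF bij_enum_idx])

text \<open>The matrix of \<open>M \<oplus> 1\<close>.\<close>

definition stab :: "real^'m^'m \<Rightarrow> nat \<Rightarrow> nat \<Rightarrow> real" where
  "stab M i j = (if i < CARD('m) \<and> j < CARD('m) then M $ enum_idx i $ enum_idx j else if i = j then 1 else 0)"

text \<open>Splitting the sum at the index \<open>CARD('m)\<close> lets the two diagonal blocks
  multiply separately.\<close>

lemma stab_mult:
  fixes A B :: "real^'m^'m"
  assumes "i < CARD('m) + k" "j < CARD('m) + k"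
  shows "(\<Sum>l<CARD('m) + k. stab A i l * stab B l j) = stab (A ** B) i j"
proof -
  have "(\<Sum>l<CARD('m) + k. stab A i l * stab B l j) =
      (\<Sum>l<CARD('m). stab A i l * stab B l j) + (\<Sum>l\<in>{CARD('m)..<CARD('m) + k}. stab A i l * stab B l j)"
    by (subst sum.union_disjoint[symmetric]) (auto intro!: sum.cong)
  also have "(\<Sum>l<CARD('m). stab A i l * stab B l j) = (if i < CARD('m) \<and> j < CARD('m) then stab (A ** B) i j else 0)"
    using sum_enum_idx[of "\<lambda>l. A $ enum_idx i $ l * B $ l $ enum_idx j"]
    by (auto simp: stab_def matrix_matrix_mult_def intro!: sum.neutral)
  also have "(\<Sum>l\<in>{CARD('m)..<CARD('m) + k}. stab A i l * stab B l j) =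
      (\<Sum>l\<in>{CARD('m)..<CARD('m) + k}. if i = l then if i = j then 1 else 0 else 0)"
    by (rule sum.cong) (auto simp: stab_def)
  also have "\<dots> = (if i < CARD('m) \<and> j < CARD('m) then 0 else if i = j then 1 else 0)"
    using assms by auto
  finally show ?thesis by (auto simp: stab_def)
qed

text \<open>This links the two kinds of determinant. Multiplicativity of \<open>stab\<close> and
  \<open>ndet\<close> keeps the left side nonzero on \<open>GL\<close>, and at the identity and at
  one axis reflection the stabilized matrix is diagonal.\<close>

lemma sgn_ndet_stab:
  fixes M :: "real^'m^'m"
  assumes "invertible M"
  shows "sgn (ndet (CARD('m) + k) (stab M)) = sgn (det M)"
proof (rule sgn_det_unique[OF _ _ _ _ assms, of "\<lambda>M. ndet (CARD('m) + k) (stab M)"])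
  \<comment> \<open>The axis \<open>enum_idx 0\<close> puts the entry \<open>- 1\<close> at position
    0 of the enumeration.\<close>
  let ?N = "CARD('m) + k" and ?r = "enum_idx 0 :: 'm"
  show "continuous_on GL (\<lambda>M :: real^'m^'m. ndet ?N (stab M))"
  proof (rule continuous_on_ndet)
    show "continuous_on GL (\<lambda>M :: real^'m^'m. stab M i j)" for i j
      by (cases "i < CARD('m) \<and> j < CARD('m)") (auto simp: stab_def[abs_def] intro!: continuous_intros)
  qed
  have one: "ndet ?N (stab (mat 1 :: real^'m^'m)) = 1"
    by (subst ndet_diagonal) (auto simp: stab_def mat_def intro!: prod.neutral)
  then show "ndet ?N (stab (mat 1 :: real^'m^'m)) > 0" by simp
  show "ndet ?N (stab M) \<noteq> 0" if M: "invertible M" for M :: "real^'m^'m"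
  proof -
    obtain B where B: "M ** B = mat 1" using M unfolding invertible_def by blast
    have "ndet ?N (stab M) * ndet ?N (stab B) = ndet ?N (stab (mat 1 :: real^'m^'m))"
      unfolding ndet_mult[symmetric] by (rule ndet_cong) (simp add: stab_mult flip: B)
    then show ?thesis using one by auto
  qed
  have "ndet ?N (stab (reflection (axis ?r 1))) = (\<Prod>i<?N. stab (reflection (axis ?r 1)) i i)"
    by (rule ndet_diagonal) (simp add: stab_def reflection_axis)
  also have "\<dots> = (\<Prod>i<?N. if i = 0 then - 1 else 1)"
    by (rule prod.cong) (auto simp: stab_def reflection_axis)
  finally show "ndet ?N (stab (reflection (axis ?r 1))) < 0" by simp
qed

text \<open>Here \<open>H\<close> is an \<open>m\<close> by \<open>n\<close> matrix, and
  \<open>m = n\<close> is part of what has to be found. Solving for the unit vectors gives a right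
  inverse, and injectivity turns it into a left inverse.\<close>

lemma ndet_nonzero_if_bijective:
  assumes surj: "\<And>i. i < m \<Longrightarrow> \<exists>a. \<forall>i'<m. (\<Sum>j<n. H i' j * a j) = (if i' = i then 1 else 0)"
    and inj: "\<And>a. \<forall>i<m. (\<Sum>j<n. H i j * a j) = 0 \<Longrightarrow> \<forall>j<n. a j = (0::real)"
  shows "ndet n H \<noteq> 0"
proof -
  have "\<exists>K. \<forall>i<m. \<forall>i'<m. (\<Sum>j<n. H i' j * K i j) = (if i' = i then 1 else 0)"
    using surj by metis
  then obtain K where K: "\<And>i i'. i < m \<Longrightarrow> i' < m \<Longrightarrow> (\<Sum>j<n. H i' j * K i j) = (if i' = i then 1 else 0)"
    by blast
  \<comment> \<open>\<open>K\<close> is stored transposed: \<open>K i\<close> solves for the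
    \<open>i\<close>-th unit vector. With \<open>K\<close> as the right inverse, every column of
    \<open>K H - 1\<close> is killed by \<open>H\<close>, hence zero by \<open>inj\<close>.\<close>
  have KH: "(\<Sum>i<m. K i j * H i j') = (if j = j' then 1 else 0)" if j: "j < n" "j' < n" for j j'
  proof -
    have "(\<Sum>j<n. H i j * ((\<Sum>i'<m. K i' j * H i' j') - (if j = j' then 1 else 0))) = 0" if i: "i < m" for i
    proof -
      have "(\<Sum>j<n. H i j * ((\<Sum>i'<m. K i' j * H i' j') - (if j = j' then 1 else 0))) =
         (\<Sum>j<n. \<Sum>i'<m. (H i j * K i' j) * H i' j') - (\<Sum>j<n. if j = j' then H i j else 0)"
        unfolding sum_subtractf[symmetric] by (rule sum.cong) (auto simp: algebra_simps sum_distrib_left)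
      also have "(\<Sum>j<n. \<Sum>i'<m. (H i j * K i' j) * H i' j') = (\<Sum>i'<m. (\<Sum>j<n. H i j * K i' j) * H i' j')"
        by (subst sum.swap) (simp add: sum_distrib_right)
      also have "\<dots> = (\<Sum>i'<m. if i' = i then H i j' else 0)"
        using i by (intro sum.cong) (auto simp: K)
      finally show ?thesis using i j by simp
    qed
    then show ?thesis using inj[of "\<lambda>j. (\<Sum>i'<m. K i' j * H i' j') - (if j = j' then 1 else 0)"] j by simp
  qed
  \<comment> \<open>\<open>H K\<close> and \<open>K H\<close> are identity matrices with the same trace\<close>
  have "real m = (\<Sum>i<m. \<Sum>j<n. H i j * K i j)" by (simp add: K)
  also have "\<dots> = (\<Sum>j<n. \<Sum>i<m. K i j * H i j)" by (subst sum.swap) (simp add: mult.commute)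
  also have "\<dots> = real n" by (simp add: KH)
  finally have "m = n" by simp
  then have "ndet n (\<lambda>j i. K i j) * ndet n H = ndet n (\<lambda>i j. if i = j then 1 else 0)"
    unfolding ndet_mult[symmetric] using KH by (intro ndet_cong) simp
  also have "\<dots> = 1" by (subst ndet_diagonal) auto
  finally show ?thesis by auto
qed

text \<open>An orientation, given by a function \<open>\<sigma> c\<close> for every chart \<open>c\<close> whose sign tells whether the
  chart is positively oriented.\<close>

definition orientation_sign :: "('p, 'm::finite) manifold \<Rightarrow> (('p, 'm) chart \<Rightarrow> real^'m \<Rightarrow> real) \<Rightarrow> bool" where
  "orientation_sign M \<sigma> \<longleftrightarrow>
     (\<forall>c\<in>matlas M. continuous_on (snd c ` fst c) (\<sigma> c) \<and> (\<forall>p\<in>fst c. \<sigma> c (snd c p) \<noteq> 0)) \<and>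
     (\<forall>c\<in>matlas M. \<forall>d\<in>matlas M. \<forall>p\<in>fst c \<inter> fst d.
        sgn (\<sigma> c (snd c p)) = sgn (det (matrix (dtr c d p))) * sgn (\<sigma> d (snd d p)))"

section \<open>From an orienting atlas to a sign function\<close>

lemma det_dtr_comp:
  assumes "smooth_atlas X \<A>" "c \<in> \<A>" "d \<in> \<A>" "e \<in> \<A>" "p \<in> fst c" "p \<in> fst d" "p \<in> fst e"
  shows "det (matrix (dtr c e p)) = det (matrix (dtr d e p)) * det (matrix (dtr c d p))"
proof -
  have "dtr c e p = dtr d e p \<circ> dtr c d p" using dtr_comp[OF assms] by (simp add: fun_eq_iff)
  then show ?thesis
    using assms by (simp add: matrix_compose linear_dtr[OF assms(1)] det_mul)
qed

text \<open>Passing from \<open>c\<close> to \<open>d\<close> and back multiplies the two Jacobian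
  determinants to 1.\<close>

lemma invertible_dtr:
  assumes "smooth_atlas X \<A>" "c \<in> \<A>" "d \<in> \<A>" "p \<in> fst c" "p \<in> fst d"
  shows "invertible (matrix (dtr c d p))"
proof -
  have "dtr c c p = id" using dtr_self[OF assms(1,2,4)] by (simp add: fun_eq_iff)
  then have "det (matrix (dtr c c p)) = 1" by (simp only: matrix_id_mat_1 det_I)
  then show ?thesis using det_dtr_comp[OF assms(1-3,2,4,5,4)] by (auto simp: invertible_det_nz)
qed

text \<open>A chart is compared with the orienting charts: its sign at a point is that of the
  Jacobian determinant of the transition to any chart of \<open>\<B>\<close> there.\<close>

lemma orientation_sign_if_orientable:
  assumes atlas: "smooth_atlas (mtop M) (matlas M)" and "orientable M"
  shows "\<exists>\<sigma>. orientation_sign M \<sigma>"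
proof -
  obtain \<B> where B: "smooth_atlas (mtop M) \<B>" "smooth_atlas (mtop M) (matlas M \<union> \<B>)"
     and pos: "\<And>c d p. c \<in> \<B> \<Longrightarrow> d \<in> \<B> \<Longrightarrow> p \<in> fst c \<Longrightarrow> p \<in> fst d \<Longrightarrow> det (matrix (dtr c d p)) > 0"
    using assms(2) unfolding orientable_def jacobian_def by blast
  define b where "b p = (SOME c. c \<in> \<B> \<and> p \<in> fst c)" for p
  have b: "b p \<in> \<B>" "p \<in> fst (b p)" if "p \<in> topspace (mtop M)" for p
  proof -
    have "\<exists>c. c \<in> \<B> \<and> p \<in> fst c" using B(1) that unfolding smooth_atlas_def by blast
    from someI_ex[OF this] show "b p \<in> \<B>" "p \<in> fst (b p)" by (simp_all only: b_def)
  qed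
  have top: "p \<in> topspace (mtop M)" if "c \<in> matlas M" "p \<in> fst c" for c p
    using is_chartD(2)[OF atlas_chart[OF atlas that(1)]] that(2) by blast
  define \<sigma> where "\<sigma> c z = sgn (det (matrix (frechet_derivative (transition c (b (chart_inv c z))) (at z))))" for c z
  \<comment> \<open>The choice \<open>b p\<close> may jump with \<open>p\<close>. Positivity of the
    transitions inside \<open>\<B>\<close> makes the sign independent of it, so near a given point
    one fixed chart can be used, which yields continuity.\<close>
  have sigma: "\<sigma> c (snd c p) = sgn (det (matrix (dtr c d p)))"
    if c: "c \<in> matlas M" "d \<in> \<B>" "p \<in> fst c" "p \<in> fst d" for c d p
  proof -
    note bp = b[OF top[OF c(1,3)]]
    have "det (matrix (dtr c d p)) = det (matrix (dtr (b p) d p)) * det (matrix (dtr c (b p) p))"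
      using c bp by (intro det_dtr_comp[OF B(2)]) auto
    moreover have "det (matrix (dtr (b p) d p)) > 0" using c bp by (intro pos) auto
    ultimately show ?thesis
      unfolding \<sigma>_def chart_inv_apply[OF atlas_chart[OF atlas c(1)] c(3)] by (simp add: sgn_mult)
  qed
  have nz: "det (matrix (dtr c d p)) \<noteq> 0" if "c \<in> matlas M" "d \<in> \<B>" "p \<in> fst c" "p \<in> fst d" for c d p
    using invertible_dtr[OF B(2), of c d p] that by (auto simp: invertible_det_nz)
  have "continuous_on (snd c ` fst c) (\<sigma> c)" if c: "c \<in> matlas M" for c
  proof (rule continuous_at_imp_continuous_on, rule ballI)
    fix z assume "z \<in> snd c ` fst c"
    then obtain p where p: "p \<in> fst c" "z = snd c p" by blast
    note bp = b[OF top[OF c p(1)]]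
    let ?O = "snd c ` (fst c \<inter> fst (b p))"
    have cB: "c \<in> matlas M \<union> \<B>" "b p \<in> matlas M \<union> \<B>" using c bp by auto
    have "continuous_on ?O (\<lambda>z. det (matrix (frechet_derivative (transition c (b p)) (at z))))"
      unfolding matrix_def
      by (intro continuous_on_compose2[OF continuous_on_det[of UNIV]] continuous_on_vec_lambda continuous_intros
          continuous_dtr[OF B(2) cB]) auto
    then have "continuous_on ?O (\<lambda>z. sgn (det (matrix (frechet_derivative (transition c (b p)) (at z)))))"
      using nz[OF c bp(1)] by (intro continuous_on_sgn) auto
    then have "continuous_on ?O (\<sigma> c)"
      by (rule continuous_on_eq) (use sigma[OF c bp(1)] in auto)
    moreover have "open ?O" "z \<in> ?O" using open_overlap[OF B(2) cB] p bp by auto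
    ultimately show "isCont (\<sigma> c) z" using continuous_on_eq_continuous_at by blast
  qed
  moreover have "\<sigma> c (snd c p) \<noteq> 0" if "c \<in> matlas M" "p \<in> fst c" for c p
    using sigma[OF that(1) b(1)[OF top[OF that]] that(2) b(2)[OF top[OF that]]]
      nz[OF that(1) b(1)[OF top[OF that]] that(2) b(2)[OF top[OF that]]] by (simp add: sgn_0_0)
  moreover have "sgn (\<sigma> c (snd c p)) = sgn (det (matrix (dtr c d p))) * sgn (\<sigma> d (snd d p))"
    if cd: "c \<in> matlas M" "d \<in> matlas M" "p \<in> fst c \<inter> fst d" for c d p
  proof -
    have p: "p \<in> fst c" "p \<in> fst d" using cd by auto
    note bp = b[OF top[OF cd(1) p(1)]]
    have "det (matrix (dtr c (b p) p)) = det (matrix (dtr d (b p) p)) * det (matrix (dtr c d p))"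
      using cd p bp by (intro det_dtr_comp[OF B(2)]) auto
    then show ?thesis unfolding sigma[OF cd(1) bp(1) p(1) bp(2)] sigma[OF cd(2) bp(1) p(2) bp(2)]
      by (simp add: sgn_mult)
  qed
  ultimately show ?thesis unfolding orientation_sign_def by blast
qed

section \<open>Matrices of linear maps on pairs of a tangent coordinate vector and a
  sequence\<close>

abbreviation Euc :: "nat \<Rightarrow> (nat \<Rightarrow> real) set" where "Euc k \<equiv> topspace (Euclidean_space k)"

text \<open>Linearity is in both arguments together: \<open>g\<close> is a linear map on \<open>\<real>\<^sup>m \<times> \<real>\<^sup>k\<close>.\<close>

definition linear_pair :: "nat \<Rightarrow> (real^'m::finite \<Rightarrow> (nat \<Rightarrow> real) \<Rightarrow> nat \<Rightarrow> real) \<Rightarrow> bool" where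
  "linear_pair k g \<longleftrightarrow>
     (\<forall>v w. \<forall>x\<in>Euc k. \<forall>y\<in>Euc k. g (v + w) (\<lambda>i. x i + y i) = (\<lambda>i. g v x i + g w y i)) \<and>
     (\<forall>r v. \<forall>x\<in>Euc k. g (r *\<^sub>R v) (\<lambda>i. r * x i) = (\<lambda>i. r * g v x i))"

lemma linear_pairD:
  assumes "linear_pair k g"
  shows "x \<in> Euc k \<Longrightarrow> y \<in> Euc k \<Longrightarrow> g (v + w) (\<lambda>i. x i + y i) = (\<lambda>i. g v x i + g w y i)"
    and "x \<in> Euc k \<Longrightarrow> g (r *\<^sub>R v) (\<lambda>i. r * x i) = (\<lambda>i. r * g v x i)"
  using assms unfolding linear_pair_def by blast+

text \<open>\<open>basis1 j\<close> and \<open>basis2 CARD('m) k j\<close> are the two components of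
  the \<open>j\<close>-th standard basis vector of the sum of the two spaces; one of them is zero
  for each \<open>j < CARD('m) + k\<close>.\<close>

definition basis1 :: "nat \<Rightarrow> real^'m::finite" where
  "basis1 j = (if j < CARD('m) then axis (enum_idx j) 1 else 0)"

definition basis2 :: "nat \<Rightarrow> nat \<Rightarrow> nat \<Rightarrow> nat \<Rightarrow> real" where
  "basis2 m k j i = (if j = m + i \<and> i < k then 1 else 0)"

definition coords :: "real^'m::finite \<Rightarrow> (nat \<Rightarrow> real) \<Rightarrow> nat \<Rightarrow> real" where
  "coords v y j = (if j < CARD('m) then v $ enum_idx j else y (j - CARD('m)))"

text \<open>The columns are the images of the basis vectors. Rows are indexed by all naturals, so
  that a square block of size \<open>CARD('m) + k\<close> can be taken before the rank of the target
  is known to be that number.\<close>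

definition pair_matrix :: "nat \<Rightarrow> (real^'m::finite \<Rightarrow> (nat \<Rightarrow> real) \<Rightarrow> nat \<Rightarrow> real) \<Rightarrow> nat \<Rightarrow> nat \<Rightarrow> real" where
  "pair_matrix k g i j = g (basis1 j) (basis2 CARD('m) k j) i"

lemma basis2_in: "basis2 m k j \<in> Euc k"
  by (simp add: basis2_def topspace_Euclidean_space)

lemma sum_basis1:
  fixes a :: "nat \<Rightarrow> real"
  shows "(\<Sum>j<CARD('m) + k. a j *\<^sub>R (basis1 j :: real^'m::finite)) = (\<Sum>j<CARD('m). a j *\<^sub>R axis (enum_idx j) 1)"
  by (rule sum.mono_neutral_cong_right) (auto simp: basis1_def)

lemma sum_basis1_nth:
  fixes a :: "nat \<Rightarrow> real"
  assumes "l < CARD('m)"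
  shows "(\<Sum>j<CARD('m) + k. a j *\<^sub>R (basis1 j :: real^'m::finite)) $ enum_idx l = a l"
proof -
  have "(\<Sum>j<CARD('m). a j *\<^sub>R axis (enum_idx j :: 'm) 1) $ enum_idx l = (\<Sum>j<CARD('m). if j = l then a j else 0)"
    unfolding sum_component using assms by (intro sum.cong) (auto simp: axis_def)
  then show ?thesis using assms by (simp add: sum_basis1)
qed

lemma sum_basis2: "(\<Sum>j<m + k. a j * basis2 m k j i) = (if i < k then a (m + i) else 0)"
proof -
  have "(\<Sum>j<m + k. a j * basis2 m k j i) = (\<Sum>j<m + k. if j = m + i then if i < k then a j else 0 else 0)"
    by (rule sum.cong) (auto simp: basis2_def)
  then show ?thesis by auto
qed

lemma linear_pair_sum:
  fixes g :: "real^'m::finite \<Rightarrow> (nat \<Rightarrow> real) \<Rightarrow> nat \<Rightarrow> real"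
  assumes "linear_pair k g"
  shows "g (\<Sum>j<n. a j *\<^sub>R basis1 j) (\<lambda>i. \<Sum>j<n. a j * basis2 CARD('m) k j i) i = (\<Sum>j<n. a j * pair_matrix k g i j)"
proof (induction n arbitrary: i)
  case 0
  have "(\<lambda>i. 0) \<in> Euc k" by (simp add: topspace_Euclidean_space)
  \<comment> \<open>Homogeneity with factor 0 shows that the zero pair is sent to zero.\<close>
  from linear_pairD(2)[OF assms this, of 0 0] show ?case by simp
next
  case (Suc n)
  let ?y = "\<lambda>i. \<Sum>j<n. a j * basis2 CARD('m) k j i"
  have y: "?y \<in> Euc k" "(\<lambda>i. a n * basis2 CARD('m) k n i) \<in> Euc k"
    by (auto simp: topspace_Euclidean_space basis2_def)
  have "g (\<Sum>j<Suc n. a j *\<^sub>R basis1 j) (\<lambda>i. \<Sum>j<Suc n. a j * basis2 CARD('m) k j i) i =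
      g ((\<Sum>j<n. a j *\<^sub>R basis1 j) + a n *\<^sub>R basis1 n) (\<lambda>i. ?y i + a n * basis2 CARD('m) k n i) i"
    by simp
  also have "\<dots> = g (\<Sum>j<n. a j *\<^sub>R basis1 j) ?y i + g (a n *\<^sub>R basis1 n) (\<lambda>i. a n * basis2 CARD('m) k n i) i"
    by (subst linear_pairD(1)[OF assms y]) simp
  also have "g (a n *\<^sub>R basis1 n) (\<lambda>i. a n * basis2 CARD('m) k n i) i = a n * pair_matrix k g i n"
    unfolding pair_matrix_def by (subst linear_pairD(2)[OF assms basis2_in]) simp
  finally show ?case by (simp add: Suc)
qed

lemma linear_pair_expand:
  fixes g :: "real^'m::finite \<Rightarrow> (nat \<Rightarrow> real) \<Rightarrow> nat \<Rightarrow> real"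
  assumes "linear_pair k g" "y \<in> Euc k"
  shows "g v y i = (\<Sum>j<CARD('m) + k. coords v y j * pair_matrix k g i j)"
proof -
  have "(\<Sum>j<CARD('m) + k. coords v y j *\<^sub>R basis1 j) = v"
  proof (subst vec_eq_iff, rule allI)
    fix x :: 'm
    obtain l where l: "l < CARD('m)" "x = enum_idx l"
      using bij_betw_imp_surj_on[OF bij_enum_idx[where 'm = 'm]] by blast
    show "(\<Sum>j<CARD('m) + k. coords v y j *\<^sub>R basis1 j) $ x = v $ x"
      unfolding l(2) sum_basis1_nth[OF l(1)] using l(1) by (simp add: coords_def)
  qed
  moreover have "(\<lambda>i. \<Sum>j<CARD('m) + k. coords v y j * basis2 CARD('m) k j i) = y"
    using assms(2) by (auto simp: sum_basis2 coords_def topspace_Euclidean_space)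
  ultimately show ?thesis using linear_pair_sum[OF assms(1), of "coords v y" "CARD('m) + k" i] by simp
qed

text \<open>Bijectivity onto \<open>Euc k'\<close> is translated into the solvability and uniqueness
  conditions of \<open>ndet_nonzero_if_bijective\<close>. Rows from \<open>k'\<close> on vanish by
  \<open>into\<close>, so agreement of the first \<open>k'\<close> components gives equality of the
  images.\<close>

lemma ndet_pair_matrix_nonzero:
  fixes g :: "real^'m::finite \<Rightarrow> (nat \<Rightarrow> real) \<Rightarrow> nat \<Rightarrow> real"
  assumes lin: "linear_pair k g"
    and into: "\<And>v y. y \<in> Euc k \<Longrightarrow> g v y \<in> Euc k'"
    and inj: "\<And>v w x y. x \<in> Euc k \<Longrightarrow> y \<in> Euc k \<Longrightarrow> g v x = g w y \<Longrightarrow> v = w \<and> x = y"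
    and surj: "\<And>y'. y' \<in> Euc k' \<Longrightarrow> \<exists>v. \<exists>y\<in>Euc k. g v y = y'"
  shows "ndet (CARD('m) + k) (pair_matrix k g) \<noteq> 0"
proof (rule ndet_nonzero_if_bijective[of k'])
  fix i assume i: "i < k'"
  obtain v y where vy: "y \<in> Euc k" "g v y = (\<lambda>i'. if i' = i then 1 else 0)"
    using surj[of "\<lambda>i'. if i' = i then 1 else 0"] i by (auto simp: topspace_Euclidean_space)
  then show "\<exists>a. \<forall>i'<k'. (\<Sum>j<CARD('m) + k. pair_matrix k g i' j * a j) = (if i' = i then 1 else 0)"
    using linear_pair_expand[OF lin vy(1), of v]
    by (intro exI[of _ "coords v y"]) (simp add: mult.commute)
next
  fix a assume a: "\<forall>i<k'. (\<Sum>j<CARD('m) + k. pair_matrix k g i j * a j) = 0"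
  let ?v = "\<Sum>j<CARD('m) + k. a j *\<^sub>R (basis1 j :: real^'m)"
  let ?y = "\<lambda>i. \<Sum>j<CARD('m) + k. a j * basis2 CARD('m) k j i"
  have y: "?y \<in> Euc k" "(\<lambda>i. 0) \<in> Euc k" by (simp_all add: topspace_Euclidean_space basis2_def)
  have "g ?v ?y i = g 0 (\<lambda>i. 0) i" for i
  proof (cases "i < k'")
    case True
    then have "g ?v ?y i = 0"
      using a linear_pair_sum[OF lin, of a "CARD('m) + k" i] by (simp add: mult.commute)
    moreover have "g 0 (\<lambda>i. 0) i = 0" using linear_pair_sum[OF lin, of a 0 i] by simp
    ultimately show ?thesis by simp
  next
    case False
    then show ?thesis using into[OF y(1), of ?v] into[OF y(2), of 0] by (simp add: topspace_Euclidean_space)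
  qed
  then have "g ?v ?y = g 0 (\<lambda>i. 0)" by (rule ext)
  then have z: "?v = 0" "?y = (\<lambda>i. 0)" using inj[OF y] by blast+
  show "\<forall>j<CARD('m) + k. a j = 0"
  proof (intro allI impI)
    fix j assume j: "j < CARD('m) + k"
    show "a j = 0"
    proof (cases "j < CARD('m)")
      case True
      then show ?thesis using sum_basis1_nth[OF True, of a k] z(1) by simp
    next
      case False
      then have "j - CARD('m) < k" "CARD('m) + (j - CARD('m)) = j" using j by auto
      then show ?thesis using fun_cong[OF z(2), of "j - CARD('m)"] by (simp add: sum_basis2)
    qed
  qed
qed

text \<open>A change of chart acts by \<open>L\<close> on the tangent summand and trivially on the
  added summand, so its matrix is \<open>stab (matrix L)\<close>.\<close>

lemma pair_matrix_comp:
  fixes g h :: "real^'m::finite \<Rightarrow> (nat \<Rightarrow> real) \<Rightarrow> nat \<Rightarrow> real"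
  assumes "linear_pair k h" "\<And>v y. y \<in> Euc k \<Longrightarrow> g v y = h (L v) y" "linear L" "j < CARD('m) + k"
  shows "pair_matrix k g i j = (\<Sum>l<CARD('m) + k. pair_matrix k h i l * stab (matrix L) l j)"
proof -
  have "coords (L (basis1 j)) (basis2 CARD('m) k j) l = stab (matrix L) l j" if "l < CARD('m) + k" for l
    using that assms(4) linear_0[OF assms(3)] by (auto simp: coords_def basis1_def basis2_def stab_def matrix_def)
  then show ?thesis
    unfolding pair_matrix_def[of k g] assms(2)[OF basis2_in] linear_pair_expand[OF assms(1) basis2_in]
    by (intro sum.cong) (simp_all add: mult.commute)
qed

text \<open>The function of a chart is the determinant of the trivialization with respect to the
  coordinate vectors of the chart and the standard basis of the added summand.\<close>

lemma orientation_sign_if_stably_parallelizable: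
  fixes M :: "('p, 'm::finite) manifold"
  assumes atlas: "smooth_atlas (mtop M) (matlas M)" and "stably_parallelizable M"
  shows "\<exists>\<sigma>. orientation_sign M \<sigma>"
proof -
  let ?X = "mtop M"
  have "base (whitney_sum (tangent_bundle M) (product_bundle ?X k)) = ?X" for k
    by (simp add: whitney_sum_def tangent_bundle_def)
  then obtain k k' f where f: "vbundle_iso (whitney_sum (tangent_bundle M) (product_bundle ?X k)) (product_bundle ?X k') f"
    using assms(2) unfolding stably_parallelizable_def trivial_bundle_def by force
  let ?E = "whitney_sum (tangent_bundle M) (product_bundle ?X k)"
  have E: "topspace (total ?E) = {(u, w). u \<in> tangent_vectors M \<and> fst w \<in> topspace ?X \<and> snd w \<in> Euc k \<and> fst u = fst w}"
    by (auto simp: whitney_sum_def tangent_bundle_def product_bundle_def topspace_tangent[OF atlas])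
  have hom: "homeomorphic_map (total ?E) (prod_topology ?X (Euclidean_space k')) f"
    using f by (simp add: vbundle_iso_def product_bundle_def)
  have fproj: "fst (f u) = fst (fst u)" if "u \<in> topspace (total ?E)" for u
  proof -
    have "proj (product_bundle ?X k') (f u) = proj ?E u" using f that unfolding vbundle_iso_def by blast
    then show ?thesis by (simp add: product_bundle_def whitney_sum_def tangent_bundle_def case_prod_beta)
  qed
  \<comment> \<open>The element of the Whitney sum over \<open>p\<close> with coordinates
    \<open>v\<close> and \<open>y\<close>; the base point is carried by both components, as the
    fibre product demands.\<close>
  define u where "u c p v y = (tangent_lift M c p v, (p, y))" for c p v and y :: "nat \<Rightarrow> real"
  define g where "g c p v y = snd (f (u c p v y))" for c p v y
  have top: "p \<in> topspace ?X" if "c \<in> matlas M" "p \<in> fst c" for c p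
    using is_chartD(2)[OF atlas_chart[OF atlas that(1)]] that(2) by blast
  have fst_lift: "fst (tangent_lift M c p v) = p" for c p v by (simp add: tangent_lift_def)
  have uin: "u c p v y \<in> topspace (total ?E)" if "c \<in> matlas M" "p \<in> fst c" "y \<in> Euc k" for c p v y
    using that tangent_lift_in[OF atlas that(1,2), of v] top[OF that(1,2)] by (simp add: u_def E fst_lift)
  have fu: "f (u c p v y) = (p, g c p v y)" if "c \<in> matlas M" "p \<in> fst c" "y \<in> Euc k" for c p v y
    using fproj[OF uin[OF that, of v]] by (simp add: g_def u_def fst_lift prod_eq_iff)
  have lift_inj: "v = w" if "tangent_lift M c p v = tangent_lift M c p w" "c \<in> matlas M" "p \<in> fst c" for c p v w
    using fun_cong[OF arg_cong[OF that(1), of snd], of c] that(2,3) dtr_self[OF atlas that(2,3)]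
    by (simp add: tangent_lift_def)
  have lin: "linear_pair k (g c p)" if c: "c \<in> matlas M" "p \<in> fst c" for c p
    unfolding linear_pair_def
  proof (intro conjI allI ballI)
    fix v w x y assume xy: "x \<in> Euc k" "y \<in> Euc k"
    have ld: "linear (dtr c d p)" if "d \<in> matlas M" "p \<in> fst d" for d
      using linear_dtr[OF atlas c(1) that(1)] c(2) that(2) by blast
    have "(\<lambda>i. x i + y i) \<in> Euc k" using xy by (simp add: topspace_Euclidean_space)
    note s = fu[OF c this, of "v + w"]
    have "u c p (v + w) (\<lambda>i. x i + y i) = vadd ?E (u c p v x) (u c p w y)"
      by (auto simp: u_def whitney_sum_def tangent_bundle_def product_bundle_def tangent_lift_def fun_eq_iff
          linear_add[OF ld])
    also have "f \<dots> = vadd (product_bundle ?X k') (f (u c p v x)) (f (u c p w y))"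
    proof -
      have "proj ?E (u c p v x) = proj ?E (u c p w y)"
        by (simp add: u_def whitney_sum_def tangent_bundle_def fst_lift)
      then show ?thesis using f uin[OF c xy(1), of v] uin[OF c xy(2), of w] unfolding vbundle_iso_def by blast
    qed
    also have "\<dots> = (p, \<lambda>i. g c p v x i + g c p w y i)"
      unfolding fu[OF c xy(1)] fu[OF c xy(2)] by (simp add: product_bundle_def)
    finally show "g c p (v + w) (\<lambda>i. x i + y i) = (\<lambda>i. g c p v x i + g c p w y i)" unfolding s by simp
  next
    fix r v x assume x: "x \<in> Euc k"
    have ld: "linear (dtr c d p)" if "d \<in> matlas M" "p \<in> fst d" for d
      using linear_dtr[OF atlas c(1) that(1)] c(2) that(2) by blast
    have "(\<lambda>i. r * x i) \<in> Euc k" using x by (simp add: topspace_Euclidean_space)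
    note s = fu[OF c this, of "r *\<^sub>R v"]
    have "u c p (r *\<^sub>R v) (\<lambda>i. r * x i) = vscale ?E r (u c p v x)"
      by (auto simp: u_def whitney_sum_def tangent_bundle_def product_bundle_def tangent_lift_def fun_eq_iff
          linear_cmul[OF ld])
    also have "f \<dots> = vscale (product_bundle ?X k') r (f (u c p v x))"
      using f uin[OF c x, of v] unfolding vbundle_iso_def by blast
    also have "\<dots> = (p, \<lambda>i. r * g c p v x i)"
      unfolding fu[OF c x] by (simp add: product_bundle_def)
    finally show "g c p (r *\<^sub>R v) (\<lambda>i. r * x i) = (\<lambda>i. r * g c p v x i)" unfolding s by simp
  qed
  have nz: "ndet (CARD('m) + k) (pair_matrix k (g c p)) \<noteq> 0" if c: "c \<in> matlas M" "p \<in> fst c" for c p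
  proof (rule ndet_pair_matrix_nonzero[OF lin[OF c], of k'])
    have im: "f ` topspace (total ?E) = topspace ?X \<times> Euc k'"
      using homeomorphic_imp_surjective_map[OF hom] by simp
    show "g c p v y \<in> Euc k'" if "y \<in> Euc k" for v y
      using im fu[OF c that, of v] uin[OF c that, of v] by (metis SigmaD2 imageI)
    show "v = w \<and> x = y" if xy: "x \<in> Euc k" "y \<in> Euc k" "g c p v x = g c p w y" for v w x y
    proof -
      have "f (u c p v x) = f (u c p w y)" using fu[OF c] xy by simp
      then have "u c p v x = u c p w y"
        using inj_onD[OF homeomorphic_imp_injective_map[OF hom]] uin[OF c] xy(1,2) by blast
      then show ?thesis using lift_inj[OF _ c] by (simp add: u_def)
    qed
    show "\<exists>v. \<exists>y\<in>Euc k. g c p v y = y'" if y': "y' \<in> Euc k'" for y'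
    proof -
      have "(p, y') \<in> f ` topspace (total ?E)" using im top[OF c] y' by simp
      then obtain a where a: "a \<in> topspace (total ?E)" "f a = (p, y')" by auto
      obtain q w q' y where aw: "a = ((q, w), (q', y))" by (cases a) auto
      have q: "q = p" "q' = p" "y \<in> Euc k" "(p, w) \<in> tangent_vectors M"
        using fproj[OF a(1)] a unfolding aw E by auto
      have "a = u c p (w c) y" using tangent_lift_eq[OF atlas c q(4)] by (simp add: aw u_def q)
      then have "g c p (w c) y = y'" using a(2) by (simp add: g_def)
      then show ?thesis using q(3) by blast
    qed
  qed
  \<comment> \<open>With \<open>v\<close> and \<open>y\<close> fixed, each matrix entry is a
    component of the trivialization applied to a continuous local section.\<close>
  have cont: "continuous_on (snd c ` fst c) (\<lambda>z. g c (chart_inv c z) v y i)"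
    if c: "c \<in> matlas M" and y: "y \<in> Euc k" for c v y i
  proof -
    let ?Z = "top_of_set (snd c ` fst c)"
    have inv: "chart_inv c (snd c p) = p" if "p \<in> fst c" for p
      by (rule chart_inv_apply[OF atlas_chart[OF atlas c] that])
    have ci: "continuous_map ?Z ?X (chart_inv c)"
      using continuous_chart_inv[OF atlas_chart[OF atlas c]] by (simp add: continuous_map_in_subtopology)
    have "continuous_map ?Z (prod_topology (tangent_topology M) (prod_topology ?X (Euclidean_space k)))
        (\<lambda>z. u c (chart_inv c z) v y)"
      unfolding u_def using y
      by (intro continuous_map_pairedI continuous_tangent_lift[OF atlas c] ci) simp
    then have "continuous_map ?Z (total ?E) (\<lambda>z. u c (chart_inv c z) v y)"
      by (auto simp: whitney_sum_def tangent_bundle_def product_bundle_def continuous_map_in_subtopology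
          u_def fst_lift)
    from continuous_map_compose[OF this homeomorphic_imp_continuous_map[OF hom]]
    have "continuous_map ?Z (Euclidean_space k') (snd \<circ> (f \<circ> (\<lambda>z. u c (chart_inv c z) v y)))"
      by (rule continuous_map_compose[OF _ continuous_map_snd])
    then have "continuous_map ?Z (powertop_real UNIV) (\<lambda>z. g c (chart_inv c z) v y)"
      unfolding Euclidean_space_def continuous_map_in_subtopology by (simp add: o_def g_def)
    then have "continuous_map ?Z euclideanreal (\<lambda>z. g c (chart_inv c z) v y i)"
      by (simp add: continuous_map_componentwise_UNIV)
    then show ?thesis by simp
  qed
  define \<sigma> where "\<sigma> c z = ndet (CARD('m) + k) (pair_matrix k (g c (chart_inv c z)))" for c z
  have sigma: "\<sigma> c (snd c p) = ndet (CARD('m) + k) (pair_matrix k (g c p))" if "c \<in> matlas M" "p \<in> fst c" for c p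
    unfolding \<sigma>_def chart_inv_apply[OF atlas_chart[OF atlas that(1)] that(2)] ..
  have "continuous_on (snd c ` fst c) (\<sigma> c)" if c: "c \<in> matlas M" for c
    unfolding \<sigma>_def pair_matrix_def by (intro continuous_on_ndet cont[OF c] basis2_in)
  moreover have "\<sigma> c (snd c p) \<noteq> 0" if "c \<in> matlas M" "p \<in> fst c" for c p
    unfolding sigma[OF that] by (rule nz[OF that])
  moreover have "sgn (\<sigma> c (snd c p)) = sgn (det (matrix (dtr c d p))) * sgn (\<sigma> d (snd d p))"
    if cd: "c \<in> matlas M" "d \<in> matlas M" "p \<in> fst c \<inter> fst d" for c d p
  proof -
    have p: "p \<in> fst c" "p \<in> fst d" using cd by auto
    have "g c p v y = g d p (dtr c d p v) y" for v y
      using tangent_lift_change[OF atlas cd(1,2) p, of v] by (simp add: g_def u_def)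
    then have "pair_matrix k (g c p) i j = (\<Sum>l<CARD('m) + k. pair_matrix k (g d p) i l * stab (matrix (dtr c d p)) l j)"
      if "j < CARD('m) + k" for i j
      using that by (intro pair_matrix_comp[OF lin[OF cd(2) p(2)] _ linear_dtr[OF atlas cd]])
    then have "ndet (CARD('m) + k) (pair_matrix k (g c p)) =
       ndet (CARD('m) + k) (pair_matrix k (g d p)) * ndet (CARD('m) + k) (stab (matrix (dtr c d p)))"
      unfolding ndet_mult[symmetric] by (intro ndet_cong)
    then show ?thesis
      unfolding sigma[OF cd(1) p(1)] sigma[OF cd(2) p(2)]
      by (simp add: sgn_mult sgn_ndet_stab[OF invertible_dtr[OF atlas cd(1,2) p]])
  qed
  ultimately show ?thesis unfolding orientation_sign_def by blast
qed

section \<open>The mapping torus\<close>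

lemma sum_option: "(\<Sum>x\<in>UNIV. f x) = f None + (\<Sum>x\<in>(UNIV :: 'n::finite set). f (Some x))"
  by (simp add: UNIV_option_conv sum.reindex)

lemma prod_option: "(\<Prod>x\<in>UNIV. f x) = f None * (\<Prod>x\<in>(UNIV :: 'n::finite set). f (Some x))"
  by (simp add: UNIV_option_conv prod.reindex)

text \<open>For \<open>Q = rmat A\<close> this is the linear part of \<open>deck A\<close>; the
  entry 1 belongs to the interval coordinate \<open>None\<close>.\<close>

definition extend :: "real^'n^'n \<Rightarrow> real^('n option)^('n option)" where
  "extend Q = (\<chi> i j. case i of None \<Rightarrow> if j = None then 1 else 0
     | Some a \<Rightarrow> (case j of None \<Rightarrow> 0 | Some b \<Rightarrow> Q $ a $ b))"

lemma extend_apply: "extend Q *v v = coord_join (Q *v torus_part v) (v $ None)"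
  by (auto simp: vec_eq_iff matrix_vector_mult_def sum_option extend_def coord_join_def torus_part_def
      split: option.split)

lemma extend_mult: "extend (Q ** R) = extend Q ** extend R"
  by (auto simp: vec_eq_iff matrix_matrix_mult_def sum_option extend_def split: option.split)

lemma extend_one: "extend (mat 1) = mat 1"
  by (auto simp: vec_eq_iff mat_def extend_def split: option.split)

lemma invertible_extend: "invertible Q \<Longrightarrow> invertible (extend Q)"
  unfolding invertible_def by (metis extend_mult extend_one)

lemma continuous_on_extend:
  assumes "continuous_on S Q" shows "continuous_on S (\<lambda>t. extend (Q t))"
  unfolding extend_def
proof (intro continuous_on_vec_lambda)
  fix i j :: "'b option"
  show "continuous_on S (\<lambda>t. case i of None \<Rightarrow> if j = None then 1 else 0
     | Some a \<Rightarrow> (case j of None \<Rightarrow> 0 | Some b \<Rightarrow> Q t $ a $ b))"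
    using assms by (cases i; cases j) (auto intro: continuous_intros)
qed

text \<open>Again only the sign is compared: \<open>extend\<close> preserves invertibility, fixes
  the identity, and keeps an axis reflection diagonal with a single \<open>- 1\<close>.\<close>

lemma sgn_det_extend:
  fixes M :: "real^'n^'n"
  assumes "invertible M" shows "sgn (det (extend M)) = sgn (det M)"
proof (rule sgn_det_unique[OF _ _ _ _ assms, of "\<lambda>M. det (extend M)" undefined])
  show "continuous_on GL (\<lambda>M :: real^'n^'n. det (extend M))"
    by (intro continuous_on_compose2[OF continuous_on_det[of UNIV]] continuous_on_extend continuous_on_id) auto
  show "det (extend M) \<noteq> 0" if "invertible M" for M :: "real^'n^'n"
    using invertible_extend[OF that] by (simp add: invertible_det_nz)
  show "det (extend (mat 1 :: real^'n^'n)) > 0" by (simp add: extend_one)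
  have "det (extend (reflection (axis undefined 1)) :: real^('n option)^('n option))
      = (\<Prod>i\<in>UNIV. extend (reflection (axis undefined 1 :: real^'n)) $ i $ i)"
    by (rule det_diagonal) (auto simp: extend_def reflection_axis split: option.split, metis option.exhaust)
  also have "\<dots> = (\<Prod>i\<in>(UNIV :: 'n set). if i = undefined then - 1 else 1)"
    by (simp add: prod_option extend_def reflection_axis)
  finally show "det (extend (reflection (axis undefined 1)) :: real^('n option)^('n option)) < 0" by simp
qed

lemma det_rmat: "det (rmat A) = of_int (det A)"
  by (simp add: det_def of_int_sum of_int_prod)

section \<open>Transition maps of the mapping torus\<close>

context
  fixes A :: "int^'n^'n" assumes A: "invertible A"
begin

text \<open>Unlike \<open>param_transition\<close>, this keeps the explicit affine map together with
  the interval coordinates on both sides. The case \<open>deck_inv\<close> is the case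
  \<open>deck\<close> read backwards, so no formula is recorded there.\<close>

lemma mt_overlap:
  assumes "(P, J) \<in> mt_params A" "(Q, K) \<in> mt_params A" "z $ None \<in> J" "w $ None \<in> K" "P z = Q w"
  obtains (shift) c where "w $ None = z $ None" "w = z + c"
      "\<And>y. y $ None \<in> J \<Longrightarrow> (y + c) $ None \<in> K \<Longrightarrow> P y = Q (y + c)"
    | (deck) c where "z $ None < 0" "w $ None = z $ None + 1" "w = deck A z + c"
      "\<And>y. y $ None < 0 \<Longrightarrow> y $ None \<in> J \<Longrightarrow> (deck A y + c) $ None \<in> K \<Longrightarrow> P y = Q (deck A y + c)"
    | (deck_inv) "w $ None < 0" "z $ None = w $ None + 1"
proof -
  have *: thesis if eq: "cyl_proj z = cyl_proj w"
    and PQ: "\<And>y c. cyl_proj (y + c) = cyl_proj y \<Longrightarrow> y $ None \<in> J \<Longrightarrow> (y + c) $ None \<in> K \<Longrightarrow> P y = Q (y + c)"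
  proof -
    obtain c where c: "w = z + c" "\<And>y. cyl_proj (y + c) = cyl_proj y" using cyl_translate[OF A eq] by blast
    have "w $ None = z $ None" using eq by (simp add: cyl_proj_eq)
    then show thesis using c PQ by (intro shift) auto
  qed
  consider "P = interior_param A" "J = {0<..<1}" "Q = interior_param A" "K = {0<..<1}"
    | "P = interior_param A" "J = {0<..<1}" "Q = seam_param A" "K = {-1/2<..<1/2}"
    | "P = seam_param A" "J = {-1/2<..<1/2}" "Q = interior_param A" "K = {0<..<1}"
    | "P = seam_param A" "J = {-1/2<..<1/2}" "Q = seam_param A" "K = {-1/2<..<1/2}"
    using assms(1,2) by (auto simp: mt_params_def[OF A])
  then show thesis
  proof cases
    case 1
    have "interior_param A y = interior_param A (y + c)"
      if "cyl_proj (y + c) = cyl_proj y" "y $ None \<in> J" "(y + c) $ None \<in> K" for y c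
      using ii_eq[OF A, of y "y + c"] that 1 by simp
    then show thesis using * ii_eq[OF A, of z w] assms 1 by blast
  next
    case 4
    have "seam_param A y = seam_param A (y + c)"
      if "cyl_proj (y + c) = cyl_proj y" "y $ None \<in> J" "(y + c) $ None \<in> K" for y c
      using ss_eq[OF A, of y "y + c"] that 4 by simp
    then show thesis using * ss_eq[OF A, of z w] assms 4 by blast
  next
    case 2
    then have "0 < w $ None \<and> cyl_proj z = cyl_proj w \<or> w $ None < 0 \<and> cyl_proj z = cyl_proj (deck A w)"
      using is_eq[OF A, of z w] assms by auto
    then show thesis
    proof (elim disjE conjE)
      assume "0 < w $ None" "cyl_proj z = cyl_proj w"
      moreover have "interior_param A y = seam_param A (y + c)"
        if "cyl_proj (y + c) = cyl_proj y" "y $ None \<in> J" "(y + c) $ None \<in> K" for y c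
        using is_eq[OF A, of y "y + c"] that 2 by (auto simp: cyl_proj_eq)
      ultimately show thesis using * 2 by blast
    next
      assume "w $ None < 0" "cyl_proj z = cyl_proj (deck A w)"
      then show thesis by (intro deck_inv) (simp_all add: cyl_proj_eq deck_None[OF A])
    qed
  next
    case 3
    then have "0 < z $ None \<and> cyl_proj w = cyl_proj z \<or> z $ None < 0 \<and> cyl_proj w = cyl_proj (deck A z)"
      using is_eq[OF A, of w z] assms by auto
    then show thesis
    proof (elim disjE conjE)
      assume "0 < z $ None" "cyl_proj w = cyl_proj z"
      moreover have "seam_param A y = interior_param A (y + c)"
        if "cyl_proj (y + c) = cyl_proj y" "y $ None \<in> J" "(y + c) $ None \<in> K" for y c
        using is_eq[OF A, of "y + c" y] that 3 by (auto simp: cyl_proj_eq)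
      ultimately show thesis using *[OF sym] 3 by blast
    next
      assume w: "z $ None < 0" "cyl_proj w = cyl_proj (deck A z)"
      obtain c where c: "w = deck A z + c" "\<And>y. cyl_proj (y + c) = cyl_proj y"
        using cyl_translate[OF A w(2)[symmetric]] by blast
      \<comment> \<open>The formula with \<open>deck A\<close> is confined to
        \<open>y $ None < 0\<close>: above the seam, a seam chart and an interior chart are related
        by a translation instead.\<close>
      have "seam_param A y = interior_param A (deck A y + c)"
        if "y $ None < 0" "y $ None \<in> J" "(deck A y + c) $ None \<in> K" for y
        using that c(2)[of "deck A y"] is_eq[OF A, of "deck A y + c" y] 3 by auto
      then show thesis using w c 3 by (intro deck) (simp_all add: cyl_proj_eq deck_None[OF A])
    qed
  qed
qed

lemma matlas_cases:
  assumes "c \<in> matlas (mapping_torus A)"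
  obtains P J W where "(P, J) \<in> mt_params A" "c = inverse_chart P (coord_box W J)"
    "open (coord_box W J)" "inj_on P (coord_box W J)"
proof -
  obtain P J W where "(P, J) \<in> mt_params A" "open W" "inj_on torus_proj W" "c = inverse_chart P (coord_box W J)"
    using assms unfolding matlas_eq[OF A] by blast
  then show thesis
    using param_chart(3,4)[OF A] by (intro that[of P J W] open_coord_box) auto
qed

lemma inverse_chart_apply:
  assumes "p \<in> fst (inverse_chart P D)"
  shows "snd (inverse_chart P D) p \<in> D" "P (snd (inverse_chart P D) p) = p"
  using assms by (auto simp: inverse_chart_def f_inv_into_f inv_into_into)

lemma transition_has_derivative:
  assumes D: "open D" "inj_on P D" "z \<in> D" and E: "open E" "inj_on Q E"
    and L: "bounded_linear L" "L z + a \<in> E"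
    and N: "open N" "z \<in> N" "\<And>y. y \<in> N \<Longrightarrow> y \<in> D \<Longrightarrow> L y + a \<in> E \<Longrightarrow> P y = Q (L y + a)"
  shows "frechet_derivative (transition (inverse_chart P D) (inverse_chart Q E)) (at z) = L"
proof -
  let ?N = "N \<inter> D \<inter> (\<lambda>y. L y + a) -` E"
  have "open ?N" using N(1) D(1) E(1)
    by (intro open_Int open_vimage continuous_intros bounded_linear.continuous_on[OF L(1)])
  moreover have "z \<in> ?N" using N D L by simp
  moreover have "L y + a = transition (inverse_chart P D) (inverse_chart Q E) y" if "y \<in> ?N" for y
    using that N(3)[of y] E(2) by (simp add: transition_inverse_chart[OF A D(2)])
  ultimately have "(transition (inverse_chart P D) (inverse_chart Q E) has_derivative L) (at z)"
    by (rule has_derivative_transform_within_open[OF has_derivative_add_const[OF bounded_linear_imp_has_derivative[OF L(1)]]])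
  then show ?thesis by (rule frechet_derivative_at[symmetric])
qed

text \<open>The three cases differ in how the interval coordinate changes, by 0, 1 or -1. Later
  arguments discard cases by comparing these numbers alone.\<close>

lemma dtr_mt:
  assumes c: "c \<in> matlas (mapping_torus A)" and d: "d \<in> matlas (mapping_torus A)"
    and p: "p \<in> fst c" "p \<in> fst d"
  obtains (shift) "snd d p $ None = snd c p $ None" "dtr c d p = (\<lambda>v. v)"
    | (deck) "snd c p $ None < 0" "snd d p $ None = snd c p $ None + 1" "dtr c d p = (*v) (extend (rmat A))"
    | (deck_inv) "snd d p $ None < 0" "snd c p $ None = snd d p $ None + 1"
proof -
  obtain P J W where P: "(P, J) \<in> mt_params A" "c = inverse_chart P (coord_box W J)"
    "open (coord_box W J)" "inj_on P (coord_box W J)" using matlas_cases[OF c] .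
  obtain Q K V where Q: "(Q, K) \<in> mt_params A" "d = inverse_chart Q (coord_box V K)"
    "open (coord_box V K)" "inj_on Q (coord_box V K)" using matlas_cases[OF d] .
  define z where "z = snd c p"
  define w where "w = snd d p"
  have z: "z \<in> coord_box W J" "P z = p" using inverse_chart_apply[of p P] p P(2) by (simp_all add: z_def)
  have w: "w \<in> coord_box V K" "Q w = p" using inverse_chart_apply[of p Q] p Q(2) by (simp_all add: w_def)
  have box: "y $ None \<in> J" if "y \<in> coord_box W J" for y using that by (simp add: coord_box_def)
  have box': "y $ None \<in> K" if "y \<in> coord_box V K" for y using that by (simp add: coord_box_def)
  have PQ: "P z = Q w" using z w by simp
  show thesis
    using P(1) Q(1) box[OF z(1)] box'[OF w(1)] PQ
  proof (cases rule: mt_overlap)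
    case (shift a)
    have "frechet_derivative (transition c d) (at z) = (\<lambda>v. v)" unfolding P(2) Q(2)
    proof (rule transition_has_derivative[OF P(3,4) z(1) Q(3,4) bounded_linear_ident _ open_UNIV UNIV_I])
      show "z + a \<in> coord_box V K" using w(1) by (simp only: shift(2))
      show "P y = Q (y + a)" if "y \<in> coord_box W J" "y + a \<in> coord_box V K" for y
        using box[OF that(1)] box'[OF that(2)] by (rule shift(3))
    qed
    then show thesis using that(1) shift(1) by (simp add: z_def w_def)
  next
    case (deck a)
    let ?L = "(*v) (extend (rmat A))"
    \<comment> \<open>The unit shift of the interval coordinate joins the translation part, leaving
      \<open>extend (rmat A)\<close> as the derivative.\<close>
    have dk: "deck A y + a = ?L y + (coord_join 0 1 + a)" for y
      by (simp add: deck_affine[OF A] extend_apply)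
    have neg: "open {y :: real^('n option). y $ None < 0}"
      by (auto intro!: open_Collect_less continuous_intros)
    have "frechet_derivative (transition c d) (at z) = ?L" unfolding P(2) Q(2)
    proof (rule transition_has_derivative[OF P(3,4) z(1) Q(3,4) matrix_vector_mul_bounded_linear _ neg])
      show "?L z + (coord_join 0 1 + a) \<in> coord_box V K" using w(1) by (simp only: deck(3) dk)
      show "z \<in> {y. y $ None < 0}" using deck(1) by simp
      show "P y = Q (?L y + (coord_join 0 1 + a))"
        if "y \<in> {y. y $ None < 0}" "y \<in> coord_box W J" "?L y + (coord_join 0 1 + a) \<in> coord_box V K" for y
        using that(1) box[OF that(2)] box'[OF that(3)] deck(4)[of y] unfolding dk by blast
    qed
    then show thesis using that(2) deck(1,2) by (simp add: z_def w_def)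
  next
    case deck_inv
    then show thesis using that(3) by (simp add: z_def w_def)
  qed
qed

text \<open>Translations have derivative 1, so a frame depending only on the interval coordinate is
  compatible with them; only the transition across the seam imposes a condition on
  \<open>Q\<close>.\<close>

lemma parallelizable_mt:
  assumes "det A = 1" shows "parallelizable (mapping_torus A)"
proof -
  have "det (rmat A) > 0" using assms by (simp add: det_rmat)
  from path_component_det_pos[OF this]
  obtain g where g: "path g" "path_image g \<subseteq> GL" "g 0 = rmat A" "g 1 = mat 1"
    unfolding path_component_def pathstart_def pathfinish_def by blast
  have g_inv: "invertible (g t)" if "t \<in> {0..1}" for t using g(2) that by (auto simp: path_image_def image_subset_iff)
  define Q where "Q t = (if 0 \<le> t then g t else g (t + 1) ** rmat A)" for t
  have "continuous_on ({0..1} \<union> {- 1..0}) Q" unfolding Q_def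
  proof (rule continuous_on_cases)
    show "continuous_on {0..1} g" using g(1) by (simp add: path_def)
    have "continuous_on {- 1..0} (\<lambda>t. g (t + 1))"
      by (rule continuous_on_compose2[OF g(1)[unfolded path_def]]) (auto intro: continuous_intros)
    then show "continuous_on {- 1..0} (\<lambda>t. g (t + 1) ** rmat A)"
      unfolding matrix_matrix_mult_def by (intro continuous_intros)
  qed (use g(3,4) in auto)
  then have contQ: "continuous_on {- 1..1} Q" by (rule continuous_on_subset) auto
  have invQ: "invertible (Q t)" if "t \<in> {- 1..1}" for t
    using that g_inv[of t] g_inv[of "t + 1"] invertible_rmat[OF A] by (auto simp: Q_def invertible_mult)
  note atlas = smooth_atlas_mt[OF A]
  have rng: "z $ None \<in> {- 1..1}" if c: "c \<in> matlas (mapping_torus A)" and z: "z \<in> snd c ` fst c" for c z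
  proof -
    obtain P J W where P: "(P, J) \<in> mt_params A" "c = inverse_chart P (coord_box W J)"
      by (rule matlas_cases[OF c])
    have "z \<in> coord_box W J" using z inverse_chart_apply(1)[of _ P "coord_box W J"] P(2) by blast
    then have "z $ None \<in> J" by (simp add: coord_box_def)
    then show ?thesis using P(1) by (auto simp: mt_params_def[OF A])
  qed
  let ?T = "\<lambda>z. extend (Q (z $ None))"
  show ?thesis
  proof (rule parallelizable_if_frames[OF atlas, of "\<lambda>c. ?T"])
    fix c assume c: "c \<in> matlas (mapping_torus A)"
    show "continuous_on (snd c ` fst c) ?T"
      by (intro continuous_on_extend continuous_on_compose2[OF contQ] continuous_intros) (use rng[OF c] in auto)
    show "invertible (?T (snd c p))" if "p \<in> fst c" for p
      using that by (intro invertible_extend invQ rng[OF c]) auto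
  next
    have dk: "?T (snd d p) *v dtr c d p v = ?T (snd c p) *v v"
      if "snd c p $ None < 0" "snd d p $ None = snd c p $ None + 1" "dtr c d p = (*v) (extend (rmat A))"
        "c \<in> matlas (mapping_torus A)" "p \<in> fst c"
      for c d :: "(((real^'n) set \<times> real) set, 'n option) chart" and p v
    proof -
      have "snd c p $ None \<in> {- 1..1}" by (rule rng[OF that(4)]) (use that(5) in blast)
      \<comment> \<open>The bound from below by \<open>- 1\<close> puts the coordinate in
        \<open>d\<close> on the nonnegative branch of \<open>Q\<close>, while the one in
        \<open>c\<close> lies on the negative branch.\<close>
      then have "Q (snd c p $ None) = Q (snd d p $ None) ** rmat A" using that(1,2) by (simp add: Q_def)
      then show ?thesis by (simp add: that(3) extend_mult matrix_vector_mul_assoc)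
    qed
    fix c d p v
    assume c: "c \<in> matlas (mapping_torus A)" "p \<in> fst c" and d: "d \<in> matlas (mapping_torus A)" "p \<in> fst d"
    from c(1) d(1) c(2) d(2) show "?T (snd d p) *v dtr c d p v = ?T (snd c p) *v v"
    proof (cases rule: dtr_mt)
      case shift
      then show ?thesis by simp
    next
      case deck
      then show ?thesis using dk c by blast
    next
      case deck_inv
      \<comment> \<open>The reverse transition is of type \<open>deck\<close>; its compatibility is
        composed with \<open>dtr c d p\<close>, and the cocycle condition cancels the two
        derivatives.\<close>
      from d(1) c(1) d(2) c(2) show ?thesis
      proof (cases rule: dtr_mt)
        case deck
        then have "?T (snd c p) *v dtr d c p (dtr c d p v) = ?T (snd d p) *v dtr c d p v" using dk d by blast
        then show ?thesis using dtr_comp[OF atlas c(1) d(1) c(1,2) d(2) c(2)] dtr_self[OF atlas c] by simp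
      qed (use deck_inv in linarith)+
    qed
  qed
qed

lemma no_orientation_sign_mt:
  assumes "det A = - 1" shows "\<not> orientation_sign (mapping_torus A) \<sigma>"
proof
  assume os: "orientation_sign (mapping_torus A) \<sigma>"
  \<comment> \<open>A ball of radius 1/2 injects into the torus, and its convexity makes both
    coordinate boxes path connected.\<close>
  let ?W = "ball (0 :: real^'n) (1/2)"
  let ?D = "coord_box ?W {0<..<1}" and ?E = "coord_box ?W {-1/2<..<1/2}"
  let ?c = "inverse_chart (interior_param A) ?D" and ?d = "inverse_chart (seam_param A) ?E"
  have par: "(interior_param A, {0<..<1}) \<in> mt_params A" "(seam_param A, {-1/2<..<1/2}) \<in> mt_params A"
    by (simp_all add: mt_params_def[OF A])
  have inj: "inj_on (interior_param A) ?D" "inj_on (seam_param A) ?E"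
    by (rule param_chart(3)[OF A par(1) inj_on_torus_proj_ball[OF A]] param_chart(3)[OF A par(2) inj_on_torus_proj_ball[OF A]])+
  have "inverse_chart P (coord_box ?W J) \<in> matlas (mapping_torus A)" if "(P, J) \<in> mt_params A" for P J
    unfolding matlas_eq[OF A] mem_Collect_eq
    by (intro exI[of _ P] exI[of _ J] exI[of _ ?W] conjI refl that open_ball inj_on_torus_proj_ball[OF A])
  note c = this[OF par(1)] and d = this[OF par(2)]
  have chart: "snd (inverse_chart P D) (P z) = z" "P z \<in> fst (inverse_chart P D)" if "inj_on P D" "z \<in> D"
    for P :: "real^('n option) \<Rightarrow> ((real^'n) set \<times> real) set" and D z
    using that by (auto simp: inverse_chart_def)
  have const: "sgn (\<sigma> (inverse_chart P (coord_box ?W J)) z) = sgn (\<sigma> (inverse_chart P (coord_box ?W J)) w)"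
    if "inverse_chart P (coord_box ?W J) \<in> matlas (mapping_torus A)" "inj_on P (coord_box ?W J)" "convex J"
      "z \<in> coord_box ?W J" "w \<in> coord_box ?W J" for P J z w
  proof -
    let ?B = "coord_box ?W J"
    have im: "snd (inverse_chart P ?B) ` fst (inverse_chart P ?B) = ?B"
      using that(2) by (simp add: inverse_chart_def inv_into_image_cancel)
    have "?B = torus_part -` ?W \<inter> (\<lambda>z. z $ None) -` J" by (auto simp: coord_box_def)
    also have "convex \<dots>"
      by (intro convex_Int convex_linear_vimage convex_ball that(3)
          bounded_linear.linear bounded_linear_torus_part bounded_linear_vec_nth)
    finally have "convex ?B" .
    then have "path_component ?B z w"
      using that(4,5) convex_imp_path_connected path_connected_component by blast
    moreover have "continuous_on ?B (\<sigma> (inverse_chart P ?B))"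
      using os that(1) im unfolding orientation_sign_def by metis
    moreover have "\<sigma> (inverse_chart P ?B) x \<noteq> 0" if "x \<in> ?B" for x
    proof -
      obtain p where "p \<in> fst (inverse_chart P ?B)" "x = snd (inverse_chart P ?B) p"
        using \<open>x \<in> ?B\<close> im by blast
      then show ?thesis
        using os \<open>inverse_chart P ?B \<in> matlas (mapping_torus A)\<close> unfolding orientation_sign_def by blast
    qed
    ultimately show ?thesis by (rule sgn_path_component)
  qed
  \<comment> \<open>Signs are compared from the seam chart to the interior chart, the direction in
    which \<open>dtr_mt\<close> gives the derivative explicitly.\<close>
  have sg: "sgn (\<sigma> ?d (snd ?d p)) = sgn (det (matrix (dtr ?d ?c p))) * sgn (\<sigma> ?c (snd ?c p))"
    if "p \<in> fst ?c" "p \<in> fst ?d" for p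
    using os c d that unfolding orientation_sign_def by blast
  \<comment> \<open>One point in each piece of the overlap. At height 1/4 both charts have the same
    coordinates \<open>z1\<close>; height 3/4 in the interior chart is height -1/4 in the seam
    chart. The torus part 0 is fixed by \<open>A\<close>, so \<open>deck A w2\<close> is exactly
    \<open>z2\<close>.\<close>
  define z1 z2 w2 :: "real^('n option)" where "z1 = coord_join 0 (1/4)" and "z2 = coord_join 0 (3/4)"
    and "w2 = coord_join 0 (-1/4)"
  have mem: "z1 \<in> ?D" "z2 \<in> ?D" "z1 \<in> ?E" "w2 \<in> ?E" by (auto simp: coord_box_def z1_def z2_def w2_def)
  have e1: "interior_param A z1 = seam_param A z1"
    by (subst is_eq[OF A]) (auto simp: z1_def)
  have "deck A w2 = z2" by (simp add: deck_def w2_def z2_def)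
  then have e2: "interior_param A z2 = seam_param A w2"
    by (subst is_eq[OF A]) (auto simp: z2_def w2_def)
  let ?p = "interior_param A z1" and ?q = "interior_param A z2"
  have p: "?p \<in> fst ?c" "?p \<in> fst ?d" "snd ?c ?p = z1" "snd ?d ?p = z1"
    using chart[OF inj(1) mem(1)] chart[OF inj(2) mem(3)] e1 by auto
  have q: "?q \<in> fst ?c" "?q \<in> fst ?d" "snd ?c ?q = z2" "snd ?d ?q = w2"
    using chart[OF inj(1) mem(2)] chart[OF inj(2) mem(4)] e2 by auto
  have "det (matrix (dtr ?d ?c ?p)) = 1"
    using d c p(2,1)
  proof (cases rule: dtr_mt)
    case shift
    then show ?thesis by (simp only: matrix_id_mat_1[unfolded id_def] det_I)
  qed (use p in \<open>auto simp: z1_def\<close>)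
  then have s1: "sgn (\<sigma> ?d z1) = sgn (\<sigma> ?c z1)" using sg[OF p(1,2)] p(3,4) by simp
  have "sgn (det (matrix (dtr ?d ?c ?q))) = - 1"
    using d c q(2,1)
  proof (cases rule: dtr_mt)
    case deck
    then show ?thesis using sgn_det_extend[OF invertible_rmat[OF A]] assms by (simp add: det_rmat)
  qed (use q in \<open>auto simp: z2_def w2_def\<close>)
  then have s2: "sgn (\<sigma> ?d w2) = - sgn (\<sigma> ?c z2)" using sg[OF q(1,2)] q(3,4) by simp
  have "sgn (\<sigma> ?d z1) = sgn (\<sigma> ?d w2)" by (rule const[OF d inj(2) _ mem(3,4)]) simp
  moreover have "sgn (\<sigma> ?c z1) = sgn (\<sigma> ?c z2)" by (rule const[OF c inj(1) _ mem(1,2)]) simp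
  \<comment> \<open>Going around once, from \<open>z1\<close> to \<open>w2\<close> in the seam
    chart, over to \<open>z2\<close> and back to \<open>z1\<close> in the interior chart, reverses
    the sign.\<close>
  ultimately have "\<sigma> ?c z1 = 0" using s1 s2 by (simp add: sgn_0_0)
  moreover have "\<sigma> ?c (snd ?c ?p) \<noteq> 0" using os c p(1) unfolding orientation_sign_def by blast
  ultimately show False by (simp only: p(3))
qed

end

theorem theorem3p3:
  fixes A :: "int^'n^'n"
  assumes "invertible A"
  shows "(det A = 1 \<longrightarrow> parallelizable (mapping_torus A)) \<and>
         (det A = -1 \<longrightarrow> \<not> orientable (mapping_torus A) \<and>
                           \<not> stably_parallelizable (mapping_torus A))"
  using parallelizable_mt[OF assms] no_orientation_sign_mt[OF assms]
    orientation_sign_if_orientable[OF smooth_atlas_mt[OF assms]]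
    orientation_sign_if_stably_parallelizable[OF smooth_atlas_mt[OF assms]]
  by blast

end
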